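(* Let $(\mathcal{U}_{\geq0},\mathcal{U}_{\leq0})$ be a pre-weight structure on a triangulated category $\mathcal{T}$. Then we have a semi-orthogonal decomposition $\mathcal{T}/\mathcal{U}_b=\langle\mathcal{U}_-/\mathcal{U}_b,\ \mathcal{U}_+/\mathcal{U}_b\rangle$. Consequently, the following two canonical functors $$\mathcal{U}_+/\mathcal{U}_b\longrightarrow\mathcal{T}/\mathcal{U}_-\quad\text{and}\quad\mathcal{U}_-/\mathcal{U}_b\longrightarrow\mathcal{T}/\mathcal{U}_+$$ are triangle equivalences.
   Context: Let $\Sigma$ be the suspension functor of $\mathcal{T}$. For full subcategories $\mathcal{X},\mathcal{Y}$, $\mathcal{X}\ast\mathcal{Y}$ is the full subcategory of objects $Z$ fitting into an exact triangle $X\to Z\to Y\to\Sigma(X)$ with $X\in\mathcal{X}$, $Y\in\mathcal{Y}$; $\mathcal{X}$ is closed under extensions if $\mathcal{X}\ast\mathcal{X}\subseteq\mathcal{X}$. A pre-weight structure on $\mathcal{T}$ is a pair $(\mathcal{U}_{\geq0},\mathcal{U}_{\leq0})$ of full additive subcategories such that (1) $\mathcal{U}_{\geq0}\ast\Sigma(\mathcal{U}_{\leq0})=\mathcal{T}$; (2) $\mathcal{U}_{\geq0}$ is closed under $\Sigma^{-1}$ and extensions; (3) $\mathcal{U}_{\leq0}$ is closed under $\Sigma$ and extensions. Put $\mathcal{U}_{\geq m}=\Sigma^{-m}(\mathcal{U}_{\geq0})$, $\mathcal{U}_{\leq m}=\Sigma^{-m}(\mathcal{U}_{\leq0})$, $\mathcal{U}_{[m,n]}=\mathcal{U}_{\geq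 m}\cap\mathcal{U}_{\leq n}$ for $m\le n$, $\mathcal{U}_+=\bigcup_{m\in\mathbb{Z}}\mathcal{U}_{\geq m}$, $\mathcal{U}_-=\bigcup_{m\in\mathbb{Z}}\mathcal{U}_{\leq m}$ and $\mathcal{U}_b=\bigcup_{m\leq n}\mathcal{U}_{[m,n]}=\mathcal{U}_+\cap\mathcal{U}_-$; these three are triangulated subcategories of $\mathcal{T}$. Quotients are Verdier quotients; $\mathcal{U}_\pm/\mathcal{U}_b$ are viewed as triangulated subcategories of $\mathcal{T}/\mathcal{U}_b$. A semi-orthogonal decomposition $\mathcal{S}=\langle\mathcal{Y},\mathcal{X}\rangle$ of a triangulated category $\mathcal{S}$ consists of two triangulated subcategories $\mathcal{X},\mathcal{Y}$ with $\mathcal{X}\ast\mathcal{Y}=\mathcal{S}$ and $\mathrm{Hom}_{\mathcal{S}}(X,Y)=0$ for all $X\in\mathcal{X}$, $Y\in\mathcal{Y}$. The canonical functors are those induced by the inclusions $\mathcal{U}_+\hookrightarrow\mathcal{T}$ and $\mathcal{U}_-\hookrightarrow\mathcal{T}$. *)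

theory Defs
  imports "HOL-Algebra.Group"
begin

section \<open>Categories and functors\<close>

record ('o, 'm) category_data =
  Ob :: "'o set"
  Ar :: "'m set"
  Dom :: "'m \<Rightarrow> 'o"
  Cod :: "'m \<Rightarrow> 'o"
  Id :: "'o \<Rightarrow> 'm"
  Cmp :: "'m \<Rightarrow> 'm \<Rightarrow> 'm"  (infixl "\<cdot>\<index>" 70)

text \<open>Composition is in applicative order: \<open>g \<cdot>\<^bsub>C\<^esub> f\<close> is ``first \<open>f\<close>, then \<open>g\<close>''.\<close>

definition Mor :: "('o, 'm, 'z) category_data_scheme \<Rightarrow> 'o \<Rightarrow> 'o \<Rightarrow> 'm set" where
  "Mor C X Y = {f \<in> Ar C. Dom C f = X \<and> Cod C f = Y}"

locale category =
  fixes C :: "('o, 'm, 'z) category_data_scheme" (structure)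
  assumes Dom_Ob: "f \<in> Ar C \<Longrightarrow> Dom C f \<in> Ob C"
    and Cod_Ob: "f \<in> Ar C \<Longrightarrow> Cod C f \<in> Ob C"
    and Id_Mor: "X \<in> Ob C \<Longrightarrow> Id C X \<in> Mor C X X"
    and Cmp_Mor: "f \<in> Mor C X Y \<Longrightarrow> g \<in> Mor C Y Z \<Longrightarrow> g \<cdot> f \<in> Mor C X Z"
    and Cmp_Id_right: "f \<in> Mor C X Y \<Longrightarrow> f \<cdot> Id C X = f"
    and Cmp_Id_left: "f \<in> Mor C X Y \<Longrightarrow> Id C Y \<cdot> f = f"
    and Cmp_assoc: "f \<in> Mor C W X \<Longrightarrow> g \<in> Mor C X Y \<Longrightarrow> h \<in> Mor C Y Z \<Longrightarrow>
      h \<cdot> (g \<cdot> f) = (h \<cdot> g) \<cdot> f"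

definition is_isomorphism :: "('o, 'm, 'z) category_data_scheme \<Rightarrow> 'm \<Rightarrow> bool" where
  "is_isomorphism C f \<longleftrightarrow> f \<in> Ar C \<and> (\<exists>g \<in> Mor C (Cod C f) (Dom C f).
     g \<cdot>\<^bsub>C\<^esub> f = Id C (Dom C f) \<and> f \<cdot>\<^bsub>C\<^esub> g = Id C (Cod C f))"

definition isomorphic :: "('o, 'm, 'z) category_data_scheme \<Rightarrow> 'o \<Rightarrow> 'o \<Rightarrow> bool" where
  "isomorphic C X Y \<longleftrightarrow> (\<exists>f \<in> Mor C X Y. is_isomorphism C f)"

definition zero_object :: "('o, 'm, 'z) category_data_scheme \<Rightarrow> 'o \<Rightarrow> bool" where
  "zero_object C Z \<longleftrightarrow> Z \<in> Ob C \<and>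
     (\<forall>X \<in> Ob C. (\<exists>!f. f \<in> Mor C X Z) \<and> (\<exists>!f. f \<in> Mor C Z X))"

record ('o, 'm, 'p, 'q) functor_data =
  FO :: "'o \<Rightarrow> 'p"
  FA :: "'m \<Rightarrow> 'q"

locale cat_functor = C: category C + D: category D
  for C :: "('o, 'm, 'y) category_data_scheme"
    and D :: "('p, 'q, 'z) category_data_scheme" +
  fixes F :: "('o, 'm, 'p, 'q) functor_data"
  assumes FO_Ob: "X \<in> Ob C \<Longrightarrow> FO F X \<in> Ob D"
    and FA_Mor: "f \<in> Mor C X Y \<Longrightarrow> FA F f \<in> Mor D (FO F X) (FO F Y)"
    and FA_Id: "X \<in> Ob C \<Longrightarrow> FA F (Id C X) = Id D (FO F X)"
    and FA_Cmp: "f \<in> Mor C X Y \<Longrightarrow> g \<in> Mor C Y Z \<Longrightarrow>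
      FA F (g \<cdot>\<^bsub>C\<^esub> f) = FA F g \<cdot>\<^bsub>D\<^esub> FA F f"

definition id_functor :: "('o, 'm, 'o, 'm) functor_data" where
  "id_functor = \<lparr>FO = (\<lambda>X. X), FA = (\<lambda>f. f)\<rparr>"

definition comp_functor ::
  "('p, 'q, 'r, 's) functor_data \<Rightarrow> ('o, 'm, 'p, 'q) functor_data \<Rightarrow> ('o, 'm, 'r, 's) functor_data"
  where "comp_functor G F = \<lparr>FO = FO G \<circ> FO F, FA = FA G \<circ> FA F\<rparr>"

definition natural_iso ::
  "('o, 'm, 'y) category_data_scheme \<Rightarrow> ('p, 'q, 'z) category_data_scheme \<Rightarrow>
   ('o, 'm, 'p, 'q) functor_data \<Rightarrow> ('o, 'm, 'p, 'q) functor_data \<Rightarrow> ('o \<Rightarrow> 'q) \<Rightarrow> bool" where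
  "natural_iso C D F G \<eta> \<longleftrightarrow>
     (\<forall>X \<in> Ob C. \<eta> X \<in> Mor D (FO F X) (FO G X) \<and> is_isomorphism D (\<eta> X)) \<and>
     (\<forall>f \<in> Ar C. \<eta> (Cod C f) \<cdot>\<^bsub>D\<^esub> FA F f = FA G f \<cdot>\<^bsub>D\<^esub> \<eta> (Dom C f))"

definition equivalence_functor ::
  "('o, 'm, 'y) category_data_scheme \<Rightarrow> ('p, 'q, 'z) category_data_scheme \<Rightarrow>
   ('o, 'm, 'p, 'q) functor_data \<Rightarrow> bool" where
  "equivalence_functor C D F \<longleftrightarrow> cat_functor C D F \<and>
     (\<exists>G \<eta> \<epsilon>. cat_functor D C G \<and>
        natural_iso C C id_functor (comp_functor G F) \<eta> \<and>
        natural_iso D D (comp_functor F G) id_functor \<epsilon>)"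

definition essential_image ::
  "('o, 'm, 'y) category_data_scheme \<Rightarrow> ('p, 'q, 'z) category_data_scheme \<Rightarrow>
   ('o, 'm, 'p, 'q) functor_data \<Rightarrow> 'p set" where
  "essential_image C D F = {Y \<in> Ob D. \<exists>X \<in> Ob C. isomorphic D (FO F X) Y}"

section \<open>Additive categories with a suspension\<close>

record ('o, 'm) suspended_data = "('o, 'm) category_data" +
  Add :: "'m \<Rightarrow> 'm \<Rightarrow> 'm"
  Zero :: "'o \<Rightarrow> 'o \<Rightarrow> 'm"
  Sus :: "('o, 'm, 'o, 'm) functor_data"

definition Mor_group :: "('o, 'm, 'z) suspended_data_scheme \<Rightarrow> 'o \<Rightarrow> 'o \<Rightarrow> 'm monoid" where
  "Mor_group C X Y = \<lparr>carrier = Mor C X Y, mult = Add C, one = Zero C X Y\<rparr>"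

definition Neg :: "('o, 'm, 'z) suspended_data_scheme \<Rightarrow> 'm \<Rightarrow> 'm" where
  "Neg C f = inv\<^bsub>Mor_group C (Dom C f) (Cod C f)\<^esub> f"

definition direct_sum ::
  "('o, 'm, 'z) suspended_data_scheme \<Rightarrow> 'o \<Rightarrow> 'o \<Rightarrow> 'o \<Rightarrow> bool" where
  "direct_sum C X Y Z \<longleftrightarrow> Z \<in> Ob C \<and>
     (\<exists>i \<in> Mor C X Z. \<exists>j \<in> Mor C Y Z. \<exists>p \<in> Mor C Z X. \<exists>q \<in> Mor C Z Y.
        p \<cdot>\<^bsub>C\<^esub> i = Id C X \<and> q \<cdot>\<^bsub>C\<^esub> j = Id C Y \<and>
        p \<cdot>\<^bsub>C\<^esub> j = Zero C Y X \<and> q \<cdot>\<^bsub>C\<^esub> i = Zero C X Y \<and>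
        Add C (i \<cdot>\<^bsub>C\<^esub> p) (j \<cdot>\<^bsub>C\<^esub> q) = Id C Z)"

locale additive_category = category C
  for C :: "('o, 'm, 'z) suspended_data_scheme" (structure) +
  assumes Mor_comm_group: "X \<in> Ob C \<Longrightarrow> Y \<in> Ob C \<Longrightarrow> comm_group (Mor_group C X Y)"
    and Cmp_Add_left: "f \<in> Mor C X Y \<Longrightarrow> g \<in> Mor C Y Z \<Longrightarrow> g' \<in> Mor C Y Z \<Longrightarrow>
      Add C g g' \<cdot> f = Add C (g \<cdot> f) (g' \<cdot> f)"
    and Cmp_Add_right: "f \<in> Mor C X Y \<Longrightarrow> f' \<in> Mor C X Y \<Longrightarrow> g \<in> Mor C Y Z \<Longrightarrow>
      g \<cdot> Add C f f' = Add C (g \<cdot> f) (g \<cdot> f')"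
    and ex_zero_object: "\<exists>Z. zero_object C Z"
    and ex_direct_sum: "X \<in> Ob C \<Longrightarrow> Y \<in> Ob C \<Longrightarrow> \<exists>Z. direct_sum C X Y Z"

definition additive_functor ::
  "('o, 'm, 'y) suspended_data_scheme \<Rightarrow> ('p, 'q, 'z) suspended_data_scheme \<Rightarrow>
   ('o, 'm, 'p, 'q) functor_data \<Rightarrow> bool" where
  "additive_functor C D F \<longleftrightarrow> cat_functor C D F \<and>
     (\<forall>X \<in> Ob C. \<forall>Y \<in> Ob C. \<forall>f \<in> Mor C X Y. \<forall>g \<in> Mor C X Y.
        FA F (Add C f g) = Add D (FA F f) (FA F g))"

text \<open>Full subcategories are given by their sets of objects.\<close>

definition full_additive_subcategory ::
  "('o, 'm, 'z) suspended_data_scheme \<Rightarrow> 'o set \<Rightarrow> bool" where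
  "full_additive_subcategory C U \<longleftrightarrow> U \<subseteq> Ob C \<and> (\<exists>Z \<in> U. zero_object C Z) \<and>
     (\<forall>X \<in> U. \<forall>Y \<in> U. \<exists>Z \<in> U. direct_sum C X Y Z)"

section \<open>Triangulated categories\<close>

text \<open>A triple \<open>(f, g, h)\<close> stands for the triangle
  \<open>X \<rightarrow> Y \<rightarrow> Z \<rightarrow> \<Sigma>(X)\<close> with \<open>X = Dom f\<close>, \<open>Y = Cod f\<close> and \<open>Z = Cod g\<close>.\<close>

definition candidate_triangle ::
  "('o, 'm, 'z) suspended_data_scheme \<Rightarrow> 'm \<times> 'm \<times> 'm \<Rightarrow> bool" where
  "candidate_triangle C = (\<lambda>(f, g, h). f \<in> Ar C \<and> g \<in> Ar C \<and> h \<in> Ar C \<and>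
     Dom C g = Cod C f \<and> Dom C h = Cod C g \<and> Cod C h = FO (Sus C) (Dom C f))"

definition triangle_morphism ::
  "('o, 'm, 'z) suspended_data_scheme \<Rightarrow> 'm \<times> 'm \<times> 'm \<Rightarrow> 'm \<times> 'm \<times> 'm \<Rightarrow>
   'm \<Rightarrow> 'm \<Rightarrow> 'm \<Rightarrow> bool" where
  "triangle_morphism C = (\<lambda>(f, g, h) (f', g', h') a b c.
     a \<in> Mor C (Dom C f) (Dom C f') \<and> b \<in> Mor C (Cod C f) (Cod C f') \<and>
     c \<in> Mor C (Cod C g) (Cod C g') \<and>
     b \<cdot>\<^bsub>C\<^esub> f = f' \<cdot>\<^bsub>C\<^esub> a \<and> c \<cdot>\<^bsub>C\<^esub> g = g' \<cdot>\<^bsub>C\<^esub> b \<and>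
     FA (Sus C) a \<cdot>\<^bsub>C\<^esub> h = h' \<cdot>\<^bsub>C\<^esub> c)"

definition isomorphic_triangles ::
  "('o, 'm, 'z) suspended_data_scheme \<Rightarrow> 'm \<times> 'm \<times> 'm \<Rightarrow> 'm \<times> 'm \<times> 'm \<Rightarrow> bool" where
  "isomorphic_triangles C t t' \<longleftrightarrow> candidate_triangle C t \<and> candidate_triangle C t' \<and>
     (\<exists>a b c. triangle_morphism C t t' a b c \<and>
        is_isomorphism C a \<and> is_isomorphism C b \<and> is_isomorphism C c)"

record ('o, 'm) triangulated_data = "('o, 'm) suspended_data" +
  Tri :: "('m \<times> 'm \<times> 'm) set"

text \<open>The suspension is only required to be an autoequivalence, not an automorphism.\<close>

locale triangulated_category = additive_category C
  for C :: "('o, 'm, 'z) triangulated_data_scheme" (structure) +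
  assumes Sus_equivalence: "equivalence_functor C C (Sus C)"
    and Sus_additive: "additive_functor C C (Sus C)"
    and Tri_candidate: "t \<in> Tri C \<Longrightarrow> candidate_triangle C t"
    and Tri_iso: "t \<in> Tri C \<Longrightarrow> isomorphic_triangles C t t' \<Longrightarrow> t' \<in> Tri C"
    and TR1_Id: "X \<in> Ob C \<Longrightarrow> zero_object C Z \<Longrightarrow>
      (Id C X, Zero C X Z, Zero C Z (FO (Sus C) X)) \<in> Tri C"
    and TR1_ex: "f \<in> Ar C \<Longrightarrow> \<exists>g h. (f, g, h) \<in> Tri C"
    and TR2: "candidate_triangle C (f, g, h) \<Longrightarrow>
      (f, g, h) \<in> Tri C \<longleftrightarrow> (g, h, Neg C (FA (Sus C) f)) \<in> Tri C"
    and TR3: "(f, g, h) \<in> Tri C \<Longrightarrow> (f', g', h') \<in> Tri C \<Longrightarrow>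
      a \<in> Mor C (Dom C f) (Dom C f') \<Longrightarrow> b \<in> Mor C (Cod C f) (Cod C f') \<Longrightarrow>
      b \<cdot> f = f' \<cdot> a \<Longrightarrow> \<exists>c. triangle_morphism C (f, g, h) (f', g', h') a b c"
    and TR4: "(f, p, d) \<in> Tri C \<Longrightarrow> (g, p', d') \<in> Tri C \<Longrightarrow> Cod C f = Dom C g \<Longrightarrow>
      (g \<cdot> f, p'', d'') \<in> Tri C \<Longrightarrow>
      \<exists>u v. (u, v, FA (Sus C) p \<cdot> d') \<in> Tri C \<and>
        triangle_morphism C (f, p, d) (g \<cdot> f, p'', d'') (Id C (Dom C f)) g u \<and>
        triangle_morphism C (g \<cdot> f, p'', d'') (g, p', d') f (Id C (Cod C g)) v"

definition triangulated_subcategory ::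
  "('o, 'm, 'z) triangulated_data_scheme \<Rightarrow> 'o set \<Rightarrow> bool" where
  "triangulated_subcategory C U \<longleftrightarrow> U \<subseteq> Ob C \<and> (\<exists>Z \<in> U. zero_object C Z) \<and>
     (\<forall>X \<in> U. \<forall>Y \<in> Ob C. isomorphic C X Y \<longrightarrow> Y \<in> U) \<and>
     (\<forall>X \<in> Ob C. X \<in> U \<longleftrightarrow> FO (Sus C) X \<in> U) \<and>
     (\<forall>(f, g, h) \<in> Tri C. Dom C f \<in> U \<and> Cod C f \<in> U \<longrightarrow> Cod C g \<in> U)"

definition full_subcategory ::
  "('o, 'm) triangulated_data \<Rightarrow> 'o set \<Rightarrow> ('o, 'm) triangulated_data" where
  "full_subcategory C U =
     C\<lparr>Ob := U, Ar := {f \<in> Ar C. Dom C f \<in> U \<and> Cod C f \<in> U},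
       Tri := {(f, g, h) \<in> Tri C. Dom C f \<in> U \<and> Cod C f \<in> U \<and> Cod C g \<in> U}\<rparr>"

text \<open>A triangle functor is a pair \<open>(F, \<omega>)\<close>, where \<open>\<omega>\<close> is the connecting natural
  isomorphism \<open>F \<circ> \<Sigma> \<rightarrow> \<Sigma> \<circ> F\<close>.\<close>

definition triangle_functor ::
  "('o, 'm, 'y) triangulated_data_scheme \<Rightarrow> ('p, 'q, 'z) triangulated_data_scheme \<Rightarrow>
   ('o, 'm, 'p, 'q) functor_data \<Rightarrow> ('o \<Rightarrow> 'q) \<Rightarrow> bool" where
  "triangle_functor C D F \<omega> \<longleftrightarrow>
     triangulated_category C \<and> triangulated_category D \<and> additive_functor C D F \<and>
     natural_iso C D (comp_functor F (Sus C)) (comp_functor (Sus D) F) \<omega> \<and>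
     (\<forall>(f, g, h) \<in> Tri C. (FA F f, FA F g, \<omega> (Dom C f) \<cdot>\<^bsub>D\<^esub> FA F h) \<in> Tri D)"

definition triangle_equivalence ::
  "('o, 'm, 'y) triangulated_data_scheme \<Rightarrow> ('p, 'q, 'z) triangulated_data_scheme \<Rightarrow>
   ('o, 'm, 'p, 'q) functor_data \<Rightarrow> ('o \<Rightarrow> 'q) \<Rightarrow> bool" where
  "triangle_equivalence C D F \<omega> \<longleftrightarrow> triangle_functor C D F \<omega> \<and> equivalence_functor C D F"

text \<open>\<open>star C \<X> \<Y>\<close> is \<open>\<X> \<ast> \<Y>\<close>.\<close>

definition star ::
  "('o, 'm, 'z) triangulated_data_scheme \<Rightarrow> 'o set \<Rightarrow> 'o set \<Rightarrow> 'o set" where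
  "star C \<X> \<Y> = {Z. \<exists>(f, g, h) \<in> Tri C. Dom C f \<in> \<X> \<and> Cod C f = Z \<and> Cod C g \<in> \<Y>}"

text \<open>\<open>semiorthogonal_decomposition S \<Y> \<X>\<close> is \<open>S = \<langle>\<Y>, \<X>\<rangle>\<close>.\<close>

definition semiorthogonal_decomposition ::
  "('o, 'm, 'z) triangulated_data_scheme \<Rightarrow> 'o set \<Rightarrow> 'o set \<Rightarrow> bool" where
  "semiorthogonal_decomposition S \<Y> \<X> \<longleftrightarrow> triangulated_category S \<and>
     triangulated_subcategory S \<X> \<and> triangulated_subcategory S \<Y> \<and>
     star S \<X> \<Y> = Ob S \<and> (\<forall>X \<in> \<X>. \<forall>Y \<in> \<Y>. Mor S X Y = {Zero S X Y})"

section \<open>Verdier quotients\<close>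

text \<open>The Verdier quotient by \<open>N\<close> is the localisation at the morphisms whose cone lies in \<open>N\<close>.
  A pair \<open>(s, f)\<close> represents the fraction \<open>f \<circ> s\<inverse>\<close>, and an arrow of the quotient is an
  equivalence class of such pairs. The operations on classes are unions over all
  representatives; for a triangulated subcategory \<open>N\<close> all the classes united coincide.\<close>

definition denominators :: "('o, 'm) triangulated_data \<Rightarrow> 'o set \<Rightarrow> 'm set" where
  "denominators C N = {s \<in> Ar C. \<exists>g h. (s, g, h) \<in> Tri C \<and> Cod C g \<in> N}"

definition fractions :: "('o, 'm) triangulated_data \<Rightarrow> 'o set \<Rightarrow> ('m \<times> 'm) set" where
  "fractions C N = {(s, f). s \<in> denominators C N \<and> f \<in> Ar C \<and> Dom C f = Dom C s}"

definition fraction_rel ::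
  "('o, 'm) triangulated_data \<Rightarrow> 'o set \<Rightarrow> (('m \<times> 'm) \<times> ('m \<times> 'm)) set" where
  "fraction_rel C N = {((s, f), (s', f')).
     (s, f) \<in> fractions C N \<and> (s', f') \<in> fractions C N \<and>
     (\<exists>W. \<exists>u \<in> Mor C W (Dom C s). \<exists>u' \<in> Mor C W (Dom C s').
        s \<cdot>\<^bsub>C\<^esub> u = s' \<cdot>\<^bsub>C\<^esub> u' \<and> f \<cdot>\<^bsub>C\<^esub> u = f' \<cdot>\<^bsub>C\<^esub> u' \<and> s \<cdot>\<^bsub>C\<^esub> u \<in> denominators C N)}"

definition fraction :: "('o, 'm) triangulated_data \<Rightarrow> 'o set \<Rightarrow> 'm \<Rightarrow> 'm \<Rightarrow> ('m \<times> 'm) set" where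
  "fraction C N s f = fraction_rel C N `` {(s, f)}"

text \<open>The functor between Verdier quotients of the domain of \<open>F\<close> and of \<open>D\<close> that is induced
  by \<open>F\<close>; the target is \<open>D\<close> modulo \<open>N\<close>.\<close>

definition induced_functor ::
  "('p, 'q) triangulated_data \<Rightarrow> 'p set \<Rightarrow> ('o, 'm, 'p, 'q) functor_data \<Rightarrow>
   ('o, ('m \<times> 'm) set, 'p, ('q \<times> 'q) set) functor_data" where
  "induced_functor D N F =
     \<lparr>FO = FO F, FA = (\<lambda>\<alpha>. \<Union>(s, f) \<in> \<alpha>. fraction D N (FA F s) (FA F f))\<rparr>"

definition localization ::
  "('o, 'm) triangulated_data \<Rightarrow> 'o set \<Rightarrow> ('o, ('m \<times> 'm) set) suspended_data" where
  "localization C N = \<lparr>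
     Ob = Ob C,
     Ar = fractions C N // fraction_rel C N,
     Dom = (\<lambda>\<alpha>. the_elem ((\<lambda>(s, f). Cod C s) ` \<alpha>)),
     Cod = (\<lambda>\<alpha>. the_elem ((\<lambda>(s, f). Cod C f) ` \<alpha>)),
     Id = (\<lambda>X. fraction C N (Id C X) (Id C X)),
     Cmp = (\<lambda>\<beta> \<alpha>. \<Union>{fraction C N (s \<cdot>\<^bsub>C\<^esub> t') (g \<cdot>\<^bsub>C\<^esub> f') | s f t g t' f'.
       (s, f) \<in> \<alpha> \<and> (t, g) \<in> \<beta> \<and> t' \<in> denominators C N \<and> Cod C t' = Dom C s \<and>
       f' \<in> Mor C (Dom C t') (Dom C t) \<and> f \<cdot>\<^bsub>C\<^esub> t' = t \<cdot>\<^bsub>C\<^esub> f'}),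
     Add = (\<lambda>\<alpha> \<beta>. \<Union>{fraction C N s (Add C f g) | s f g. (s, f) \<in> \<alpha> \<and> (s, g) \<in> \<beta>}),
     Zero = (\<lambda>X Y. fraction C N (Id C X) (Zero C X Y)),
     Sus = induced_functor C N (Sus C)\<rparr>"

definition quotient_functor ::
  "('o, 'm) triangulated_data \<Rightarrow> 'o set \<Rightarrow> ('o, 'm, 'o, ('m \<times> 'm) set) functor_data" where
  "quotient_functor C N = \<lparr>FO = (\<lambda>X. X), FA = (\<lambda>f. fraction C N (Id C (Dom C f)) f)\<rparr>"

definition verdier_quotient ::
  "('o, 'm) triangulated_data \<Rightarrow> 'o set \<Rightarrow> ('o, ('m \<times> 'm) set) triangulated_data" where
  "verdier_quotient C N = suspended_data.extend (localization C N) (triangulated_data.fields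
     {t. \<exists>(f, g, h) \<in> Tri C. isomorphic_triangles (localization C N)
        (FA (quotient_functor C N) f, FA (quotient_functor C N) g, FA (quotient_functor C N) h) t})"

text \<open>The functor from the quotient of a full subcategory of \<open>C\<close> to the quotient of \<open>C\<close> by \<open>N\<close>
  that is induced by the inclusion.\<close>

definition canonical_functor ::
  "('o, 'm) triangulated_data \<Rightarrow> 'o set \<Rightarrow> ('o, ('m \<times> 'm) set, 'o, ('m \<times> 'm) set) functor_data"
  where "canonical_functor C N = induced_functor C N id_functor"

section \<open>Pre-weight structures\<close>

text \<open>Essential images of a full subcategory under \<open>\<Sigma>\<close> and under a quasi-inverse of \<open>\<Sigma>\<close>:
  \<open>X\<close> is isomorphic to \<open>\<Sigma>\<inverse>(Y)\<close> if and only if \<open>\<Sigma>(X)\<close> is isomorphic to \<open>Y\<close>.\<close>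

definition Sus_image :: "('o, 'm, 'z) triangulated_data_scheme \<Rightarrow> 'o set \<Rightarrow> 'o set" where
  "Sus_image C U = {Y \<in> Ob C. \<exists>X \<in> U. isomorphic C (FO (Sus C) X) Y}"

definition Sus_inv_image :: "('o, 'm, 'z) triangulated_data_scheme \<Rightarrow> 'o set \<Rightarrow> 'o set" where
  "Sus_inv_image C U = {X \<in> Ob C. \<exists>Y \<in> U. isomorphic C (FO (Sus C) X) Y}"

definition Sus_power :: "('o, 'm, 'z) triangulated_data_scheme \<Rightarrow> int \<Rightarrow> 'o set \<Rightarrow> 'o set" where
  "Sus_power C n U =
     (if 0 \<le> n then (Sus_image C ^^ nat n) U else (Sus_inv_image C ^^ nat (- n)) U)"

text \<open>Below, \<open>U\<close> is \<open>\<U>\<^sub>\<ge>\<^sub>0\<close> and \<open>V\<close> is \<open>\<U>\<^sub>\<le>\<^sub>0\<close>.\<close>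

definition pre_weight_structure ::
  "('o, 'm, 'z) triangulated_data_scheme \<Rightarrow> 'o set \<Rightarrow> 'o set \<Rightarrow> bool" where
  "pre_weight_structure C U V \<longleftrightarrow>
     full_additive_subcategory C U \<and> full_additive_subcategory C V \<and>
     star C U (Sus_image C V) = Ob C \<and>
     Sus_inv_image C U \<subseteq> U \<and> star C U U \<subseteq> U \<and>
     Sus_image C V \<subseteq> V \<and> star C V V \<subseteq> V"

definition U_ge :: "('o, 'm, 'z) triangulated_data_scheme \<Rightarrow> 'o set \<Rightarrow> int \<Rightarrow> 'o set" where
  "U_ge C U m = Sus_power C (- m) U"

definition U_le :: "('o, 'm, 'z) triangulated_data_scheme \<Rightarrow> 'o set \<Rightarrow> int \<Rightarrow> 'o set" where
  "U_le C V m = Sus_power C (- m) V"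

definition U_plus :: "('o, 'm, 'z) triangulated_data_scheme \<Rightarrow> 'o set \<Rightarrow> 'o set" where
  "U_plus C U = (\<Union>m. U_ge C U m)"

definition U_minus :: "('o, 'm, 'z) triangulated_data_scheme \<Rightarrow> 'o set \<Rightarrow> 'o set" where
  "U_minus C V = (\<Union>m. U_le C V m)"

definition U_bounded :: "('o, 'm, 'z) triangulated_data_scheme \<Rightarrow> 'o set \<Rightarrow> 'o set \<Rightarrow> 'o set" where
  "U_bounded C U V = \<Union>{U_ge C U m \<inter> U_le C V n | m n. m \<le> n}"

end

theory Submission
  imports Defs
begin

text \<open>
  Put \<open>P = \<U>\<^sub>+\<close>, \<open>M = \<U>\<^sub>-\<close> and \<open>B = \<U>\<^sub>b = P \<inter> M\<close>. Only two facts about them matter: \<open>P\<close> and \<open>M\<close> are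
  triangulated subcategories, and every object \<open>Z\<close> lies in a triangle \<open>X \<rightarrow> Z \<rightarrow> Y \<rightarrow> \<Sigma>(X)\<close> with \<open>X \<in> P\<close>,
  \<open>Y \<in> M\<close>. Given \<open>f : W \<rightarrow> Y\<close> with \<open>W \<in> P\<close> and \<open>Y \<in> M\<close>, decompose its fibre \<open>F\<close> as \<open>V \<rightarrow> F \<rightarrow> Y'\<close>. The
  composite \<open>V \<rightarrow> F \<rightarrow> W\<close> is killed by \<open>f\<close>, and its cone lies in \<open>P\<close> and, as an extension of \<open>Y\<close> by \<open>Y'\<close>,
  also in \<open>M\<close>; hence \<open>f\<close> vanishes modulo \<open>B\<close>. This is the orthogonality. In the same way a fraction
  modulo \<open>M\<close> between objects of \<open>P\<close> is refined to one modulo \<open>B\<close>. A fraction modulo \<open>P\<close> between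
  objects of \<open>M\<close> cannot be refined like this, but by the orthogonality both of its legs factor
  through the \<open>M\<close>-part of a decomposition of its apex.
\<close>

section \<open>Categories and equivalences\<close>

text \<open>The quotient is not given by a universal property: its arrows are classes of roofs
  \<open>(s, f)\<close>, its operations are unions over representatives, and the suspension is only
  an autoequivalence. So the axioms of a triangulated category are proved for this model before the
  decomposition can be formulated, and each desuspension costs a chosen isomorphism and often a
  sign. Roofs carry the denominator on the source side. An apex is easily replaced by something that
  maps to it, such as its \<open>P\<close>-part, but not by something it maps to, such as its
  \<open>M\<close>-part; this is why the two equivalences need different arguments. No orthogonality
  between \<open>P\<close> and \<open>M\<close> is assumed in the original category: an arrow from
  \<open>P\<close> to \<open>M\<close> only vanishes after precomposition with a denominator for
  \<open>P \<inter> M\<close>. Hence the legs of a roof between objects of \<open>M\<close> need not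
  vanish on the \<open>P\<close>-part of the apex itself. Two killing denominators, one for each
  leg, first shrink that part, and the cone of the resulting arrow is the \<open>M\<close>-part that
  is used.\<close>

context category
begin

text \<open>Hom sets are unfolded into equations for domain and codomain so that simplification can
  type composites. The conjuncts on objects supply the membership side conditions of later
  rules.\<close>

lemma Mor_iff [simp]:
  "f \<in> Mor C X Y \<longleftrightarrow> f \<in> Ar C \<and> Dom C f = X \<and> Cod C f = Y \<and> X \<in> Ob C \<and> Y \<in> Ob C"
  by (auto simp: Mor_def Dom_Ob Cod_Ob)

lemma Dom_Ob_simp [simp]: "f \<in> Ar C \<Longrightarrow> Dom C f \<in> Ob C"
  by (rule Dom_Ob)

lemma Cod_Ob_simp [simp]: "f \<in> Ar C \<Longrightarrow> Cod C f \<in> Ob C"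
  by (rule Cod_Ob)

lemma Id_simps [simp]:
  "X \<in> Ob C \<Longrightarrow> Id C X \<in> Ar C" "X \<in> Ob C \<Longrightarrow> Dom C (Id C X) = X"
  "X \<in> Ob C \<Longrightarrow> Cod C (Id C X) = X"
  using Id_Mor[of X] by auto

lemma Cmp_simps [simp]:
  assumes "f \<in> Ar C" "g \<in> Ar C" "Dom C g = Cod C f"
  shows "g \<cdot> f \<in> Ar C" "Dom C (g \<cdot> f) = Dom C f" "Cod C (g \<cdot> f) = Cod C g"
  using Cmp_Mor[of f "Dom C f" "Cod C f" g "Cod C g"] assms by auto

lemma Cmp_assoc_simp [simp]:
  assumes "f \<in> Ar C" "g \<in> Ar C" "h \<in> Ar C" "Dom C g = Cod C f" "Dom C h = Cod C g"
  shows "(h \<cdot> g) \<cdot> f = h \<cdot> (g \<cdot> f)"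
  using Cmp_assoc[of f "Dom C f" "Cod C f" g "Cod C g" h "Cod C h"] assms by auto

lemma Cmp_Id_simps [simp]:
  "f \<in> Ar C \<Longrightarrow> Dom C f = X \<Longrightarrow> f \<cdot> Id C X = f"
  "f \<in> Ar C \<Longrightarrow> Cod C f = X \<Longrightarrow> Id C X \<cdot> f = f"
  using Cmp_Id_right[of f "Dom C f" "Cod C f"] Cmp_Id_left[of f "Dom C f" "Cod C f"] by auto

text \<open>Composites are normalised to the right, so an equation for \<open>g \<cdot> f\<close> no
  longer matches inside \<open>g \<cdot> (f \<cdot> x)\<close>. In this form it can still be used
  there as a rewrite rule.\<close>

lemma Cmp_ext:
  assumes "g \<cdot> f = k" "f \<in> Ar C" "g \<in> Ar C" "Dom C g = Cod C f" "x \<in> Ar C" "Cod C x = Dom C f"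
  shows "g \<cdot> (f \<cdot> x) = k \<cdot> x"
  using assms by (metis Cmp_assoc_simp)

lemma is_isomorphism_Ar [simp]: "is_isomorphism C f \<Longrightarrow> f \<in> Ar C"
  by (simp add: is_isomorphism_def)

lemma is_isomorphismI:
  assumes "f \<in> Mor C X Y" "g \<in> Mor C Y X" "g \<cdot> f = Id C X" "f \<cdot> g = Id C Y"
  shows "is_isomorphism C f"
  unfolding is_isomorphism_def using assms by (intro conjI bexI[of _ g]) auto

lemma is_isomorphismE:
  assumes "is_isomorphism C f" "f \<in> Mor C X Y"
  obtains g where "g \<in> Mor C Y X" "g \<cdot> f = Id C X" "f \<cdot> g = Id C Y" "is_isomorphism C g"
proof -
  obtain g where g: "g \<in> Mor C Y X" "g \<cdot> f = Id C X" "f \<cdot> g = Id C Y"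
    using assms unfolding is_isomorphism_def by (auto simp: Mor_def)
  then have "is_isomorphism C g"
    using assms by (intro is_isomorphismI[of g Y X f])
  with g that show thesis by blast
qed

lemma is_isomorphismD:
  assumes "is_isomorphism C f"
  shows "\<exists>g. g \<in> Mor C (Cod C f) (Dom C f) \<and> g \<cdot> f = Id C (Dom C f) \<and> f \<cdot> g = Id C (Cod C f)"
  using assms unfolding is_isomorphism_def by blast

lemma is_isomorphism_Id [simp]: "X \<in> Ob C \<Longrightarrow> is_isomorphism C (Id C X)"
  by (rule is_isomorphismI[of _ X X "Id C X"]) auto

lemma is_isomorphism_Cmp [simp]:
  assumes "is_isomorphism C f" "is_isomorphism C g" "Dom C g = Cod C f"
  shows "is_isomorphism C (g \<cdot> f)"
proof -
  note [simp] = assms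
  obtain f' where f': "f' \<in> Mor C (Cod C f) (Dom C f)" "f' \<cdot> f = Id C (Dom C f)"
    "f \<cdot> f' = Id C (Cod C f)"
    using is_isomorphismD[of f] assms by blast
  obtain g' where g': "g' \<in> Mor C (Cod C g) (Dom C g)" "g' \<cdot> g = Id C (Dom C g)"
    "g \<cdot> g' = Id C (Cod C g)"
    using is_isomorphismD[of g] assms by blast
  show ?thesis
    by (rule is_isomorphismI[of _ "Dom C f" "Cod C g" "f' \<cdot> g'"])
      (use f' g' in \<open>auto simp: Cmp_ext[OF f'(3)] Cmp_ext[OF g'(2)]\<close>)
qed

lemma iso_cancel_left:
  assumes "is_isomorphism C a" "f \<in> Ar C" "g \<in> Ar C" "Cod C f = Dom C a" "Cod C g = Dom C a"
    "a \<cdot> f = a \<cdot> g"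
  shows "f = g"
proof -
  obtain b where b: "b \<in> Mor C (Cod C a) (Dom C a)" "b \<cdot> a = Id C (Dom C a)"
    using is_isomorphismD[of a] assms by blast
  have "f = b \<cdot> (a \<cdot> f)" using assms(1-5) b by (simp add: Cmp_ext[OF b(2)])
  also have "\<dots> = g" using assms b by (simp add: Cmp_ext[OF b(2)])
  finally show ?thesis .
qed

lemma iso_cancel_right:
  assumes "is_isomorphism C a" "f \<in> Ar C" "g \<in> Ar C" "Dom C f = Cod C a" "Dom C g = Cod C a"
    "f \<cdot> a = g \<cdot> a"
  shows "f = g"
proof -
  obtain b where b: "b \<in> Mor C (Cod C a) (Dom C a)" "a \<cdot> b = Id C (Cod C a)"
    using is_isomorphismD[of a] assms by blast
  have "f = (f \<cdot> a) \<cdot> b" using assms(1-5) b by simp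
  also have "\<dots> = (g \<cdot> a) \<cdot> b" using assms(6) by simp
  also have "\<dots> = g" using assms(1-5) b by simp
  finally show ?thesis .
qed

text \<open>Invertibility of the two composites gives \<open>f\<close> a left and a right inverse,
  and these coincide by associativity.\<close>

lemma iso_both_sides:
  assumes "f \<in> Mor C X Y" "g \<in> Mor C Y X" "g' \<in> Mor C Y X"
    "is_isomorphism C (g \<cdot> f)" "is_isomorphism C (f \<cdot> g')"
  shows "is_isomorphism C f"
proof -
  obtain a where a: "a \<in> Mor C X X" "a \<cdot> (g \<cdot> f) = Id C X"
    using is_isomorphismD[OF assms(4)] assms(1,2) by (auto simp del: Cmp_assoc_simp)
  obtain b where b: "b \<in> Mor C Y Y" "f \<cdot> g' \<cdot> b = Id C Y"
    using is_isomorphismD[OF assms(5)] assms(1,3) by auto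
  have "a \<cdot> g \<cdot> (f \<cdot> (g' \<cdot> b)) = g' \<cdot> b"
    using a b assms Cmp_ext[of "a \<cdot> g" f "Id C X" "g' \<cdot> b"] by simp
  then have *: "a \<cdot> g = g' \<cdot> b" using a b assms by simp
  show ?thesis
  proof (rule is_isomorphismI[of _ X Y "a \<cdot> g"])
    show "f \<cdot> (a \<cdot> g) = Id C Y" unfolding * using a b assms(1-3) by simp
  qed (use a assms in simp_all)
qed

lemma isomorphicI: "f \<in> Mor C X Y \<Longrightarrow> is_isomorphism C f \<Longrightarrow> isomorphic C X Y"
  unfolding isomorphic_def by blast

lemma isomorphicE:
  assumes "isomorphic C X Y"
  obtains f where "f \<in> Mor C X Y" "is_isomorphism C f"
  using assms unfolding isomorphic_def by blast

lemma isomorphic_refl: "X \<in> Ob C \<Longrightarrow> isomorphic C X X"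
  by (rule isomorphicI[of "Id C X"]) auto

lemma isomorphic_sym: "isomorphic C X Y \<Longrightarrow> isomorphic C Y X"
  by (metis isomorphicE isomorphicI is_isomorphismE)

lemma isomorphic_trans:
  assumes "isomorphic C X Y" "isomorphic C Y Z" shows "isomorphic C X Z"
proof -
  obtain f where "f \<in> Mor C X Y" "is_isomorphism C f" using assms(1) by (rule isomorphicE)
  moreover obtain g where "g \<in> Mor C Y Z" "is_isomorphism C g" using assms(2) by (rule isomorphicE)
  ultimately show ?thesis by (intro isomorphicI[of "g \<cdot> f"]) auto
qed

lemma isomorphic_Ob: "isomorphic C X Y \<Longrightarrow> X \<in> Ob C \<and> Y \<in> Ob C"
  by (auto elim: isomorphicE)

end

context cat_functor
begin

lemma FO_Ob_simp [simp]: "X \<in> Ob C \<Longrightarrow> FO F X \<in> Ob D"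
  by (rule FO_Ob)

lemma FA_simps [simp]:
  assumes "f \<in> Ar C"
  shows "FA F f \<in> Ar D" "Dom D (FA F f) = FO F (Dom C f)" "Cod D (FA F f) = FO F (Cod C f)"
  using FA_Mor[of f "Dom C f" "Cod C f"] assms by auto

lemma FA_Id_simp [simp]: "X \<in> Ob C \<Longrightarrow> FA F (Id C X) = Id D (FO F X)"
  by (rule FA_Id)

lemma FA_Cmp_simp [simp]:
  "f \<in> Ar C \<Longrightarrow> g \<in> Ar C \<Longrightarrow> Dom C g = Cod C f \<Longrightarrow> FA F (g \<cdot>\<^bsub>C\<^esub> f) = FA F g \<cdot>\<^bsub>D\<^esub> FA F f"
  using FA_Cmp[of f "Dom C f" "Cod C f" g "Cod C g"] by auto

lemma is_isomorphism_FA [simp]: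
  assumes "is_isomorphism C f" shows "is_isomorphism D (FA F f)"
proof -
  note [simp] = assms
  obtain g where g: "g \<in> Mor C (Cod C f) (Dom C f)" "g \<cdot>\<^bsub>C\<^esub> f = Id C (Dom C f)"
    "f \<cdot>\<^bsub>C\<^esub> g = Id C (Cod C f)"
    using C.is_isomorphismD[of f] assms by blast
  show ?thesis
    by (rule D.is_isomorphismI[of _ "FO F (Dom C f)" "FO F (Cod C f)" "FA F g"])
      (use g in \<open>auto simp flip: FA_Cmp_simp\<close>)
qed

lemma isomorphic_FO:
  assumes "isomorphic C X Y" shows "isomorphic D (FO F X) (FO F Y)"
proof -
  obtain f where "f \<in> Mor C X Y" "is_isomorphism C f" using assms by (rule C.isomorphicE)
  then show ?thesis by (intro D.isomorphicI[of "FA F f"]) auto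
qed

end

lemma id_functor_simps [simp]: "FO id_functor X = X" "FA id_functor f = f"
  by (simp_all add: id_functor_def)

lemma comp_functor_simps [simp]:
  "FO (comp_functor G F) X = FO G (FO F X)" "FA (comp_functor G F) f = FA G (FA F f)"
  by (simp_all add: comp_functor_def)

lemma natural_isoD:
  assumes "natural_iso C D F G \<eta>"
  shows "X \<in> Ob C \<Longrightarrow> \<eta> X \<in> Mor D (FO F X) (FO G X)"
    and "X \<in> Ob C \<Longrightarrow> is_isomorphism D (\<eta> X)"
    and "f \<in> Mor C X Y \<Longrightarrow> \<eta> Y \<cdot>\<^bsub>D\<^esub> FA F f = FA G f \<cdot>\<^bsub>D\<^esub> \<eta> X"
  using assms by (auto simp: natural_iso_def Mor_def)

locale fully_faithful_functor = cat_functor +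
  assumes full: "X \<in> Ob C \<Longrightarrow> Y \<in> Ob C \<Longrightarrow> h \<in> Mor D (FO F X) (FO F Y) \<Longrightarrow>
      \<exists>f \<in> Mor C X Y. FA F f = h"
    and faithful: "f \<in> Mor C X Y \<Longrightarrow> g \<in> Mor C X Y \<Longrightarrow> FA F f = FA F g \<Longrightarrow> f = g"
begin

lemma fullE:
  assumes "X \<in> Ob C" "Y \<in> Ob C" "h \<in> Mor D (FO F X) (FO F Y)"
  obtains f where "f \<in> Mor C X Y" "h = FA F f"
  using full assms by metis

lemma reflects_isomorphism:
  assumes "f \<in> Mor C X Y" "is_isomorphism D (FA F f)"
  shows "is_isomorphism C f"
proof -
  have [simp]: "f \<in> Ar C" "Dom C f = X" "Cod C f = Y" "X \<in> Ob C" "Y \<in> Ob C" using assms by auto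
  obtain h where h: "h \<in> Mor D (FO F Y) (FO F X)" "h \<cdot>\<^bsub>D\<^esub> FA F f = Id D (FO F X)"
    "FA F f \<cdot>\<^bsub>D\<^esub> h = Id D (FO F Y)"
    using D.is_isomorphismD[OF assms(2)] by auto
  obtain g where g: "g \<in> Mor C Y X" "FA F g = h" using full[OF _ _ h(1)] by auto
  show ?thesis
    by (rule C.is_isomorphismI[of f X Y g])
      (use g h faithful[of "g \<cdot>\<^bsub>C\<^esub> f" X X "Id C X"] faithful[of "f \<cdot>\<^bsub>C\<^esub> g" Y Y "Id C Y"] in simp_all)
qed

lemma reflects_isomorphic:
  assumes "X \<in> Ob C" "Y \<in> Ob C" "isomorphic D (FO F X) (FO F Y)"
  shows "isomorphic C X Y"
proof -
  obtain h where h: "h \<in> Mor D (FO F X) (FO F Y)" "is_isomorphism D h"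
    using assms(3) by (rule D.isomorphicE)
  obtain f where "f \<in> Mor C X Y" "h = FA F f" using fullE[OF assms(1,2) h(1)] .
  then show ?thesis using h by (blast intro: C.isomorphicI reflects_isomorphism)
qed

text \<open>A quasi-inverse sends \<open>Y\<close> to a chosen preimage \<open>r Y\<close> and an
  arrow to the preimage of its conjugate by the chosen isomorphisms \<open>e\<close>. The functor
  laws and the naturality of the unit hold after applying \<open>F\<close>, hence by faithfulness
  before it.\<close>

lemma equivalence_functorI:
  assumes ess: "\<And>Y. Y \<in> Ob D \<Longrightarrow> \<exists>X \<in> Ob C. isomorphic D (FO F X) Y"
  shows "equivalence_functor C D F"
proof -
  have "\<exists>X. X \<in> Ob C \<and> isomorphic D (FO F X) Y" if "Y \<in> Ob D" for Y
    using ess[OF that] by blast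
  then obtain r where r: "\<And>Y. Y \<in> Ob D \<Longrightarrow> r Y \<in> Ob C \<and> isomorphic D (FO F (r Y)) Y"
    by metis
  then have "\<exists>e. e \<in> Mor D (FO F (r Y)) Y \<and> is_isomorphism D e" if "Y \<in> Ob D" for Y
    using that by (meson D.isomorphicE)
  then obtain e where e: "\<And>Y. Y \<in> Ob D \<Longrightarrow> e Y \<in> Mor D (FO F (r Y)) Y \<and> is_isomorphism D (e Y)"
    by metis
  have "\<exists>e'. e' \<in> Mor D Y (FO F (r Y)) \<and> e' \<cdot>\<^bsub>D\<^esub> e Y = Id D (FO F (r Y)) \<and> e Y \<cdot>\<^bsub>D\<^esub> e' = Id D Y"
    if "Y \<in> Ob D" for Y
    using e[OF that] D.is_isomorphismE[of "e Y" "FO F (r Y)" Y] by blast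
  then obtain e' where e': "\<And>Y. Y \<in> Ob D \<Longrightarrow> e' Y \<in> Mor D Y (FO F (r Y)) \<and>
      e' Y \<cdot>\<^bsub>D\<^esub> e Y = Id D (FO F (r Y)) \<and> e Y \<cdot>\<^bsub>D\<^esub> e' Y = Id D Y"
    by metis
  have rty [simp]: "r Y \<in> Ob C" "e Y \<in> Ar D" "Dom D (e Y) = FO F (r Y)" "Cod D (e Y) = Y"
    "e' Y \<in> Ar D" "Dom D (e' Y) = Y" "Cod D (e' Y) = FO F (r Y)"
    "e' Y \<cdot>\<^bsub>D\<^esub> e Y = Id D (FO F (r Y))" "e Y \<cdot>\<^bsub>D\<^esub> e' Y = Id D Y"
    "is_isomorphism D (e Y)" if "Y \<in> Ob D" for Y
    using r[OF that] e[OF that] e'[OF that] by simp_all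
  have [simp]: "is_isomorphism D (e' Y)" if "Y \<in> Ob D" for Y
    by (rule D.is_isomorphismI[of _ Y "FO F (r Y)" "e Y"]) (use that in auto)
  have ext1: "e Y \<cdot>\<^bsub>D\<^esub> (e' Y \<cdot>\<^bsub>D\<^esub> x) = x" if "Y \<in> Ob D" "x \<in> Ar D" "Cod D x = Y" for x Y
    using D.Cmp_ext[of "e Y" "e' Y" "Id D Y" x] that by simp
  \<comment> \<open>The implication makes the statement total in \<open>h\<close>, so that a choice
    function can be extracted.\<close>
  have "\<exists>f. h \<in> Ar D \<longrightarrow> f \<in> Mor C (r (Dom D h)) (r (Cod D h)) \<and>
      FA F f = e' (Cod D h) \<cdot>\<^bsub>D\<^esub> (h \<cdot>\<^bsub>D\<^esub> e (Dom D h))" for h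
  proof (cases "h \<in> Ar D")
    case True
    then show ?thesis
      using full[of "r (Dom D h)" "r (Cod D h)" "e' (Cod D h) \<cdot>\<^bsub>D\<^esub> (h \<cdot>\<^bsub>D\<^esub> e (Dom D h))"] by auto
  qed simp
  then obtain m where m: "\<And>h. h \<in> Ar D \<Longrightarrow> m h \<in> Mor C (r (Dom D h)) (r (Cod D h))"
    "\<And>h. h \<in> Ar D \<Longrightarrow> FA F (m h) = e' (Cod D h) \<cdot>\<^bsub>D\<^esub> (h \<cdot>\<^bsub>D\<^esub> e (Dom D h))"
    by metis
  have m_typ [simp]: "m h \<in> Ar C" "Dom C (m h) = r (Dom D h)" "Cod C (m h) = r (Cod D h)"
    if "h \<in> Ar D" for h
    using m(1)[OF that] by auto
  \<comment> \<open>The unit at \<open>X\<close> will be the preimage of the inverse of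
    \<open>e (FO F X)\<close>.\<close>
  have "\<exists>i. X \<in> Ob C \<longrightarrow> i \<in> Mor C X (r (FO F X)) \<and> FA F i = e' (FO F X)" for X
  proof (cases "X \<in> Ob C")
    case True
    then have "e' (FO F X) \<in> Mor D (FO F X) (FO F (r (FO F X)))" by simp
    with True show ?thesis using full[of X "r (FO F X)" "e' (FO F X)"] by (metis FO_Ob rty(1))
  qed simp
  then obtain i where i: "\<And>X. X \<in> Ob C \<Longrightarrow> i X \<in> Mor C X (r (FO F X))"
    "\<And>X. X \<in> Ob C \<Longrightarrow> FA F (i X) = e' (FO F X)"
    by metis
  have i_typ [simp]: "i X \<in> Ar C" "Dom C (i X) = X" "Cod C (i X) = r (FO F X)"
    if "X \<in> Ob C" for X
    using i(1)[OF that] that by auto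
  define G where "G = \<lparr>FO = r, FA = m\<rparr>"
  have G [simp]: "FO G = r" "FA G = m" by (simp_all add: G_def)
  have "cat_functor D C G"
  proof (intro cat_functor.intro cat_functor_axioms.intro D.category_axioms C.category_axioms)
    fix X assume X: "X \<in> Ob D"
    then show "FO G X \<in> Ob C" by simp
    show "FA G (Id D X) = Id C (FO G X)"
      by (rule faithful[of _ "r X" "r X"]) (use X m(2)[of "Id D X"] in auto)
  next
    fix f X Y assume f: "f \<in> Mor D X Y"
    then show "FA G f \<in> Mor C (FO G X) (FO G Y)" by auto
    fix g Z assume g: "g \<in> Mor D Y Z"
    show "FA G (g \<cdot>\<^bsub>D\<^esub> f) = FA G g \<cdot>\<^bsub>C\<^esub> FA G f"
      by (rule faithful[of _ "r X" "r Z"])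
        (use f g m(2)[of f] m(2)[of g] m(2)[of "g \<cdot>\<^bsub>D\<^esub> f"] in \<open>auto simp: ext1\<close>)
  qed
  moreover have "natural_iso C C id_functor (comp_functor G F) i"
    unfolding natural_iso_def
  proof (intro conjI ballI)
    fix X assume X: "X \<in> Ob C"
    show "is_isomorphism C (i X)"
      by (rule reflects_isomorphism[OF i(1)[OF X]]) (use X i(2) in auto)
  next
    fix f assume f: "f \<in> Ar C"
    have "i (Cod C f) \<cdot>\<^bsub>C\<^esub> f = m (FA F f) \<cdot>\<^bsub>C\<^esub> i (Dom C f)"
      by (rule faithful[of _ "Dom C f" "r (FO F (Cod C f))"])
        (use f i(2) m(2)[of "FA F f"] in \<open>auto simp: ext1\<close>)
    then show "i (Cod C f) \<cdot>\<^bsub>C\<^esub> FA id_functor f = FA (comp_functor G F) f \<cdot>\<^bsub>C\<^esub> i (Dom C f)" by simp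
  qed auto
  moreover have "natural_iso D D (comp_functor F G) id_functor e"
    unfolding natural_iso_def
    using m(2) by (auto simp: ext1)
  ultimately show ?thesis
    unfolding equivalence_functor_def using cat_functor_axioms by blast
qed

end

text \<open>Naturality of the unit recovers \<open>f\<close> from \<open>FA G (FA F f)\<close> up to
  composition with isomorphisms.\<close>

lemma equivalence_functor_faithful:
  assumes "cat_functor C D F" "cat_functor D C G"
    and \<eta>: "natural_iso C C id_functor (comp_functor G F) \<eta>"
    and f: "f \<in> Mor C X Y" and g: "g \<in> Mor C X Y" and eq: "FA F f = FA F g"
  shows "f = g"
proof -
  interpret F: cat_functor C D F by fact
  have "\<eta> Y \<cdot>\<^bsub>C\<^esub> h = FA G (FA F h) \<cdot>\<^bsub>C\<^esub> \<eta> X" if "h \<in> Mor C X Y" for h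
    using natural_isoD(3)[OF \<eta> that] by simp
  from this[OF f] this[OF g] eq have "\<eta> Y \<cdot>\<^bsub>C\<^esub> f = \<eta> Y \<cdot>\<^bsub>C\<^esub> g" by simp
  moreover have "\<eta> Y \<in> Mor C Y (FO G (FO F Y))" "is_isomorphism C (\<eta> Y)"
    using natural_isoD(1,2)[OF \<eta>, of Y] f by auto
  ultimately show ?thesis
    using f g F.C.iso_cancel_left[of "\<eta> Y" f g] by auto
qed

text \<open>Faithfulness comes from the unit alone. Fullness uses the counit as well: it makes
  \<open>G\<close> faithful, and the candidate preimage of \<open>h\<close> is checked after
  applying \<open>G\<close>.\<close>

lemma equivalence_functorD:
  assumes "equivalence_functor C D F"
  shows "fully_faithful_functor C D F"
    and "Y \<in> Ob D \<Longrightarrow> \<exists>X \<in> Ob C. isomorphic D (FO F X) Y"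
proof -
  obtain G \<eta> \<epsilon> where F: "cat_functor C D F" and G: "cat_functor D C G"
    and \<eta>: "natural_iso C C id_functor (comp_functor G F) \<eta>"
    and \<epsilon>: "natural_iso D D (comp_functor F G) id_functor \<epsilon>"
    using assms unfolding equivalence_functor_def by blast
  interpret F: cat_functor C D F by fact
  interpret G: cat_functor D C G by fact
  have \<epsilon>1: "\<epsilon> Y \<in> Mor D (FO F (FO G Y)) Y" "is_isomorphism D (\<epsilon> Y)" if "Y \<in> Ob D" for Y
    using natural_isoD(1,2)[OF \<epsilon> that] by simp_all
  have \<eta>1: "\<eta> X \<in> Mor C X (FO G (FO F X))" "is_isomorphism C (\<eta> X)" if "X \<in> Ob C" for X
    using natural_isoD(1,2)[OF \<eta> that] by simp_all
  show "Y \<in> Ob D \<Longrightarrow> \<exists>X \<in> Ob C. isomorphic D (FO F X) Y"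
    using \<epsilon>1 by (intro bexI[of _ "FO G Y"]) (auto intro!: F.D.isomorphicI[of "\<epsilon> Y"])
  have G_faithful: "h = h'" if h: "h \<in> Mor D X Y" "h' \<in> Mor D X Y" and eq: "FA G h = FA G h'" for h h' X Y
  proof -
    have "h0 \<cdot>\<^bsub>D\<^esub> \<epsilon> X = \<epsilon> Y \<cdot>\<^bsub>D\<^esub> FA F (FA G h0)" if "h0 \<in> Mor D X Y" for h0
      using natural_isoD(3)[OF \<epsilon> that] by simp
    from this[OF h(1)] this[OF h(2)] eq have "h \<cdot>\<^bsub>D\<^esub> \<epsilon> X = h' \<cdot>\<^bsub>D\<^esub> \<epsilon> X" by simp
    then show ?thesis using h \<epsilon>1[of X] F.D.iso_cancel_right[of "\<epsilon> X" h h'] by auto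
  qed
  show "fully_faithful_functor C D F"
  proof (intro fully_faithful_functor.intro fully_faithful_functor_axioms.intro F)
    fix X Y h assume X: "X \<in> Ob C" and Y: "Y \<in> Ob C" and h: "h \<in> Mor D (FO F X) (FO F Y)"
    obtain k where k: "k \<in> Mor C (FO G (FO F Y)) Y" "k \<cdot>\<^bsub>C\<^esub> \<eta> Y = Id C Y" "\<eta> Y \<cdot>\<^bsub>C\<^esub> k = Id C (FO G (FO F Y))"
      using F.C.is_isomorphismE[of "\<eta> Y"] \<eta>1[OF Y] by blast
    \<comment> \<open>The only possible preimage: naturality of the unit at \<open>f\<close> with
      \<open>FA F f = h\<close>, solved for \<open>f\<close>.\<close>
    define f where "f = k \<cdot>\<^bsub>C\<^esub> (FA G h \<cdot>\<^bsub>C\<^esub> \<eta> X)"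
    have f: "f \<in> Mor C X Y" using k h X Y \<eta>1[OF X] by (auto simp: f_def)
    have "\<eta> Y \<cdot>\<^bsub>C\<^esub> f = FA G (FA F f) \<cdot>\<^bsub>C\<^esub> \<eta> X"
      using natural_isoD(3)[OF \<eta> f] by simp
    moreover have "\<eta> Y \<cdot>\<^bsub>C\<^esub> f = FA G h \<cdot>\<^bsub>C\<^esub> \<eta> X"
      using k h X Y \<eta>1[OF X] \<eta>1[OF Y] by (auto simp: f_def F.C.Cmp_ext[OF k(3)])
    ultimately have "FA G (FA F f) = FA G h"
      using F.C.iso_cancel_right[of "\<eta> X" "FA G (FA F f)" "FA G h"] \<eta>1[OF X] f h by auto
    then have "FA F f = h" using G_faithful[of "FA F f" "FO F X" "FO F Y" h] f h by auto
    with f show "\<exists>f \<in> Mor C X Y. FA F f = h" by blast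
  next
    fix f g X Y assume "f \<in> Mor C X Y" "g \<in> Mor C X Y" "FA F f = FA F g"
    then show "f = g" using equivalence_functor_faithful[OF F G \<eta>] by blast
  qed
qed

section \<open>Additive categories\<close>

context additive_category
begin

lemma Mor_group_simps:
  "carrier (Mor_group C X Y) = Mor C X Y" "mult (Mor_group C X Y) = Add C"
  "one (Mor_group C X Y) = Zero C X Y"
  by (simp_all add: Mor_group_def)

lemma Zero_simps [simp]:
  assumes "X \<in> Ob C" "Y \<in> Ob C"
  shows "Zero C X Y \<in> Ar C" "Dom C (Zero C X Y) = X" "Cod C (Zero C X Y) = Y"
proof -
  interpret comm_group "Mor_group C X Y" using Mor_comm_group assms .
  show "Zero C X Y \<in> Ar C" "Dom C (Zero C X Y) = X" "Cod C (Zero C X Y) = Y"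
    using one_closed by (simp_all add: Mor_group_simps)
qed

lemma Add_simps [simp]:
  assumes "f \<in> Ar C" "g \<in> Ar C" "Dom C g = Dom C f" "Cod C g = Cod C f"
  shows "Add C f g \<in> Ar C" "Dom C (Add C f g) = Dom C f" "Cod C (Add C f g) = Cod C f"
proof -
  interpret comm_group "Mor_group C (Dom C f) (Cod C f)" using Mor_comm_group assms by simp
  show "Add C f g \<in> Ar C" "Dom C (Add C f g) = Dom C f" "Cod C (Add C f g) = Cod C f"
    using m_closed[of f g] assms by (simp_all add: Mor_group_simps)
qed

lemma Neg_simps [simp]:
  assumes "f \<in> Ar C"
  shows "Neg C f \<in> Ar C" "Dom C (Neg C f) = Dom C f" "Cod C (Neg C f) = Cod C f"
proof -
  interpret comm_group "Mor_group C (Dom C f) (Cod C f)" using Mor_comm_group assms by simp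
  show "Neg C f \<in> Ar C" "Dom C (Neg C f) = Dom C f" "Cod C (Neg C f) = Cod C f"
    using inv_closed[of f] assms by (simp_all add: Mor_group_simps Neg_def)
qed

lemma Add_commute:
  assumes "f \<in> Ar C" "g \<in> Ar C" "Dom C g = Dom C f" "Cod C g = Cod C f"
  shows "Add C f g = Add C g f"
proof -
  interpret comm_group "Mor_group C (Dom C f) (Cod C f)" using Mor_comm_group assms by simp
  show ?thesis using m_comm[of f g] assms by (simp add: Mor_group_simps)
qed

lemma Add_assoc:
  assumes "f \<in> Ar C" "g \<in> Ar C" "h \<in> Ar C" "Dom C g = Dom C f" "Cod C g = Cod C f"
    "Dom C h = Dom C f" "Cod C h = Cod C f"
  shows "Add C (Add C f g) h = Add C f (Add C g h)"
proof -
  interpret comm_group "Mor_group C (Dom C f) (Cod C f)" using Mor_comm_group assms by simp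
  show ?thesis using m_assoc[of f g h] assms by (simp add: Mor_group_simps)
qed

lemma Add_Zero_simps [simp]:
  assumes "f \<in> Ar C" "Dom C f = X" "Cod C f = Y"
  shows "Add C f (Zero C X Y) = f" "Add C (Zero C X Y) f = f"
proof -
  interpret comm_group "Mor_group C (Dom C f) (Cod C f)" using Mor_comm_group assms(1) by simp
  show "Add C f (Zero C X Y) = f" "Add C (Zero C X Y) f = f"
    using r_one[of f] l_one[of f] assms Dom_Ob_simp[of f] Cod_Ob_simp[of f] by (simp_all add: Mor_group_simps)
qed

lemma Add_Neg_simps [simp]:
  assumes "f \<in> Ar C"
  shows "Add C f (Neg C f) = Zero C (Dom C f) (Cod C f)"
    "Add C (Neg C f) f = Zero C (Dom C f) (Cod C f)"
proof -
  interpret comm_group "Mor_group C (Dom C f) (Cod C f)" using Mor_comm_group assms(1) by simp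
  show "Add C f (Neg C f) = Zero C (Dom C f) (Cod C f)"
    "Add C (Neg C f) f = Zero C (Dom C f) (Cod C f)"
    using r_inv[of f] l_inv[of f] assms by (simp_all add: Mor_group_simps Neg_def)
qed

lemma Neg_unique:
  assumes "f \<in> Mor C X Y" "g \<in> Mor C X Y" "Add C f g = Zero C X Y"
  shows "g = Neg C f"
proof -
  interpret comm_group "Mor_group C X Y" using Mor_comm_group assms(1) by simp
  have "Add C g f = Zero C X Y" using assms Add_commute[of f g] by simp
  then have "inv\<^bsub>Mor_group C X Y\<^esub> f = g"
    using inv_equality[of g f] assms by (simp add: Mor_group_simps)
  then show ?thesis using assms by (simp add: Neg_def)
qed

lemma eq_if_Add_Neg:
  assumes "f \<in> Mor C X Y" "g \<in> Mor C X Y" "Add C f (Neg C g) = Zero C X Y"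
  shows "f = g"
proof -
  have "f = Add C f (Add C (Neg C g) g)" using assms(1,2) by simp
  also have "\<dots> = Add C (Add C f (Neg C g)) g"
    using assms(1,2) by (subst Add_assoc) simp_all
  also have "\<dots> = g" using assms by simp
  finally show ?thesis .
qed

lemma Neg_Neg [simp]: "f \<in> Ar C \<Longrightarrow> Neg C (Neg C f) = f"
  by (rule Neg_unique[of "Neg C f" "Dom C f" "Cod C f", symmetric]) simp_all

lemma Neg_Zero [simp]: "X \<in> Ob C \<Longrightarrow> Y \<in> Ob C \<Longrightarrow> Neg C (Zero C X Y) = Zero C X Y"
  by (rule Neg_unique[of "Zero C X Y" X Y, symmetric]) simp_all

lemma Neg_eq_iff [simp]: "f \<in> Ar C \<Longrightarrow> g \<in> Ar C \<Longrightarrow> Neg C f = Neg C g \<longleftrightarrow> f = g"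
  by (metis Neg_Neg)

lemma Cmp_Add_distrib:
  assumes "f \<in> Ar C" "g \<in> Ar C" "Dom C g = Dom C f" "Cod C g = Cod C f"
  shows "h \<in> Ar C \<Longrightarrow> Dom C h = Cod C f \<Longrightarrow> h \<cdot> Add C f g = Add C (h \<cdot> f) (h \<cdot> g)"
    and "h \<in> Ar C \<Longrightarrow> Cod C h = Dom C f \<Longrightarrow> Add C f g \<cdot> h = Add C (f \<cdot> h) (g \<cdot> h)"
  using Cmp_Add_right[of f "Dom C f" "Cod C f" g h "Cod C h"]
    Cmp_Add_left[of h "Dom C h" "Dom C f" f "Cod C f" g] assms by auto

text \<open>An idempotent of a group is neutral. This turns bilinearity of composition, and
  additivity of a functor, into preservation of zero arrows.\<close>

lemma Add_self_eq_Zero: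
  assumes "f \<in> Mor C X Y" "Add C f f = f" shows "f = Zero C X Y"
proof -
  have "f = Add C f (Add C f (Neg C f))" using assms(1) by simp
  also have "\<dots> = Add C (Add C f f) (Neg C f)" using assms(1) by (subst Add_assoc) simp_all
  also have "\<dots> = Zero C X Y" using assms by simp
  finally show ?thesis .
qed

lemma Cmp_Zero_simps [simp]:
  assumes "f \<in> Ar C" "X \<in> Ob C"
  shows "Dom C f = Y \<Longrightarrow> f \<cdot> Zero C X Y = Zero C X (Cod C f)"
    and "Cod C f = Y \<Longrightarrow> Zero C Y X \<cdot> f = Zero C (Dom C f) X"
proof -
  show "f \<cdot> Zero C X Y = Zero C X (Cod C f)" if "Dom C f = Y"
    by (rule Add_self_eq_Zero) (use assms that in \<open>auto simp flip: Cmp_Add_distrib(1)\<close>)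
  show "Zero C Y X \<cdot> f = Zero C (Dom C f) X" if "Cod C f = Y"
    by (rule Add_self_eq_Zero) (use assms that in \<open>auto simp flip: Cmp_Add_distrib(2)\<close>)
qed

lemma Cmp_Neg_simps [simp]:
  assumes "f \<in> Ar C" "g \<in> Ar C" "Dom C g = Cod C f"
  shows "g \<cdot> Neg C f = Neg C (g \<cdot> f)" "Neg C g \<cdot> f = Neg C (g \<cdot> f)"
  by (rule Neg_unique[of _ "Dom C f" "Cod C g"];
      use assms in \<open>simp flip: Cmp_Add_distrib\<close>)+

text \<open>Every arrow into or out of \<open>Z\<close> factors through the identity of
  \<open>Z\<close>, so it vanishes as soon as the identity does. Unlike the universal property, this
  equation is visibly preserved by additive functors.\<close>

lemma zero_object_iff: "zero_object C Z \<longleftrightarrow> Z \<in> Ob C \<and> Id C Z = Zero C Z Z"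
proof
  assume "zero_object C Z"
  then have Z: "Z \<in> Ob C" "\<exists>!f. f \<in> Mor C Z Z" unfolding zero_object_def by blast+
  then have "Id C Z \<in> Mor C Z Z" "Zero C Z Z \<in> Mor C Z Z" by simp_all
  with Z show "Z \<in> Ob C \<and> Id C Z = Zero C Z Z" by blast
next
  assume Z: "Z \<in> Ob C \<and> Id C Z = Zero C Z Z"
  have "f = Zero C X Z" if "f \<in> Mor C X Z" for f X
  proof -
    have "f = Id C Z \<cdot> f" using that by simp
    also have "\<dots> = Zero C X Z" using that Z by (auto simp del: Cmp_Id_simps)
    finally show ?thesis .
  qed
  moreover have "f = Zero C Z X" if "f \<in> Mor C Z X" for f X
  proof -
    have "f = f \<cdot> Id C Z" using that by simp
    also have "\<dots> = Zero C Z X" using that Z by (auto simp del: Cmp_Id_simps)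
    finally show ?thesis .
  qed
  moreover have "Zero C X Z \<in> Mor C X Z" "Zero C Z X \<in> Mor C Z X" if "X \<in> Ob C" for X
    using that Z by simp_all
  ultimately show "zero_object C Z" unfolding zero_object_def using Z by blast
qed

lemma zero_object_Mor:
  assumes "zero_object C Z"
  shows "f \<in> Mor C X Z \<Longrightarrow> f = Zero C X Z" and "f \<in> Mor C Z X \<Longrightarrow> f = Zero C Z X"
proof -
  have Z: "Z \<in> Ob C" using assms by (simp add: zero_object_def)
  show "f = Zero C X Z" if f: "f \<in> Mor C X Z"
  proof -
    have "Zero C X Z \<in> Mor C X Z" "X \<in> Ob C" using f Z by simp_all
    then show ?thesis using assms f unfolding zero_object_def by blast
  qed
  show "f = Zero C Z X" if f: "f \<in> Mor C Z X"
  proof -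
    have "Zero C Z X \<in> Mor C Z X" "X \<in> Ob C" using f Z by simp_all
    then show ?thesis using assms f unfolding zero_object_def by blast
  qed
qed

lemma zero_object_isomorphic:
  assumes "zero_object C Z" "zero_object C Z'"
  shows "isomorphic C Z Z'" "is_isomorphism C (Zero C Z Z')"
proof -
  have [simp]: "Z \<in> Ob C" "Z' \<in> Ob C" "Id C Z = Zero C Z Z" "Id C Z' = Zero C Z' Z'"
    using assms by (simp_all add: zero_object_iff)
  show iso: "is_isomorphism C (Zero C Z Z')"
    by (rule is_isomorphismI[of _ Z Z' "Zero C Z' Z"]) simp_all
  show "isomorphic C Z Z'" by (rule isomorphicI[OF _ iso]) simp
qed

lemma zero_object_iso:
  assumes "zero_object C Z" "isomorphic C Z Z'" shows "zero_object C Z'"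
proof -
  obtain f where f: "f \<in> Mor C Z Z'" "is_isomorphism C f" using assms(2) by (rule isomorphicE)
  obtain g where g: "g \<in> Mor C Z' Z" "f \<cdot> g = Id C Z'" using is_isomorphismE[OF f(2,1)] .
  have "f = Zero C Z Z'" using zero_object_Mor(2)[OF assms(1) f(1)] .
  then have "Id C Z' = Zero C Z' Z'" using f(1) g by simp
  then show ?thesis using f(1) by (simp add: zero_object_iff)
qed

lemma is_isomorphism_Neg [simp]:
  assumes "is_isomorphism C f" shows "is_isomorphism C (Neg C f)"
proof -
  obtain g where g: "g \<in> Mor C (Cod C f) (Dom C f)" "g \<cdot> f = Id C (Dom C f)" "f \<cdot> g = Id C (Cod C f)"
    using is_isomorphismD[OF assms] by blast
  show ?thesis
    by (rule is_isomorphismI[of _ "Dom C f" "Cod C f" "Neg C g"]) (use assms g in auto)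
qed

end

section \<open>Additive functors\<close>

locale additive_cat_functor = cat_functor C D F + C: additive_category C + D: additive_category D
  for C :: "('o, 'm, 'y) suspended_data_scheme"
    and D :: "('p, 'q, 'z) suspended_data_scheme"
    and F :: "('o, 'm, 'p, 'q) functor_data" +
  assumes FA_Add: "f \<in> Mor C X Y \<Longrightarrow> g \<in> Mor C X Y \<Longrightarrow>
    FA F (Add C f g) = Add D (FA F f) (FA F g)"
begin

lemma FA_Add_simp [simp]:
  "f \<in> Ar C \<Longrightarrow> g \<in> Ar C \<Longrightarrow> Dom C g = Dom C f \<Longrightarrow> Cod C g = Cod C f \<Longrightarrow>
    FA F (Add C f g) = Add D (FA F f) (FA F g)"
  by (rule FA_Add[of _ "Dom C f" "Cod C f"]) simp_all

lemma FA_Zero [simp]: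
  "X \<in> Ob C \<Longrightarrow> Y \<in> Ob C \<Longrightarrow> FA F (Zero C X Y) = Zero D (FO F X) (FO F Y)"
  by (rule D.Add_self_eq_Zero) (simp_all flip: FA_Add_simp)

lemma FA_Neg [simp]: "f \<in> Ar C \<Longrightarrow> FA F (Neg C f) = Neg D (FA F f)"
  by (rule D.Neg_unique[of _ "FO F (Dom C f)" "FO F (Cod C f)"]) (simp_all flip: FA_Add_simp)

lemma additive_functor_axioms: "additive_functor C D F"
  unfolding additive_functor_def using cat_functor_axioms FA_Add by blast

lemma zero_object_FO: "zero_object C Z \<Longrightarrow> zero_object D (FO F Z)"
  by (simp add: C.zero_object_iff D.zero_object_iff flip: FA_Id_simp FA_Zero)

text \<open>Additivity turns an equality of images into the vanishing of the image of a difference,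
  so the kernel decides faithfulness. The suspension of the quotient and the canonical functors are
  treated in this way.\<close>

lemma faithfulI:
  assumes kernel: "\<And>X Y f. f \<in> Mor C X Y \<Longrightarrow> FA F f = Zero D (FO F X) (FO F Y) \<Longrightarrow> f = Zero C X Y"
    and f: "f \<in> Mor C X Y" and g: "g \<in> Mor C X Y" and eq: "FA F f = FA F g"
  shows "f = g"
proof -
  have "FA F (Add C f (Neg C g)) = Zero D (FO F X) (FO F Y)" using f g eq by simp
  then have "Add C f (Neg C g) = Zero C X Y" using f g kernel[of "Add C f (Neg C g)" X Y] by simp
  then show ?thesis by (rule C.eq_if_Add_Neg[OF f g])
qed

end

section \<open>Exact triangles\<close>

text \<open>\<open>Tri\<close> holds bare triples of arrows. Carrying the three objects as
  parameters makes the typing of all arrows available at once and lets rules match on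
  vertices.\<close>

definition triangle ::
  "('o, 'm, 'z) triangulated_data_scheme \<Rightarrow> 'o \<Rightarrow> 'o \<Rightarrow> 'o \<Rightarrow> 'm \<Rightarrow> 'm \<Rightarrow> 'm \<Rightarrow> bool" where
  "triangle C X Y Z f g h \<longleftrightarrow> (f, g, h) \<in> Tri C \<and>
     f \<in> Mor C X Y \<and> g \<in> Mor C Y Z \<and> h \<in> Mor C Z (FO (Sus C) X)"

lemma triangle_Mor:
  assumes "triangle C X Y Z f g h"
  shows "f \<in> Mor C X Y" "g \<in> Mor C Y Z" "h \<in> Mor C Z (FO (Sus C) X)" "(f, g, h) \<in> Tri C"
  using assms by (simp_all add: triangle_def)

text \<open>The axioms up to TR3; the octahedral axiom is not available while the quotient is being
  shown to be triangulated.\<close>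

locale pretriangulated_category = additive_category C
  for C :: "('o, 'm, 'z) triangulated_data_scheme" (structure) +
  assumes Sus_equivalence: "equivalence_functor C C (Sus C)"
    and Sus_additive: "additive_functor C C (Sus C)"
    and Tri_candidate: "t \<in> Tri C \<Longrightarrow> candidate_triangle C t"
    and Tri_iso: "t \<in> Tri C \<Longrightarrow> isomorphic_triangles C t t' \<Longrightarrow> t' \<in> Tri C"
    and TR1_Id: "X \<in> Ob C \<Longrightarrow> zero_object C Z \<Longrightarrow>
      (Id C X, Zero C X Z, Zero C Z (FO (Sus C) X)) \<in> Tri C"
    and TR1_ex: "f \<in> Ar C \<Longrightarrow> \<exists>g h. (f, g, h) \<in> Tri C"
    and TR2: "candidate_triangle C (f, g, h) \<Longrightarrow>
      (f, g, h) \<in> Tri C \<longleftrightarrow> (g, h, Neg C (FA (Sus C) f)) \<in> Tri C"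
    and TR3: "(f, g, h) \<in> Tri C \<Longrightarrow> (f', g', h') \<in> Tri C \<Longrightarrow>
      a \<in> Mor C (Dom C f) (Dom C f') \<Longrightarrow> b \<in> Mor C (Cod C f) (Cod C f') \<Longrightarrow>
      b \<cdot> f = f' \<cdot> a \<Longrightarrow> \<exists>c. triangle_morphism C (f, g, h) (f', g', h') a b c"
begin

abbreviation susO :: "'o \<Rightarrow> 'o" where "susO X \<equiv> FO (Sus C) X"
abbreviation susA :: "'m \<Rightarrow> 'm" where "susA f \<equiv> FA (Sus C) f"

end

sublocale pretriangulated_category \<subseteq> sus: fully_faithful_functor C C "Sus C"
  by (rule equivalence_functorD(1)) (rule Sus_equivalence)

sublocale pretriangulated_category \<subseteq> sus: additive_cat_functor C C "Sus C"
proof unfold_locales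
  fix f g X Y assume f: "f \<in> Mor C X Y" and g: "g \<in> Mor C X Y"
  then have "X \<in> Ob C" "Y \<in> Ob C" by simp_all
  with f g Sus_additive show "FA (Sus C) (Add C f g) = Add C (FA (Sus C) f) (FA (Sus C) g)"
    unfolding additive_functor_def by blast
qed

context pretriangulated_category
begin

lemma sus_essE:
  assumes "Y \<in> Ob C"
  obtains X e where "X \<in> Ob C" "e \<in> Mor C (susO X) Y" "is_isomorphism C e"
  using equivalence_functorD(2)[OF Sus_equivalence assms] by (blast elim: isomorphicE)

lemma triangleI:
  assumes "(f, g, h) \<in> Tri C" shows "triangle C (Dom C f) (Cod C f) (Cod C g) f g h"
  using assms Tri_candidate[OF assms] by (simp add: triangle_def candidate_triangle_def)

lemma triangle_iso:
  assumes T: "triangle C X Y Z f g h"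
    and "f' \<in> Mor C X' Y'" "g' \<in> Mor C Y' Z'" "h' \<in> Mor C Z' (susO X')"
    and "a \<in> Mor C X X'" "b \<in> Mor C Y Y'" "c \<in> Mor C Z Z'"
    and "is_isomorphism C a" "is_isomorphism C b" "is_isomorphism C c"
    and "b \<cdot> f = f' \<cdot> a" "c \<cdot> g = g' \<cdot> b" "susA a \<cdot> h = h' \<cdot> c"
  shows "triangle C X' Y' Z' f' g' h'"
proof -
  have "triangle_morphism C (f, g, h) (f', g', h') a b c"
    using assms triangle_Mor[OF T] by (simp add: triangle_morphism_def)
  then have "isomorphic_triangles C (f, g, h) (f', g', h')"
    unfolding isomorphic_triangles_def candidate_triangle_def
    using assms(2-10) triangle_Mor[OF T] by auto
  from Tri_iso[OF _ this] assms(2-4) triangle_Mor[OF T] show ?thesis by (simp add: triangle_def)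
qed

lemma rotate:
  assumes T: "triangle C X Y Z f g h"
  shows "triangle C Y Z (susO X) g h (Neg C (susA f))"
  using triangle_Mor[OF T] TR2[of f g h] by (simp add: triangle_def candidate_triangle_def)

lemma rotate_back:
  assumes f: "f \<in> Mor C X Y" and T: "triangle C Y Z (susO X) g h (Neg C (susA f))"
  shows "triangle C X Y Z f g h"
  using f triangle_Mor[OF T] TR2[of f g h] by (simp add: triangle_def candidate_triangle_def)

lemma triangle_Id:
  assumes "X \<in> Ob C" "zero_object C Z"
  shows "triangle C X X Z (Id C X) (Zero C X Z) (Zero C Z (susO X))"
  using TR1_Id[OF assms] assms by (simp add: triangle_def zero_object_iff)

lemma triangle_map:
  assumes T: "triangle C X Y Z f g h" and T': "triangle C X' Y' Z' f' g' h'"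
    and "a \<in> Mor C X X'" "b \<in> Mor C Y Y'" "b \<cdot> f = f' \<cdot> a"
  obtains c where "c \<in> Mor C Z Z'" "c \<cdot> g = g' \<cdot> b" "susA a \<cdot> h = h' \<cdot> c"
proof -
  obtain c where "triangle_morphism C (f, g, h) (f', g', h') a b c"
    using TR3[of f g h f' g' h' a b] triangle_Mor[OF T] triangle_Mor[OF T'] assms(3-5) by auto
  then have "c \<in> Mor C Z Z'" "c \<cdot> g = g' \<cdot> b" "susA a \<cdot> h = h' \<cdot> c"
    using triangle_Mor[OF T] triangle_Mor[OF T'] by (simp_all add: triangle_morphism_def)
  then show thesis by (rule that)
qed

text \<open>The identity triangle on \<open>X\<close> maps to the given one, so
  \<open>g \<cdot> f\<close> factors through a zero object. The other two composites are this one
  after rotation.\<close>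

lemma triangle_comp_zero:
  assumes T: "triangle C X Y Z f g h"
  shows "g \<cdot> f = Zero C X Z" "h \<cdot> g = Zero C Y (susO X)" "susA f \<cdot> h = Zero C Z (susO Y)"
proof -
  have *: "g \<cdot> f = Zero C X Z" if T: "triangle C X Y Z f g h" for X Y Z f g h
  proof -
    note t = triangle_Mor[OF T]
    obtain z where z: "zero_object C z" using ex_zero_object by blast
    then have zO: "z \<in> Ob C" by (simp add: zero_object_def)
    have X: "X \<in> Ob C" using t by simp
    have "Id C X \<in> Mor C X X" using X by simp
    then obtain c where c: "c \<in> Mor C z Z" "c \<cdot> Zero C X z = g \<cdot> f"
      using triangle_map[OF triangle_Id[OF X z] T _ t(1) refl] by blast
    then show ?thesis using zO X by simp
  qed
  show "g \<cdot> f = Zero C X Z" using *[OF T] .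
  show "h \<cdot> g = Zero C Y (susO X)" using *[OF rotate[OF T]] .
  note t = triangle_Mor[OF T]
  have "Neg C (susA f \<cdot> h) = Neg C (Zero C Z (susO Y))" using *[OF rotate[OF rotate[OF T]]] t by simp
  then show "susA f \<cdot> h = Zero C Z (susO Y)" using t by (simp del: Neg_Zero)
qed

text \<open>TR3 supplies third arrows only. So the wanted first arrow is found after rotating both
  triangles, as an arrow between suspensions, and is then desuspended by fullness.\<close>

lemma weak_kernel:
  assumes T: "triangle C X Y Z f g h" and p: "p \<in> Mor C W Y" "g \<cdot> p = Zero C W Z"
  obtains q where "q \<in> Mor C W X" "f \<cdot> q = p"
proof -
  note t = triangle_Mor[OF T]
  obtain z where z: "zero_object C z" using ex_zero_object by blast
  then have zO: "z \<in> Ob C" by (simp add: zero_object_def)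
  have W: "W \<in> Ob C" using p by simp
  have "Zero C z Z \<in> Mor C z Z" "Zero C z Z \<cdot> Zero C W z = g \<cdot> p" using t p zO by simp_all
  then obtain c where c: "c \<in> Mor C (susO W) (susO X)"
    "susA p \<cdot> Neg C (susA (Id C W)) = Neg C (susA f) \<cdot> c"
    using triangle_map[OF rotate[OF triangle_Id[OF W z]] rotate[OF T] p(1)] by blast
  obtain q where q: "q \<in> Mor C W X" "c = susA q"
    using sus.fullE[OF _ _ c(1)] W t(1) by auto
  have "susA p = susA (f \<cdot> q)" using c(2) q p t by simp
  then have "p = f \<cdot> q" using p q t by (intro sus.faithful[of p W Y]) simp_all
  then show thesis using that[OF q(1)] by simp
qed

text \<open>The triangle is mapped to \<open>0 \<rightarrow> W \<rightarrow> W\<close>. That one is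
  exact because the suspension of a zero object is a zero object, so that the identity triangle of
  \<open>W\<close> can be rotated back.\<close>

lemma weak_cokernel:
  assumes T: "triangle C X Y Z f g h" and p: "p \<in> Mor C Y W" "p \<cdot> f = Zero C X W"
  obtains q where "q \<in> Mor C Z W" "q \<cdot> g = p"
proof -
  note t = triangle_Mor[OF T]
  obtain z where z: "zero_object C z" using ex_zero_object by blast
  then have zO: "z \<in> Ob C" by (simp add: zero_object_def)
  have W: "W \<in> Ob C" using p by simp
  have "triangle C z W W (Zero C z W) (Id C W) (Zero C W (susO z))"
    by (rule rotate_back)
      (use triangle_Id[OF W sus.zero_object_FO[OF z]] zO W in simp_all)
  moreover have "Zero C X z \<in> Mor C X z" "p \<cdot> f = Zero C z W \<cdot> Zero C X z" using t p zO by simp_all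
  ultimately obtain q where q: "q \<in> Mor C Z W" "q \<cdot> g = Id C W \<cdot> p"
    using triangle_map[OF T _ _ p(1)] by blast
  then have "q \<cdot> g = p" using p by simp
  with q(1) show thesis by (rule that)
qed

text \<open>Write \<open>e\<close> as the identity plus \<open>n\<close>. Then
  \<open>n \<cdot> g\<close> and \<open>h \<cdot> n\<close> vanish, so \<open>n\<close> factors as
  \<open>k \<cdot> h\<close> and has square zero; the inverse of \<open>e\<close> is the identity
  minus \<open>n\<close>. This takes the place of the long exact sequences of Hom groups.\<close>

lemma triangle_endo_iso:
  assumes T: "triangle C X Y Z f g h" and e: "e \<in> Mor C Z Z" "e \<cdot> g = g" "h \<cdot> e = h"
  shows "is_isomorphism C e"
proof -
  note t = triangle_Mor[OF T]
  have Z: "Z \<in> Ob C" using e by simp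
  define n where "n = Add C e (Neg C (Id C Z))"
  have n: "n \<in> Mor C Z Z" using e by (simp add: n_def)
  have "n \<cdot> g = Zero C Y Z" using e t by (simp add: n_def Cmp_Add_distrib)
  then obtain k where k: "k \<in> Mor C (susO X) Z" "k \<cdot> h = n"
    using weak_cokernel[OF rotate[OF T] n] by blast
  have "h \<cdot> n = Zero C Z (susO X)" using e t by (simp add: n_def Cmp_Add_distrib)
  then have nn: "n \<cdot> n = Zero C Z Z"
    using k n t Cmp_assoc_simp[of n h k] by simp
  have e_n: "e = Add C (Id C Z) n" "e = Add C n (Id C Z)"
    using e by (simp_all add: n_def Add_assoc Add_commute[of "Id C Z"])
  define e' where "e' = Add C (Id C Z) (Neg C n)"
  have e': "e' \<in> Mor C Z Z" using n by (simp add: e'_def)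
  have en: "e \<cdot> n = n" "n \<cdot> e = n" using n nn by (simp_all add: e_n(1) Cmp_Add_distrib)
  have *: "Add C e (Neg C n) = Id C Z" unfolding e_n(1) using n by (simp add: Add_assoc)
  have "e \<cdot> e' = Id C Z" "e' \<cdot> e = Id C Z"
    using e n by (simp_all add: e'_def Cmp_Add_distrib en *)
  then show ?thesis by (intro is_isomorphismI[OF e(1) e'])
qed

text \<open>A filler \<open>c'\<close> for the inverse square need not be inverse to
  \<open>c\<close>. But both composites are compatible with the second and third arrows of a
  triangle, so they are invertible by \<open>triangle_endo_iso\<close>, and hence so is
  \<open>c\<close>.\<close>

lemma five_lemma:
  assumes T: "triangle C X Y Z f g h" and T': "triangle C X' Y' Z' f' g' h'"
    and a: "a \<in> Mor C X X'" "is_isomorphism C a" and b: "b \<in> Mor C Y Y'" "is_isomorphism C b"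
    and c: "c \<in> Mor C Z Z'"
    and eq: "b \<cdot> f = f' \<cdot> a" "c \<cdot> g = g' \<cdot> b" "susA a \<cdot> h = h' \<cdot> c"
  shows "is_isomorphism C c"
proof -
  note t = triangle_Mor[OF T] triangle_Mor[OF T']
  obtain a' where a': "a' \<in> Mor C X' X" "a' \<cdot> a = Id C X" "a \<cdot> a' = Id C X'"
    using is_isomorphismE[OF a(2,1)] by blast
  obtain b' where b': "b' \<in> Mor C Y' Y" "b' \<cdot> b = Id C Y" "b \<cdot> b' = Id C Y'"
    using is_isomorphismE[OF b(2,1)] by blast
  have "f \<cdot> a' = b' \<cdot> (b \<cdot> (f \<cdot> a'))" using t a' b b' by (simp add: Cmp_ext[OF b'(2)])
  also have "\<dots> = b' \<cdot> f'" using t a a' b b' by (simp add: Cmp_ext[OF eq(1)])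
  finally have "b' \<cdot> f' = f \<cdot> a'" by simp
  then obtain c' where c': "c' \<in> Mor C Z' Z" "c' \<cdot> g' = g \<cdot> b'" "susA a' \<cdot> h' = h \<cdot> c'"
    using triangle_map[OF T' T a'(1) b'(1)] by blast
  have sa: "susA a' \<cdot> susA a = Id C (susO X)" "susA a \<cdot> susA a' = Id C (susO X')"
    using a a' by (simp_all flip: sus.FA_Cmp_simp)
  have "is_isomorphism C (c' \<cdot> c)"
  proof (rule triangle_endo_iso[OF T])
    show "(c' \<cdot> c) \<cdot> g = g"
      using t c c'(1) b b' by (simp add: eq(2) Cmp_ext[OF c'(2)])
    have "h \<cdot> (c' \<cdot> c) = susA a' \<cdot> (susA a \<cdot> h)"
      using t c c'(1) a a' by (simp add: eq(3) Cmp_ext[OF c'(3)[symmetric]])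
    also have "\<dots> = h" using t a a' by (simp add: Cmp_ext[OF sa(1)])
    finally show "h \<cdot> (c' \<cdot> c) = h" .
  qed (use c c' in simp)
  moreover have "is_isomorphism C (c \<cdot> c')"
  proof (rule triangle_endo_iso[OF T'])
    show "(c \<cdot> c') \<cdot> g' = g'"
      using t c c' b b' by (simp add: Cmp_ext[OF eq(2)])
    have "h' \<cdot> (c \<cdot> c') = susA a \<cdot> (susA a' \<cdot> h')"
      using t c c' a a' by (simp add: Cmp_ext[OF eq(3)[symmetric]])
    also have "\<dots> = h'" using t a a' by (simp add: Cmp_ext[OF sa(2)])
    finally show "h' \<cdot> (c \<cdot> c') = h'" .
  qed (use c c' in simp)
  ultimately show ?thesis by (rule iso_both_sides[OF c c'(1) c'(1)])
qed

lemma triangle_iso_ex: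
  assumes T: "triangle C X Y Z f g h" and T': "triangle C X' Y' Z' f' g' h'"
    and a: "a \<in> Mor C X X'" "is_isomorphism C a" and b: "b \<in> Mor C Y Y'" "is_isomorphism C b"
    and eq: "b \<cdot> f = f' \<cdot> a"
  obtains c where "c \<in> Mor C Z Z'" "is_isomorphism C c" "c \<cdot> g = g' \<cdot> b" "susA a \<cdot> h = h' \<cdot> c"
  using triangle_map[OF T T' a(1) b(1) eq] five_lemma[OF T T' a b _ eq] by metis

lemma cone_unique:
  assumes "triangle C X Y Z f g h" "triangle C X Y Z' f g' h'"
  shows "isomorphic C Z Z'"
proof -
  note f = triangle_Mor(1)[OF assms(1)]
  have "Id C X \<in> Mor C X X" "Id C Y \<in> Mor C Y Y" "is_isomorphism C (Id C X)"
    "is_isomorphism C (Id C Y)" "Id C Y \<cdot> f = f \<cdot> Id C X" using f by simp_all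
  then show ?thesis
    using triangle_iso_ex[OF assms] isomorphicI by metis
qed

lemma cone_ex:
  assumes "f \<in> Mor C X Y"
  obtains Z g h where "triangle C X Y Z f g h"
proof -
  obtain g h where "(f, g, h) \<in> Tri C" using TR1_ex assms by (metis Mor_iff)
  from triangleI[OF this] have "triangle C X Y (Cod C g) f g h" using assms by simp
  then show thesis by (rule that)
qed

text \<open>Rotating back needs a vertex that is a suspension: the cone of \<open>f\<close> is
  replaced by an isomorphic \<open>susO X\<close>, and the connecting arrow is desuspended after the
  sign of the rotation has been absorbed.\<close>

lemma fibre_ex:
  assumes f: "f \<in> Mor C Y Z"
  obtains X u h where "triangle C X Y Z u f h"
proof -
  obtain W g h where T: "triangle C Y Z W f g h" using cone_ex[OF f] .
  note t = triangle_Mor[OF T]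
  have "W \<in> Ob C" using t by simp
  then obtain X e where e: "X \<in> Ob C" "e \<in> Mor C (susO X) W" "is_isomorphism C e"
    by (rule sus_essE)
  obtain e' where e': "e' \<in> Mor C W (susO X)" "e' \<cdot> e = Id C (susO X)" "e \<cdot> e' = Id C W"
    "is_isomorphism C e'"
    using is_isomorphismE[OF e(3,2)] .
  have "Neg C (h \<cdot> e) \<in> Mor C (susO X) (susO Y)" using t e by simp
  then obtain u where u: "u \<in> Mor C X Y" "Neg C (h \<cdot> e) = susA u"
    using sus.fullE[OF e(1)] t(1) by (metis Mor_iff)
  have u': "h \<cdot> e = Neg C (susA u)" using Neg_Neg[of "h \<cdot> e"] t e by (simp add: u(2))
  have "triangle C Y Z (susO X) f (e' \<cdot> g) (h \<cdot> e)"
    by (rule triangle_iso[OF T, of _ _ _ _ _ _ "Id C Y" "Id C Z" e'])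
      (use t e e' in \<open>simp_all add: Cmp_ext[OF e'(2)]\<close>)
  then have "triangle C Y Z (susO X) f (e' \<cdot> g) (Neg C (susA u))"
    unfolding u' .
  then have "triangle C X Y Z u f (e' \<cdot> g)" by (rule rotate_back[OF u(1)])
  then show thesis by (rule that)
qed

text \<open>The identity of \<open>X\<close> together with \<open>f\<close> is an isomorphism from
  the arrow \<open>Id C X\<close> to the arrow \<open>f\<close>, so the two have isomorphic
  cones.\<close>

lemma iso_cone_zero:
  assumes T: "triangle C X Y Z f g h" and "is_isomorphism C f"
  shows "zero_object C Z"
proof -
  note t = triangle_Mor[OF T]
  obtain z where z: "zero_object C z" using ex_zero_object by blast
  have X: "X \<in> Ob C" using t by simp
  have "Id C X \<in> Mor C X X" "is_isomorphism C (Id C X)" using X by simp_all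
  then obtain c where c: "c \<in> Mor C z Z" "is_isomorphism C c"
    using triangle_iso_ex[OF triangle_Id[OF X z] T _ _ t(1) assms(2) refl] by blast
  then show ?thesis using zero_object_iso[OF z] isomorphicI by blast
qed

text \<open>Three rotations negate all three suspended arrows. Conjugating by minus one at the
  middle vertex repairs the first two signs and leaves the last.\<close>

lemma triangle_sus:
  assumes T: "triangle C X Y Z f g h"
  shows "triangle C (susO X) (susO Y) (susO Z) (susA f) (susA g) (Neg C (susA h))"
proof -
  note t = triangle_Mor[OF T]
  show ?thesis
    by (rule triangle_iso[OF rotate[OF rotate[OF rotate[OF T]]], of _ _ _ _ _ _
          "Id C (susO X)" "Neg C (Id C (susO Y))" "Id C (susO Z)"])
      (use t in simp_all)
qed

lemma triangle_sus_back:
  assumes T: "triangle C (susO X) (susO Y) (susO Z) (susA f) (susA g) (Neg C (susA h))"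
    and t: "f \<in> Mor C X Y" "g \<in> Mor C Y Z" "h \<in> Mor C Z (susO X)"
  shows "triangle C X Y Z f g h"
proof -
  have "triangle C (susO X) (susO Y) (susO Z) (Neg C (susA f)) (Neg C (susA g)) (Neg C (susA h))"
    by (rule triangle_iso[OF T, of _ _ _ _ _ _
          "Id C (susO X)" "Neg C (Id C (susO Y))" "Id C (susO Z)"])
      (use t in simp_all)
  then show ?thesis using t rotate_back by blast
qed

text \<open>Since \<open>p\<close> splits \<open>i\<close>, the connecting arrow vanishes and the
  cone of \<open>i\<close> is the other summand. Closure under extensions thereby gives closure
  under direct sums.\<close>

lemma direct_sum_triangle:
  assumes "direct_sum C X Y Z" "X \<in> Ob C" "Y \<in> Ob C"
  obtains W i g h where "triangle C X Z W i g h" "isomorphic C W Y"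
proof -
  obtain i j p q where m: "i \<in> Mor C X Z" "j \<in> Mor C Y Z" "p \<in> Mor C Z X" "q \<in> Mor C Z Y"
    and pi: "p \<cdot> i = Id C X" and qj: "q \<cdot> j = Id C Y"
    and qi: "q \<cdot> i = Zero C X Y" and sum: "Add C (i \<cdot> p) (j \<cdot> q) = Id C Z"
    using assms(1) unfolding direct_sum_def by blast
  obtain W g h where T: "triangle C X Z W i g h" using cone_ex[OF m(1)] .
  note t = triangle_Mor[OF T]
  obtain w where w: "w \<in> Mor C W Y" "w \<cdot> g = q" using weak_cokernel[OF T m(4) qi] .
  have gi: "g \<cdot> i = Zero C X W" using triangle_comp_zero[OF T] by simp
  have "susA i \<cdot> h = Zero C W (susO Z)"
    by (rule triangle_comp_zero(3)[OF T])
  then have "susA p \<cdot> (susA i \<cdot> h) = Zero C W (susO X)" using m t by simp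
  moreover have "susA p \<cdot> susA i = Id C (susO X)" using m pi by (simp flip: sus.FA_Cmp_simp)
  ultimately have h0: "h = Zero C W (susO X)" using m t Cmp_ext[of "susA p" "susA i" _ h] by simp
  \<comment> \<open>\<open>g \<cdot> j\<close> is a right inverse of \<open>w\<close>. The other
    composite \<open>e\<close> satisfies \<open>e \<cdot> g = g\<close>, and it is compatible with
    \<open>h\<close> because \<open>h\<close> is zero, so it is invertible.\<close>
  define e where "e = g \<cdot> (j \<cdot> w)"
  have e: "e \<in> Mor C W W" using m t w by (simp add: e_def)
  have "g = g \<cdot> Add C (i \<cdot> p) (j \<cdot> q)" using t sum by simp
  also have "\<dots> = g \<cdot> (j \<cdot> q)" using t m by (simp add: Cmp_Add_distrib Cmp_ext[OF gi])
  also have "\<dots> = e \<cdot> g" using m t w by (simp add: e_def)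
  finally have "is_isomorphism C e" using h0 e assms(2) by (intro triangle_endo_iso[OF T]) simp_all
  moreover have "is_isomorphism C (w \<cdot> (g \<cdot> j))" using m t w qj by (simp add: Cmp_ext[OF w(2)])
  moreover have gj: "g \<cdot> j \<in> Mor C Y W" "e = (g \<cdot> j) \<cdot> w" using m t w by (simp_all add: e_def)
  ultimately have "is_isomorphism C w"
    using iso_both_sides[OF w(1) gj(1) gj(1)] by metis
  then show thesis using that T isomorphicI[OF w(1)] by blast
qed

end

sublocale triangulated_category \<subseteq> pretriangulated_category
  by unfold_locales (rule Sus_equivalence Sus_additive Tri_candidate Tri_iso TR1_Id TR1_ex TR2 TR3; assumption)+

lemma (in triangulated_category) octahedral:
  assumes F: "triangle C X Y A f p d" and G: "triangle C Y Z B g p' d'"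
    and H: "triangle C X Z D (g \<cdot> f) p'' d''"
  obtains u v where "triangle C A D B u v (susA p \<cdot> d')"
    "u \<cdot> p = p'' \<cdot> g" "d'' \<cdot> u = d" "v \<cdot> p'' = p'" "susA f \<cdot> d'' = d' \<cdot> v"
proof -
  note t = triangle_Mor[OF F] triangle_Mor[OF G] triangle_Mor[OF H]
  obtain u v where uv: "(u, v, susA p \<cdot> d') \<in> Tri C"
    "triangle_morphism C (f, p, d) (g \<cdot> f, p'', d'') (Id C X) g u"
    "triangle_morphism C (g \<cdot> f, p'', d'') (g, p', d') f (Id C Z) v"
    using TR4[of f p d g p' d' p'' d''] t by auto
  have u: "u \<in> Mor C A D" "u \<cdot> p = p'' \<cdot> g" "susA (Id C X) \<cdot> d = d'' \<cdot> u"
    using uv(2) t unfolding triangle_morphism_def by (simp_all only: prod.case Mor_iff)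
  have v: "v \<in> Mor C D B" "v \<cdot> p'' = p' \<cdot> Id C Z" "susA f \<cdot> d'' = d' \<cdot> v"
    using uv(3) t unfolding triangle_morphism_def by (simp_all only: prod.case Mor_iff)
  have "triangle C A D B u v (susA p \<cdot> d')"
    unfolding triangle_def using uv(1) u(1) v(1) t by simp
  moreover have "d'' \<cdot> u = d" "v \<cdot> p'' = p'" using u v t by simp_all
  ultimately show thesis using that u(2) v(3) by blast
qed

section \<open>Triangulated subcategories\<close>

locale triangulated_sub = pretriangulated_category +
  fixes N
  assumes triangulated_subcategory: "triangulated_subcategory C N"
begin

lemma N_Ob [simp]: "X \<in> N \<Longrightarrow> X \<in> Ob C"
  using triangulated_subcategory unfolding triangulated_subcategory_def by blast

lemma N_iso: "X \<in> N \<Longrightarrow> isomorphic C X Y \<Longrightarrow> Y \<in> N"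
  using triangulated_subcategory isomorphic_Ob unfolding triangulated_subcategory_def by blast

lemma N_zero: "zero_object C Z \<Longrightarrow> Z \<in> N"
  using triangulated_subcategory zero_object_isomorphic N_iso
  unfolding triangulated_subcategory_def by blast

lemma N_sus: "X \<in> Ob C \<Longrightarrow> susO X \<in> N \<longleftrightarrow> X \<in> N"
  using triangulated_subcategory unfolding triangulated_subcategory_def by blast

lemma N_third:
  assumes T: "triangle C X Y Z f g h" and "X \<in> N" "Y \<in> N" shows "Z \<in> N"
proof -
  have "\<forall>(f, g, h) \<in> Tri C. Dom C f \<in> N \<and> Cod C f \<in> N \<longrightarrow> Cod C g \<in> N"
    using triangulated_subcategory unfolding triangulated_subcategory_def by blast
  from bspec[OF this triangle_Mor(4)[OF T]] show ?thesis
    using triangle_Mor(1,2)[OF T] assms(2,3) by simp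
qed

text \<open>Rotation brings the missing vertex into the position of the cone, and membership in
  \<open>N\<close> is not affected by suspension.\<close>

lemma N_first:
  assumes T: "triangle C X Y Z f g h" and "Y \<in> N" "Z \<in> N" shows "X \<in> N"
  using N_third[OF rotate[OF T] assms(2,3)] triangle_Mor(1)[OF T] N_sus[of X] by simp

lemma N_second:
  assumes T: "triangle C X Y Z f g h" and "X \<in> N" "Z \<in> N" shows "Y \<in> N"
  using N_third[OF rotate[OF rotate[OF T]]] triangle_Mor(1)[OF T] N_sus[of X] N_sus[of Y] assms(2,3)
  by simp

lemma N_direct_sum:
  assumes "direct_sum C X Y Z" "X \<in> N" "Y \<in> N" shows "Z \<in> N"
proof -
  obtain W i g h where T: "triangle C X Z W i g h" and W: "isomorphic C W Y"
    using direct_sum_triangle[OF assms(1) N_Ob[OF assms(2)] N_Ob[OF assms(3)]] by blast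
  show ?thesis using N_second[OF T assms(2) N_iso[OF assms(3) isomorphic_sym[OF W]]] .
qed

end

section \<open>Denominators and fractions\<close>

locale verdier = triangulated_category C + triangulated_sub C N
  for C :: "('o, 'm) triangulated_data" (structure) and N
begin

abbreviation den :: "'m set" where "den \<equiv> denominators C N"

lemma den_Ar [simp]: "s \<in> den \<Longrightarrow> s \<in> Ar C"
  by (simp add: denominators_def)

text \<open>The definition asks for one cone in \<open>N\<close>. Cones are unique up to isomorphism
  and \<open>N\<close> is closed under isomorphism, so any cone decides.\<close>

lemma den_iff_cone:
  assumes T: "triangle C X Y Z s g h" shows "s \<in> den \<longleftrightarrow> Z \<in> N"
proof
  note t = triangle_Mor[OF T]
  assume "s \<in> den"
  then obtain g' h' where T': "(s, g', h') \<in> Tri C" "Cod C g' \<in> N"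
    unfolding denominators_def by blast
  have "triangle C X Y (Cod C g') s g' h'" using triangleI[OF T'(1)] t by simp
  with T' show "Z \<in> N" using cone_unique[OF _ T] N_iso by blast
next
  note t = triangle_Mor[OF T]
  assume "Z \<in> N"
  then have "s \<in> Ar C \<and> (s, g, h) \<in> Tri C \<and> Cod C g \<in> N" using t by simp
  then show "s \<in> den" unfolding denominators_def by blast
qed

lemma den_iso: "is_isomorphism C s \<Longrightarrow> s \<in> den"
proof -
  assume s: "is_isomorphism C s"
  then have "s \<in> Mor C (Dom C s) (Cod C s)" by simp
  then obtain Z g h where T: "triangle C (Dom C s) (Cod C s) Z s g h" by (rule cone_ex)
  show "s \<in> den" using den_iff_cone[OF T] N_zero[OF iso_cone_zero[OF T s]] by simp
qed

lemma den_Id [simp]: "X \<in> Ob C \<Longrightarrow> Id C X \<in> den"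
  by (rule den_iso) simp

text \<open>By the octahedral axiom the cones of \<open>f\<close>, of \<open>g \<cdot> f\<close> and
  of \<open>g\<close> form a triangle, and \<open>N\<close> contains each vertex of a triangle whose
  other two vertices it contains.\<close>

lemma den_two_of_three:
  assumes f: "f \<in> Mor C X Y" and g: "g \<in> Mor C Y Z"
  shows "f \<in> den \<Longrightarrow> g \<in> den \<Longrightarrow> g \<cdot> f \<in> den"
    and "g \<cdot> f \<in> den \<Longrightarrow> g \<in> den \<Longrightarrow> f \<in> den"
    and "g \<cdot> f \<in> den \<Longrightarrow> f \<in> den \<Longrightarrow> g \<in> den"
proof -
  obtain A p d where F: "triangle C X Y A f p d" using cone_ex[OF f] .
  obtain B p' d' where G: "triangle C Y Z B g p' d'" using cone_ex[OF g] .
  have "g \<cdot> f \<in> Mor C X Z" using f g by simp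
  then obtain D p'' d'' where H: "triangle C X Z D (g \<cdot> f) p'' d''" by (rule cone_ex)
  obtain u v where T: "triangle C A D B u v (susA p \<cdot> d')" using octahedral[OF F G H] .
  note * = den_iff_cone[OF F] den_iff_cone[OF G] den_iff_cone[OF H]
  show "f \<in> den \<Longrightarrow> g \<in> den \<Longrightarrow> g \<cdot> f \<in> den"
    and "g \<cdot> f \<in> den \<Longrightarrow> g \<in> den \<Longrightarrow> f \<in> den"
    and "g \<cdot> f \<in> den \<Longrightarrow> f \<in> den \<Longrightarrow> g \<in> den"
    unfolding * using N_first[OF T] N_second[OF T] N_third[OF T] by blast+
qed

lemma den_Cmp [simp]: "f \<in> den \<Longrightarrow> g \<in> den \<Longrightarrow> Dom C g = Cod C f \<Longrightarrow> g \<cdot> f \<in> den"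
  by (rule den_two_of_three(1)[of _ "Dom C f" "Cod C f" _ "Cod C g"]) simp_all

text \<open>\<open>t\<close> is the fibre of \<open>f\<close> followed by the arrow to the cone of
  \<open>s\<close>. It has the same cone as \<open>s\<close>, and \<open>f \<cdot> t\<close> factors
  through \<open>s\<close> because it dies in that cone.\<close>

lemma den_Ore:
  assumes s: "s \<in> Mor C X Y" "s \<in> den" and f: "f \<in> Mor C W Y"
  obtains V t f' where "t \<in> Mor C V W" "t \<in> den" "f' \<in> Mor C V X" "f \<cdot> t = s \<cdot> f'"
proof -
  obtain Z g h where T: "triangle C X Y Z s g h" using cone_ex[OF s(1)] .
  note t = triangle_Mor[OF T]
  have "g \<cdot> f \<in> Mor C W Z" using f t by simp
  then obtain V v k where T': "triangle C V W Z v (g \<cdot> f) k" by (rule fibre_ex)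
  note t' = triangle_Mor[OF T']
  have v: "v \<in> den" using den_iff_cone[OF T'] den_iff_cone[OF T] s by simp
  have "g \<cdot> (f \<cdot> v) = Zero C V Z" using triangle_comp_zero(1)[OF T'] f t t' by simp
  moreover have "f \<cdot> v \<in> Mor C V Y" using f t' by simp
  ultimately obtain q where "q \<in> Mor C V X" "s \<cdot> q = f \<cdot> v" using weak_kernel[OF T] by blast
  then show thesis using that[OF t'(1) v] by metis
qed

text \<open>\<open>q\<close> is the fibre of \<open>b\<close>, whose cone is \<open>U\<close>;
  consecutive arrows of a triangle compose to zero.\<close>

lemma den_kills:
  assumes b: "b \<in> Mor C W U" and U: "U \<in> N"
  obtains V q where "q \<in> Mor C V W" "q \<in> den" "b \<cdot> q = Zero C V U"
proof -
  obtain V q h where T: "triangle C V W U q b h" using fibre_ex[OF b] .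
  have "q \<in> den" using den_iff_cone[OF T] U by simp
  then show thesis using that triangle_Mor(1)[OF T] triangle_comp_zero(1)[OF T] by blast
qed

text \<open>\<open>d\<close> factors through the fibre of \<open>s\<close>, which lies in
  \<open>N\<close>, and any arrow into \<open>N\<close> is killed by a denominator.\<close>

lemma den_cancel_zero:
  assumes s: "s \<in> Mor C X Y" "s \<in> den" and d: "d \<in> Mor C W X" "s \<cdot> d = Zero C W Y"
  obtains V q where "q \<in> Mor C V W" "q \<in> den" "d \<cdot> q = Zero C V X"
proof -
  obtain U u h where T: "triangle C U X Y u s h" using fibre_ex[OF s(1)] .
  note t = triangle_Mor[OF T]
  have "susO U \<in> N" using den_iff_cone[OF rotate[OF T]] s by simp
  then have U: "U \<in> N" using N_sus t by simp
  obtain e where e: "e \<in> Mor C W U" "u \<cdot> e = d" using weak_kernel[OF T d] .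
  obtain V q where q: "q \<in> Mor C V W" "q \<in> den" "e \<cdot> q = Zero C V U" using den_kills[OF e(1) U] .
  have "d \<cdot> q = u \<cdot> (e \<cdot> q)" using e(1) q(1) t by (subst Cmp_ext[OF e(2)]) simp_all
  then have "d \<cdot> q = Zero C V X" using q t by simp
  then show thesis using that q by blast
qed

lemma den_cancel:
  assumes s: "s \<in> Mor C X Y" "s \<in> den" and x: "x \<in> Mor C W X" and y: "y \<in> Mor C W X"
    and eq: "s \<cdot> x = s \<cdot> y"
  obtains V q where "q \<in> Mor C V W" "q \<in> den" "x \<cdot> q = y \<cdot> q"
proof -
  have "Add C x (Neg C y) \<in> Mor C W X" "s \<cdot> Add C x (Neg C y) = Zero C W Y"
    using s x y eq by (simp_all add: Cmp_Add_distrib)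
  then obtain V q where q: "q \<in> Mor C V W" "q \<in> den" "Add C x (Neg C y) \<cdot> q = Zero C V X"
    using den_cancel_zero[OF s] by blast
  have "x \<cdot> q = y \<cdot> q"
    by (rule eq_if_Add_Neg[of _ V X]) (use x y q in \<open>simp_all add: Cmp_Add_distrib\<close>)
  with q(1,2) show thesis by (rule that)
qed

lemma den_sus: "s \<in> Ar C \<Longrightarrow> susA s \<in> den \<longleftrightarrow> s \<in> den"
proof -
  assume "s \<in> Ar C"
  then have "s \<in> Mor C (Dom C s) (Cod C s)" by simp
  then obtain Z g h where T: "triangle C (Dom C s) (Cod C s) Z s g h" by (rule cone_ex)
  then have "Z \<in> Ob C" using triangle_Mor(2)[OF T] by simp
  then show ?thesis using den_iff_cone[OF T] den_iff_cone[OF triangle_sus[OF T]] N_sus[of Z] by simp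
qed

text \<open>A filler from TR3 alone need not be a denominator. Here it is composed through the cone
  \<open>D\<close> of the common diagonal \<open>f \<cdot> s = t \<cdot> k\<close>: the octahedron
  on \<open>t \<cdot> k\<close> gives \<open>u\<close> with cone \<open>B\<close>, and the one on
  \<open>f \<cdot> s\<close> gives \<open>v'\<close> whose cone is the suspension of
  \<open>A\<close>.\<close>

lemma den_completion:
  assumes F: "triangle C X Y Z f g h" and K: "triangle C W V Z0 k l m"
    and s: "s \<in> Mor C W X" "s \<in> den" and t: "t \<in> Mor C V Y" "t \<in> den" and eq: "f \<cdot> s = t \<cdot> k"
  obtains z where "z \<in> Mor C Z0 Z" "z \<in> den" "z \<cdot> l = g \<cdot> t" "susA s \<cdot> m = h \<cdot> z"
proof -
  note fk = triangle_Mor[OF F] triangle_Mor[OF K]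
  have "t \<cdot> k \<in> Mor C W Y" using t fk by simp
  then obtain D p'' d'' where D: "triangle C W Y D (t \<cdot> k) p'' d''" by (rule cone_ex)
  obtain B p' d' where B: "triangle C V Y B t p' d'" using cone_ex[OF t(1)] .
  obtain A p d where A: "triangle C W X A s p d" using cone_ex[OF s(1)] .
  obtain u v where u: "triangle C Z0 D B u v (susA l \<cdot> d')" "u \<cdot> l = p'' \<cdot> t" "d'' \<cdot> u = m"
    using octahedral[OF K B D] by metis
  obtain u' v' where v': "triangle C A D Z u' v' (susA p \<cdot> h)" "v' \<cdot> p'' = g" "susA s \<cdot> d'' = h \<cdot> v'"
    using octahedral[OF A F D[folded eq]] by metis
  note m = fk triangle_Mor[OF u(1)] triangle_Mor[OF v'(1)] triangle_Mor[OF D]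
  have "u \<in> den" using den_iff_cone[OF u(1)] den_iff_cone[OF B] t by simp
  moreover have "A \<in> N" using den_iff_cone[OF A] s by simp
  then have "v' \<in> den" using den_iff_cone[OF rotate[OF v'(1)]] N_sus by simp
  ultimately have "v' \<cdot> u \<in> den" using m by simp
  moreover have "v' \<cdot> u \<in> Mor C Z0 Z" using m by simp
  moreover have "(v' \<cdot> u) \<cdot> l = g \<cdot> t" using m t by (simp add: u(2) Cmp_ext[OF v'(2)])
  moreover have "susA s \<cdot> m = h \<cdot> (v' \<cdot> u)"
    using m s by (simp add: Cmp_ext[OF v'(3)[symmetric]] u(3))
  ultimately show thesis using that by blast
qed

section \<open>Equivalence of fractions\<close>

abbreviation frac :: "'m \<Rightarrow> 'm \<Rightarrow> ('m \<times> 'm) set" where "frac \<equiv> fraction C N"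

lemma fractions_iff [simp]: "(s, f) \<in> fractions C N \<longleftrightarrow> s \<in> den \<and> f \<in> Ar C \<and> Dom C f = Dom C s"
  by (simp add: fractions_def)

lemma fraction_relI:
  assumes "s \<in> Mor C W X" "s \<in> den" "f \<in> Mor C W Y" "s' \<in> Mor C W' X'" "s' \<in> den" "f' \<in> Mor C W' Y'"
    and "u \<in> Mor C V W" "u' \<in> Mor C V W'" "s \<cdot> u = s' \<cdot> u'" "f \<cdot> u = f' \<cdot> u'" "s \<cdot> u \<in> den"
  shows "((s, f), (s', f')) \<in> fraction_rel C N"
proof -
  have "\<exists>u\<in>Mor C V (Dom C s). \<exists>u'\<in>Mor C V (Dom C s'). s \<cdot> u = s' \<cdot> u' \<and> f \<cdot> u = f' \<cdot> u' \<and> s \<cdot> u \<in> den"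
    using assms by (intro bexI[of _ u] bexI[of _ u']) simp_all
  then show ?thesis unfolding fraction_rel_def using assms(1-6) by auto
qed

text \<open>By two-of-three, \<open>s\<close> can be cancelled from \<open>s \<cdot> u\<close>, so
  both comparison legs are denominators themselves. The codomains agree because the composites
  do.\<close>

lemma fraction_relE:
  assumes "((s, f), (s', f')) \<in> fraction_rel C N"
  obtains V u u' where "u \<in> Mor C V (Dom C s)" "u \<in> den" "u' \<in> Mor C V (Dom C s')" "u' \<in> den"
    "s \<cdot> u = s' \<cdot> u'" "f \<cdot> u = f' \<cdot> u'" "(s, f) \<in> fractions C N" "(s', f') \<in> fractions C N"
    "Cod C s' = Cod C s" "Cod C f' = Cod C f"
proof -
  obtain V u u' where sf: "(s, f) \<in> fractions C N" "(s', f') \<in> fractions C N"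
    and u: "u \<in> Mor C V (Dom C s)" "u' \<in> Mor C V (Dom C s')"
      "s \<cdot> u = s' \<cdot> u'" "f \<cdot> u = f' \<cdot> u'" "s \<cdot> u \<in> den"
    using assms unfolding fraction_rel_def by blast
  have "Cod C (s \<cdot> u) = Cod C s" "Cod C (f \<cdot> u) = Cod C f" using sf u(1) by simp_all
  moreover have "Cod C (s' \<cdot> u') = Cod C s'" "Cod C (f' \<cdot> u') = Cod C f'" using sf u(2) by simp_all
  ultimately have cod: "Cod C s' = Cod C s" "Cod C f' = Cod C f" using u by simp_all
  have "u \<in> den" using den_two_of_three(2)[OF u(1), of s "Cod C s"] sf u by simp
  moreover have "u' \<in> den" using den_two_of_three(2)[OF u(2), of s' "Cod C s'"] sf u by simp
  ultimately show thesis using that u sf cod by blast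
qed

lemma fraction_rel_refl: "(s, f) \<in> fractions C N \<Longrightarrow> ((s, f), (s, f)) \<in> fraction_rel C N"
  by (rule fraction_relI[of s "Dom C s" "Cod C s" f "Cod C f" _ "Dom C s" "Cod C s" _ "Cod C f"
        "Id C (Dom C s)" "Dom C s" "Id C (Dom C s)"]) simp_all

lemma fraction_rel_sym:
  assumes "((s, f), (s', f')) \<in> fraction_rel C N" shows "((s', f'), (s, f)) \<in> fraction_rel C N"
proof -
  obtain V u u' where u: "u \<in> Mor C V (Dom C s)" "u \<in> den" "u' \<in> Mor C V (Dom C s')" "u' \<in> den"
    "s \<cdot> u = s' \<cdot> u'" "f \<cdot> u = f' \<cdot> u'" "(s, f) \<in> fractions C N" "(s', f') \<in> fractions C N"
    using fraction_relE[OF assms] by metis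
  show ?thesis
    by (rule fraction_relI[of s' "Dom C s'" "Cod C s'" f' "Cod C f'" s "Dom C s" "Cod C s" f
          "Cod C f" u' V u])
      (use u in simp_all)
qed

text \<open>The Ore square is formed over the apex of the middle fraction, where \<open>u'\<close>
  and \<open>v\<close> meet, so the two comparisons combine without cancelling a
  denominator.\<close>

lemma fraction_rel_trans:
  assumes 1: "((s, f), (s', f')) \<in> fraction_rel C N" and 2: "((s', f'), (s'', f'')) \<in> fraction_rel C N"
  shows "((s, f), (s'', f'')) \<in> fraction_rel C N"
proof -
  obtain V u u' where u: "u \<in> Mor C V (Dom C s)" "u \<in> den" "u' \<in> Mor C V (Dom C s')" "u' \<in> den"
    "s \<cdot> u = s' \<cdot> u'" "f \<cdot> u = f' \<cdot> u'" "(s, f) \<in> fractions C N" "(s', f') \<in> fractions C N"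
    using fraction_relE[OF 1] by metis
  obtain V' v v' where v: "v \<in> Mor C V' (Dom C s')" "v \<in> den" "v' \<in> Mor C V' (Dom C s'')" "v' \<in> den"
    "s' \<cdot> v = s'' \<cdot> v'" "f' \<cdot> v = f'' \<cdot> v'" "(s'', f'') \<in> fractions C N"
    using fraction_relE[OF 2] by metis
  obtain P a b where ab: "a \<in> Mor C P V'" "a \<in> den" "b \<in> Mor C P V" "v \<cdot> a = u' \<cdot> b"
    using den_Ore[OF u(3,4) v(1)] .
  have "s \<cdot> (u \<cdot> b) = s' \<cdot> (v \<cdot> a)" using u ab by (simp add: Cmp_ext[OF u(5)])
  also have "\<dots> = s'' \<cdot> (v' \<cdot> a)" using u(8) v ab(1) by (simp add: Cmp_ext[OF v(5)])
  finally have e1: "s \<cdot> (u \<cdot> b) = s'' \<cdot> (v' \<cdot> a)" .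
  have "f \<cdot> (u \<cdot> b) = f' \<cdot> (v \<cdot> a)" using u ab by (simp add: Cmp_ext[OF u(6)])
  also have "\<dots> = f'' \<cdot> (v' \<cdot> a)" using u(8) v ab(1) by (simp add: Cmp_ext[OF v(6)])
  finally have e2: "f \<cdot> (u \<cdot> b) = f'' \<cdot> (v' \<cdot> a)" .
  show ?thesis
    by (rule fraction_relI[of s "Dom C s" "Cod C s" f "Cod C f" s'' "Dom C s''" "Cod C s''" f''
          "Cod C f''" "u \<cdot> b" P "v' \<cdot> a"])
      (use u(1,2,7) v(3,4,7) ab(1-3) e1 e2 in simp_all)
qed

lemma frac_eq_iff:
  assumes "(s, f) \<in> fractions C N" "(s', f') \<in> fractions C N"
  shows "frac s f = frac s' f' \<longleftrightarrow> ((s, f), (s', f')) \<in> fraction_rel C N"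
proof
  assume "frac s f = frac s' f'"
  then have "(s', f') \<in> frac s f" using fraction_rel_refl[OF assms(2)] by (simp add: fraction_def)
  then show "((s, f), (s', f')) \<in> fraction_rel C N" by (simp add: fraction_def)
next
  assume "((s, f), (s', f')) \<in> fraction_rel C N"
  then show "frac s f = frac s' f'"
    unfolding fraction_def using fraction_rel_sym fraction_rel_trans by fast
qed

lemma frac_mem_iff: "(s', f') \<in> frac s f \<longleftrightarrow> ((s, f), (s', f')) \<in> fraction_rel C N"
  by (simp add: fraction_def)

lemma frac_eqI:
  assumes "s \<in> Mor C W X" "s \<in> den" "f \<in> Mor C W Y" "s' \<in> Mor C W' X" "s' \<in> den" "f' \<in> Mor C W' Y"
    and "u \<in> Mor C V W" "u' \<in> Mor C V W'" "s \<cdot> u = s' \<cdot> u'" "f \<cdot> u = f' \<cdot> u'" "s \<cdot> u \<in> den"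
  shows "frac s f = frac s' f'"
  using fraction_relI[OF assms] assms(1-6) by (subst frac_eq_iff) simp_all

lemma frac_eqE:
  assumes "frac s f = frac s' f'" "(s, f) \<in> fractions C N" "(s', f') \<in> fractions C N"
  obtains V u u' where "u \<in> Mor C V (Dom C s)" "u \<in> den" "u' \<in> Mor C V (Dom C s')" "u' \<in> den"
    "s \<cdot> u = s' \<cdot> u'" "f \<cdot> u = f' \<cdot> u'"
  using fraction_relE assms frac_eq_iff by metis

text \<open>The basic move of the whole development: the apex of a roof may be exchanged along any
  denominator.\<close>

lemma frac_refine:
  assumes "s \<in> Mor C W X" "s \<in> den" "f \<in> Mor C W Y" "u \<in> Mor C V W" "u \<in> den"
  shows "frac (s \<cdot> u) (f \<cdot> u) = frac s f"
  by (rule frac_eqI[of _ V X _ Y s W f "Id C V" V u]) (use assms in simp_all)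

lemma Ob_verdier_quotient [simp]: "Ob (verdier_quotient C N) = Ob C"
  by (simp add: verdier_quotient_def suspended_data.defs triangulated_data.defs localization_def)

end

section \<open>Composition and addition of fractions\<close>

context verdier
begin

abbreviation L :: "('o, ('m \<times> 'm) set) triangulated_data" where "L \<equiv> verdier_quotient C N"

abbreviation Cmp_L (infixl "\<odot>" 70) where "\<beta> \<odot> \<alpha> \<equiv> \<beta> \<cdot>\<^bsub>L\<^esub> \<alpha>"

lemma verdier_quotient_sels:
  "Ar L = fractions C N // fraction_rel C N"
  "Dom L \<alpha> = the_elem ((\<lambda>(s, f). Cod C s) ` \<alpha>)"
  "Cod L \<alpha> = the_elem ((\<lambda>(s, f). Cod C f) ` \<alpha>)"
  "Id L X = frac (Id C X) (Id C X)"
  "Cmp L \<beta> \<alpha> = \<Union>{frac (s \<cdot> t') (g \<cdot> f') | s f t g t' f'.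
       (s, f) \<in> \<alpha> \<and> (t, g) \<in> \<beta> \<and> t' \<in> den \<and> Cod C t' = Dom C s \<and>
       f' \<in> Mor C (Dom C t') (Dom C t) \<and> f \<cdot> t' = t \<cdot> f'}"
  "Add L \<alpha> \<beta> = \<Union>{frac s (Add C f g) | s f g. (s, f) \<in> \<alpha> \<and> (s, g) \<in> \<beta>}"
  "Zero L X Y = frac (Id C X) (Zero C X Y)"
  "Sus L = induced_functor C N (Sus C)"
  by (simp_all add: verdier_quotient_def suspended_data.defs triangulated_data.defs localization_def)

text \<open>\<open>Dom\<close> and \<open>Cod\<close> pick the only element of an image of the
  class. Equivalent fractions have legs with equal codomains, so that image is a singleton.\<close>

lemma Ar_frac:
  assumes "s \<in> Mor C W X" "s \<in> den" "f \<in> Mor C W Y"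
  shows "frac s f \<in> Ar L" "Dom L (frac s f) = X" "Cod L (frac s f) = Y"
proof -
  have sf: "(s, f) \<in> fractions C N" using assms by simp
  then show "frac s f \<in> Ar L" by (simp add: verdier_quotient_sels quotientI fraction_def)
  have mem: "(s, f) \<in> frac s f" using fraction_rel_refl[OF sf] by (simp add: frac_mem_iff)
  have *: "Cod C (fst z) = Cod C s \<and> Cod C (snd z) = Cod C f" if "z \<in> frac s f" for z
  proof -
    have "((s, f), (fst z, snd z)) \<in> fraction_rel C N" using that by (simp add: fraction_def)
    then show ?thesis by (rule fraction_relE) simp
  qed
  have "(\<lambda>(s, f). Cod C s) ` frac s f = (\<lambda>_. Cod C s) ` frac s f"
    "(\<lambda>(s, f). Cod C f) ` frac s f = (\<lambda>_. Cod C f) ` frac s f"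
    by (rule image_cong; use * in \<open>simp add: case_prod_unfold\<close>)+
  then have "(\<lambda>(s, f). Cod C s) ` frac s f = {Cod C s}" "(\<lambda>(s, f). Cod C f) ` frac s f = {Cod C f}"
    using mem by auto
  then show "Dom L (frac s f) = X" "Cod L (frac s f) = Y"
    using assms by (simp_all add: verdier_quotient_sels)
qed

lemma Ar_L_E:
  assumes "\<alpha> \<in> Ar L"
  obtains W s f where "s \<in> Mor C W (Dom L \<alpha>)" "s \<in> den" "f \<in> Mor C W (Cod L \<alpha>)" "\<alpha> = frac s f"
proof -
  obtain s f where sf: "(s, f) \<in> fractions C N" "\<alpha> = frac s f"
    using assms unfolding verdier_quotient_sels(1) fraction_def by (auto elim!: quotientE)
  then have m: "s \<in> Mor C (Dom C s) (Cod C s)" "s \<in> den" "f \<in> Mor C (Dom C s) (Cod C f)"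
    by simp_all
  note d = Ar_frac[OF m]
  show thesis using that[of s "Dom C s" f] m d sf by metis
qed

lemma frac_Mor:
  assumes "s \<in> Mor C W X" "s \<in> den" "f \<in> Mor C W Y"
  shows "frac s f \<in> Mor L X Y"
  using Ar_frac[OF assms] by (simp add: Mor_def)

lemma Mor_L_E:
  assumes "\<alpha> \<in> Mor L X Y"
  obtains W s f where "s \<in> Mor C W X" "s \<in> den" "f \<in> Mor C W Y" "\<alpha> = frac s f"
proof -
  have "\<alpha> \<in> Ar L" "Dom L \<alpha> = X" "Cod L \<alpha> = Y" using assms by (simp_all add: Mor_def)
  then show thesis using Ar_L_E[of \<alpha>] that by metis
qed

lemma Union_const: "A \<noteq> {} \<Longrightarrow> (\<And>x. x \<in> A \<Longrightarrow> x = c) \<Longrightarrow> \<Union>A = c"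
  by blast

text \<open>Two ambiguities are treated at once, the representatives of both fractions and the Ore
  square. The common refinement has four stages \<open>a\<close>, \<open>d\<close>,
  \<open>e\<close>, \<open>h\<close>, since each comparison must be aligned with the previous
  ones.\<close>

lemma Cmp_well_defined:
  assumes sf: "((s, f), (s1, f1)) \<in> fraction_rel C N" and tg: "((t, g), (t1, g1)) \<in> fraction_rel C N"
    and p: "p \<in> Mor C P (Dom C s)" "p \<in> den" "q \<in> Mor C P (Dom C t)" "f \<cdot> p = t \<cdot> q"
    and p1: "p1 \<in> Mor C P1 (Dom C s1)" "p1 \<in> den" "q1 \<in> Mor C P1 (Dom C t1)" "f1 \<cdot> p1 = t1 \<cdot> q1"
  shows "frac (s \<cdot> p) (g \<cdot> q) = frac (s1 \<cdot> p1) (g1 \<cdot> q1)"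
proof -
  obtain U u u1 where u: "u \<in> Mor C U (Dom C s)" "u \<in> den" "u1 \<in> Mor C U (Dom C s1)" "u1 \<in> den"
    and su: "s \<cdot> u = s1 \<cdot> u1" and fu: "f \<cdot> u = f1 \<cdot> u1"
    and sf': "(s, f) \<in> fractions C N" "(s1, f1) \<in> fractions C N"
      "Cod C s1 = Cod C s" "Cod C f1 = Cod C f"
    using fraction_relE[OF sf] by metis
  obtain V v v1 where v: "v \<in> Mor C V (Dom C t)" "v \<in> den" "v1 \<in> Mor C V (Dom C t1)" "v1 \<in> den"
    and tv: "t \<cdot> v = t1 \<cdot> v1" and gv: "g \<cdot> v = g1 \<cdot> v1"
    and tg': "(t, g) \<in> fractions C N" "(t1, g1) \<in> fractions C N"
      "Cod C t1 = Cod C t" "Cod C g1 = Cod C g"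
    using fraction_relE[OF tg] by metis
  have cod: "Cod C t = Cod C f"
  proof -
    have "Cod C (f \<cdot> p) = Cod C f" "Cod C (t \<cdot> q) = Cod C t" using p(1,3) sf' tg' by simp_all
    then show ?thesis using p(4) by simp
  qed
  \<comment> \<open>Two squares make the numerators \<open>f\<close> and \<open>f1\<close> agree
    over \<open>B\<close>: the first aligns \<open>p\<close> with the comparison leg
    \<open>u\<close>, the second aligns \<open>u1 \<cdot> b\<close> with \<open>p1\<close>.\<close>
  obtain A a b where a: "a \<in> Mor C A P" "a \<in> den" "b \<in> Mor C A U" "p \<cdot> a = u \<cdot> b"
    using den_Ore[OF u(1,2) p(1)] .
  have b: "b \<in> den"
    using den_two_of_three(2)[OF a(3) u(1)] a(1,2) p(1,2) u(2) by (simp flip: a(4))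
  have "u1 \<cdot> b \<in> Mor C A (Dom C s1)" using u a by simp
  then obtain B d c where d: "d \<in> Mor C B A" "d \<in> den" "c \<in> Mor C B P1" "(u1 \<cdot> b) \<cdot> d = p1 \<cdot> c"
    using den_Ore[OF p1(1,2)] by metis
  have c: "c \<in> den"
  proof (rule den_two_of_three(2)[OF d(3) p1(1)])
    show "p1 \<cdot> c \<in> den" unfolding d(4)[symmetric] using u(3,4) a(3) b d(1,2) by simp
  qed (rule p1(2))
  define m where "m = q \<cdot> (a \<cdot> d)"
  define n where "n = q1 \<cdot> c"
  have m: "m \<in> Mor C B (Dom C t)" and n: "n \<in> Mor C B (Dom C t1)"
    using p p1 a d by (simp_all add: m_def n_def)
  have u1bd: "u1 \<cdot> (b \<cdot> d) = p1 \<cdot> c" using d u(3) a(3) by simp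
  have pad: "p \<cdot> (a \<cdot> d) = u \<cdot> (b \<cdot> d)"
    using a(1,3) d(1) p(1) u(1) by (simp add: Cmp_ext[OF a(4)])
  have "t \<cdot> m = f \<cdot> (p \<cdot> (a \<cdot> d))"
    using a(1) d(1) p(1,3) sf' tg' cod by (simp add: m_def Cmp_ext[OF p(4)])
  also have "\<dots> = f1 \<cdot> (u1 \<cdot> (b \<cdot> d))"
    using a(3) d(1) u(1,3) sf' by (simp add: pad Cmp_ext[OF fu])
  also have "\<dots> = t1 \<cdot> n"
    using d(3) p1(1,3) sf' tg' cod by (simp add: u1bd n_def Cmp_ext[OF p1(4)])
  finally have tm: "t \<cdot> m = t1 \<cdot> n" .
  \<comment> \<open>\<open>m\<close> and \<open>n\<close> agree after \<open>t\<close> and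
    \<open>t1\<close>, but they need not factor through the apex \<open>V\<close> that compares the
    fractions with denominators \<open>t\<close> and \<open>t1\<close>. A third square pushes
    \<open>m\<close> into \<open>V\<close>.\<close>
  obtain E e k where e: "e \<in> Mor C E B" "e \<in> den" "k \<in> Mor C E V" "m \<cdot> e = v \<cdot> k"
    using den_Ore[OF v(1,2) m] .
  have "t1 \<cdot> (v1 \<cdot> k) = t \<cdot> (v \<cdot> k)"
    using v(1,3) e(3) tg' by (simp add: Cmp_ext[OF tv])
  also have "\<dots> = t1 \<cdot> (n \<cdot> e)"
    using m n e(1) tg' by (simp add: Cmp_ext[OF tm] flip: e(4))
  finally have *: "t1 \<cdot> (v1 \<cdot> k) = t1 \<cdot> (n \<cdot> e)" .
  \<comment> \<open>Denominators need not be monic: \<open>v1 \<cdot> k\<close> and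
    \<open>n \<cdot> e\<close> are only known to agree after \<open>t1\<close>, so one more
    refinement \<open>h\<close> is required.\<close>
  have "t1 \<in> Mor C (Dom C t1) (Cod C t1)" "t1 \<in> den" "v1 \<cdot> k \<in> Mor C E (Dom C t1)"
    "n \<cdot> e \<in> Mor C E (Dom C t1)" using v e(1,3) n tg' by simp_all
  from den_cancel[OF this *] obtain H h where h: "h \<in> Mor C H E" "h \<in> den"
    "(v1 \<cdot> k) \<cdot> h = (n \<cdot> e) \<cdot> h" .
  have vkh: "v1 \<cdot> (k \<cdot> h) = n \<cdot> (e \<cdot> h)" using h v(3) n e(1,3) by simp
  have "g \<cdot> (m \<cdot> (e \<cdot> h)) = g \<cdot> (v \<cdot> (k \<cdot> h))"
    using e(1,3) h(1) m v(1) tg' by (simp add: Cmp_ext[OF e(4)])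
  also have "\<dots> = g1 \<cdot> (n \<cdot> (e \<cdot> h))"
    using e(1,3) h(1) v(1,3) tg' by (simp add: Cmp_ext[OF gv] vkh)
  finally have geh: "g \<cdot> (m \<cdot> (e \<cdot> h)) = g1 \<cdot> (n \<cdot> (e \<cdot> h))" .
  have sp: "s \<cdot> (p \<cdot> (a \<cdot> (d \<cdot> x))) = s1 \<cdot> (p1 \<cdot> (c \<cdot> x))" if x: "x \<in> Ar C" "Cod C x = B" for x
  proof -
    have "s \<cdot> (p \<cdot> (a \<cdot> (d \<cdot> x))) = s \<cdot> (u \<cdot> (b \<cdot> (d \<cdot> x)))"
      using x a(1,3) d(1) p(1) u(1) by (simp add: Cmp_ext[OF a(4)])
    also have "\<dots> = s1 \<cdot> (u1 \<cdot> (b \<cdot> (d \<cdot> x)))"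
      using x a(3) d(1) u(1,3) sf' by (simp add: Cmp_ext[OF su])
    also have "u1 \<cdot> (b \<cdot> (d \<cdot> x)) = p1 \<cdot> (c \<cdot> x)"
      using x a(3) d(1,3) u(3) p1(1) Cmp_ext[OF u1bd, of x] by simp
    finally show ?thesis .
  qed
  show ?thesis
  proof (rule frac_eqI[of _ P "Cod C s" _ "Cod C g" _ P1 _ "a \<cdot> (d \<cdot> (e \<cdot> h))" H "c \<cdot> (e \<cdot> h)"])
    show "(s \<cdot> p) \<cdot> (a \<cdot> (d \<cdot> (e \<cdot> h))) = (s1 \<cdot> p1) \<cdot> (c \<cdot> (e \<cdot> h))"
      using sp[of "e \<cdot> h"] sf' p(1) p1(1) a(1) d(1,3) e(1) h(1) by simp
    show "(g \<cdot> q) \<cdot> (a \<cdot> (d \<cdot> (e \<cdot> h))) = (g1 \<cdot> q1) \<cdot> (c \<cdot> (e \<cdot> h))"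
      using geh tg' p(3) p1(3) a(1) d(1,3) e(1) h(1) by (simp add: m_def n_def)
  qed (use sf' tg' p(1-3) p1(1-3) a(1,2) d(1-3) c e(1,2) h(1,2) in simp_all)
qed

text \<open>The composite is a union over all Ore squares of all representatives. The given square
  makes this family nonempty and \<open>Cmp_well_defined\<close> makes it constant, so any single
  square computes the composite.\<close>

lemma Cmp_frac:
  assumes s: "s \<in> Mor C W X" "s \<in> den" "f \<in> Mor C W Y" and t: "t \<in> Mor C V Y" "t \<in> den" "g \<in> Mor C V Z"
    and p: "p \<in> Mor C P W" "p \<in> den" "q \<in> Mor C P V" "f \<cdot> p = t \<cdot> q"
  shows "frac t g \<odot> frac s f = frac (s \<cdot> p) (g \<cdot> q)"
proof -
  have eq: "frac t g \<odot> frac s f = \<Union>{frac (s' \<cdot> t') (g' \<cdot> f') | s' f1 t1 g' t' f'.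
       (s', f1) \<in> frac s f \<and> (t1, g') \<in> frac t g \<and> t' \<in> den \<and> Cod C t' = Dom C s' \<and>
       f' \<in> Mor C (Dom C t') (Dom C t1) \<and> f1 \<cdot> t' = t1 \<cdot> f'}" (is "_ = \<Union>?S")
    by (rule verdier_quotient_sels(5))
  have "(s, f) \<in> frac s f" "(t, g) \<in> frac t g"
    using s t fraction_rel_refl by (simp_all add: frac_mem_iff)
  moreover have "Cod C p = Dom C s" "q \<in> Mor C (Dom C p) (Dom C t)" using p s t by simp_all
  ultimately have "frac (s \<cdot> p) (g \<cdot> q) \<in> ?S" using p by blast
  moreover have "x = frac (s \<cdot> p) (g \<cdot> q)" if xS: "x \<in> ?S" for x
  proof -
    obtain s' f1 t1 g' t' f' where x: "x = frac (s' \<cdot> t') (g' \<cdot> f')"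
      and m: "(s', f1) \<in> frac s f" "(t1, g') \<in> frac t g" and t': "t' \<in> den" "Cod C t' = Dom C s'"
      "f' \<in> Mor C (Dom C t') (Dom C t1)" "f1 \<cdot> t' = t1 \<cdot> f'" using xS by blast
    have "p \<in> Mor C P (Dom C s)" "q \<in> Mor C P (Dom C t)" "t' \<in> Mor C (Dom C t') (Dom C s')"
      using p s t t' Cod_Ob[of t'] by simp_all
    from Cmp_well_defined[OF m[unfolded frac_mem_iff] this(1) p(2) this(2) p(4) this(3) t'(1) t'(3,4)] x
    show ?thesis by simp
  qed
  ultimately show ?thesis unfolding eq using Union_const[of ?S] by blast
qed

lemma frac_ex:
  assumes s: "s \<in> Mor C W X" "s \<in> den" "f \<in> Mor C W Y" and t: "t \<in> Mor C V Y" "t \<in> den" "g \<in> Mor C V Z"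
  obtains P p q where "p \<in> Mor C P W" "p \<in> den" "q \<in> Mor C P V" "f \<cdot> p = t \<cdot> q"
    "frac t g \<odot> frac s f = frac (s \<cdot> p) (g \<cdot> q)"
proof -
  obtain P p q where p: "p \<in> Mor C P W" "p \<in> den" "q \<in> Mor C P V" "f \<cdot> p = t \<cdot> q"
    using den_Ore[OF t(1,2) s(3)] .
  then show thesis using that[OF p] Cmp_frac[OF s t p] by blast
qed

lemma Id_L: "X \<in> Ob C \<Longrightarrow> Id L X = frac (Id C X) (Id C X)"
  by (simp add: verdier_quotient_sels)

lemma category_L: "category L"
proof
  fix \<alpha> assume "\<alpha> \<in> Ar L"
  then obtain W s f where "s \<in> Mor C W (Dom L \<alpha>)" "f \<in> Mor C W (Cod L \<alpha>)" by (rule Ar_L_E)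
  then show "Dom L \<alpha> \<in> Ob L" "Cod L \<alpha> \<in> Ob L" by simp_all
next
  fix X assume "X \<in> Ob L"
  then have X: "Id C X \<in> Mor C X X" "Id C X \<in> den" by simp_all
  then show "Id L X \<in> Mor L X X" using frac_Mor[OF X X(1)] by (simp add: Id_L)
next
  fix \<alpha> X Y assume "\<alpha> \<in> Mor L X Y"
  then obtain W s f where s: "s \<in> Mor C W X" "s \<in> den" "f \<in> Mor C W Y" and \<alpha>: "\<alpha> = frac s f"
    by (rule Mor_L_E)
  have X: "Id C X \<in> Mor C X X" "Id C X \<in> den" and Y: "Id C Y \<in> Mor C Y Y" "Id C Y \<in> den"
    and W: "Id C W \<in> Mor C W W" "Id C W \<in> den"
    using s by simp_all
  have "frac s f \<odot> frac (Id C X) (Id C X) = frac (Id C X \<cdot> s) (f \<cdot> Id C W)"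
    by (rule Cmp_frac[OF X X(1) s s(1,2) W(1)]) (use s in simp)
  then show "\<alpha> \<odot> Id L X = \<alpha>" using s \<alpha> by (simp add: Id_L)
  have "frac (Id C Y) (Id C Y) \<odot> frac s f = frac (s \<cdot> Id C W) (Id C Y \<cdot> f)"
    by (rule Cmp_frac[OF s Y Y(1) W s(3)]) (use s in simp)
  then show "Id L Y \<odot> \<alpha> = \<alpha>" using s \<alpha> by (simp add: Id_L)
next
  fix \<alpha> \<beta> X Y Z assume "\<alpha> \<in> Mor L X Y" "\<beta> \<in> Mor L Y Z"
  then obtain W s f V t g where s: "s \<in> Mor C W X" "s \<in> den" "f \<in> Mor C W Y" and \<alpha>: "\<alpha> = frac s f"
    and t: "t \<in> Mor C V Y" "t \<in> den" "g \<in> Mor C V Z" and \<beta>: "\<beta> = frac t g"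
    by (metis Mor_L_E)
  obtain P p q where p: "p \<in> Mor C P W" "p \<in> den" "q \<in> Mor C P V"
    "frac t g \<odot> frac s f = frac (s \<cdot> p) (g \<cdot> q)"
    using frac_ex[OF s t] by metis
  have "s \<cdot> p \<in> Mor C P X" "s \<cdot> p \<in> den" "g \<cdot> q \<in> Mor C P Z" using s t p(1-3) by simp_all
  from frac_Mor[OF this] show "\<beta> \<odot> \<alpha> \<in> Mor L X Z" using p(4) \<alpha> \<beta> by simp
next
  fix \<alpha> \<beta> \<gamma> X Y Z A assume "\<alpha> \<in> Mor L X Y" "\<beta> \<in> Mor L Y Z" "\<gamma> \<in> Mor L Z A"
  then obtain W s f V t g U r h where s: "s \<in> Mor C W X" "s \<in> den" "f \<in> Mor C W Y" and \<alpha>: "\<alpha> = frac s f"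
    and t: "t \<in> Mor C V Y" "t \<in> den" "g \<in> Mor C V Z" and \<beta>: "\<beta> = frac t g"
    and r: "r \<in> Mor C U Z" "r \<in> den" "h \<in> Mor C U A" and \<gamma>: "\<gamma> = frac r h"
    by (metis Mor_L_E)
  obtain P p q where p: "p \<in> Mor C P W" "p \<in> den" "q \<in> Mor C P V" "f \<cdot> p = t \<cdot> q"
    "frac t g \<odot> frac s f = frac (s \<cdot> p) (g \<cdot> q)"
    using frac_ex[OF s t] .
  obtain R a b where a: "a \<in> Mor C R V" "a \<in> den" "b \<in> Mor C R U" "g \<cdot> a = r \<cdot> b"
    "frac r h \<odot> frac t g = frac (t \<cdot> a) (h \<cdot> b)"
    using frac_ex[OF t r] .
  \<comment> \<open>An Ore square stacked on the two already chosen gives one apex that computes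
    both bracketings.\<close>
  obtain B x y where x: "x \<in> Mor C B P" "x \<in> den" "y \<in> Mor C B R" "q \<cdot> x = a \<cdot> y"
    using den_Ore[OF a(1,2) p(3)] .
  have 1: "frac r h \<odot> frac (s \<cdot> p) (g \<cdot> q) = frac ((s \<cdot> p) \<cdot> x) (h \<cdot> (b \<cdot> y))"
  proof (rule Cmp_frac[of _ P X _ Z _ U _ A _ B])
    show "(g \<cdot> q) \<cdot> x = r \<cdot> (b \<cdot> y)"
      using t(3) p(3) x a(1,3) r(1) by (simp add: Cmp_ext[OF a(4)])
  qed (use s t r p(1-3) x a(1-3) in simp_all)
  have 2: "frac (t \<cdot> a) (h \<cdot> b) \<odot> frac s f = frac (s \<cdot> (p \<cdot> x)) ((h \<cdot> b) \<cdot> y)"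
  proof (rule Cmp_frac[of _ W X _ Y _ R _ A _ B])
    show "f \<cdot> (p \<cdot> x) = (t \<cdot> a) \<cdot> y"
      using t(1) s(3) p(1,3) x a(1) by (simp add: Cmp_ext[OF p(4)])
  qed (use s t r p(1-3) x a(1-3) in simp_all)
  show "\<gamma> \<odot> (\<beta> \<odot> \<alpha>) = (\<gamma> \<odot> \<beta>) \<odot> \<alpha>"
    unfolding \<alpha> \<beta> \<gamma> p(5) a(5) 1 2 using s(1) p(1) x(1,3) a(3) r(3) by simp
qed

end

sublocale verdier \<subseteq> L: category "verdier_quotient C N"
  by (rule category_L)

context verdier
begin

section \<open>The quotient functor and common denominators\<close>

abbreviation Q :: "'m \<Rightarrow> ('m \<times> 'm) set" where "Q \<equiv> FA (quotient_functor C N)"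

lemma FO_quotient_functor [simp]: "FO (quotient_functor C N) X = X"
  by (simp add: quotient_functor_def)

lemma Q_frac: "f \<in> Mor C X Y \<Longrightarrow> Q f = frac (Id C X) f"
  by (simp add: quotient_functor_def)

lemma Q_functor: "cat_functor C L (quotient_functor C N)"
proof (intro cat_functor.intro cat_functor_axioms.intro category_axioms category_L)
  fix X assume "X \<in> Ob C"
  then show "FO (quotient_functor C N) X \<in> Ob L" "Q (Id C X) = Id L (FO (quotient_functor C N) X)"
    by (simp_all add: quotient_functor_def Id_L)
next
  fix f X Y assume f: "f \<in> Mor C X Y"
  have X: "Id C X \<in> Mor C X X" "Id C X \<in> den" using f by simp_all
  show "Q f \<in> Mor L (FO (quotient_functor C N) X) (FO (quotient_functor C N) Y)"
    using frac_Mor[OF X f] Q_frac[OF f] by simp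
  fix g Z assume g: "g \<in> Mor C Y Z"
  have Y: "Id C Y \<in> Mor C Y Y" "Id C Y \<in> den" using f by simp_all
  have gf: "g \<cdot> f \<in> Mor C X Z" using f g by simp
  have "frac (Id C Y) g \<odot> frac (Id C X) f = frac (Id C X \<cdot> Id C X) (g \<cdot> f)"
    by (rule Cmp_frac[OF X f Y g X f]) (use f in simp)
  then show "Q (g \<cdot> f) = Q g \<odot> Q f" using X Q_frac[OF f] Q_frac[OF g] Q_frac[OF gf] by simp
qed

end

sublocale verdier \<subseteq> Q: cat_functor C "verdier_quotient C N" "quotient_functor C N"
  by (rule Q_functor)

context verdier
begin

lemma Q_iso: "s \<in> den \<Longrightarrow> is_isomorphism L (Q s)"
proof -
  assume s: "s \<in> den"
  define W X where "W = Dom C s" and "X = Cod C s"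
  have m: "s \<in> Mor C W X" using s by (simp add: W_def X_def)
  have X: "Id C X \<in> Mor C X X" "Id C X \<in> den" and W: "Id C W \<in> Mor C W W" "Id C W \<in> den"
    using m by simp_all
  have 1: "frac s (Id C W) \<odot> frac (Id C W) s = frac (Id C W \<cdot> Id C W) (Id C W \<cdot> Id C W)"
    by (rule Cmp_frac[OF W m m s W(1) W W(1)]) simp
  have 2: "frac (Id C W) s \<odot> frac s (Id C W) = frac (s \<cdot> Id C W) (s \<cdot> Id C W)"
    by (rule Cmp_frac[OF m s W(1) W m W W(1)]) simp
  have 3: "frac s s = frac (Id C X) (Id C X)"
    by (rule frac_eqI[OF m s m X X(1) W(1) m]) (use m s in simp_all)
  show "is_isomorphism L (Q s)"
    by (rule L.is_isomorphismI[of _ W X "frac s (Id C W)"])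
      (use 1 2 3 m W frac_Mor[OF W m] frac_Mor[OF m s W(1)] Q_frac[OF m] in \<open>simp_all add: Id_L\<close>)
qed

text \<open>Composing with \<open>Q s\<close> clears the denominator. As \<open>Q s\<close> is
  invertible, the equation determines the fraction; many identities below are verified after such a
  composition, which is then cancelled.\<close>

lemma frac_Q:
  assumes s: "s \<in> Mor C W X" "s \<in> den" "f \<in> Mor C W Y"
  shows "frac s f \<odot> Q s = Q f"
proof -
  have W: "Id C W \<in> Mor C W W" "Id C W \<in> den" using s by simp_all
  have "frac s f \<odot> frac (Id C W) s = frac (Id C W \<cdot> Id C W) (f \<cdot> Id C W)"
    by (rule Cmp_frac[OF W s(1) s W W(1)]) (use s in simp)
  then show ?thesis using Q_frac[OF s(1)] Q_frac[OF s(3)] W s by simp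
qed

lemma Q_E:
  assumes "\<alpha> \<in> Mor L X Y"
  obtains W s f where "s \<in> Mor C W X" "s \<in> den" "f \<in> Mor C W Y" "\<alpha> = frac s f"
    "\<alpha> \<odot> Q s = Q f"
  using Mor_L_E[OF assms] frac_Q by metis

text \<open>When both denominators are the identity, the two comparison legs coincide and become a
  single equalising denominator.\<close>

lemma Q_eq_iff:
  assumes f: "f \<in> Mor C X Y" and g: "g \<in> Mor C X Y"
  shows "Q f = Q g \<longleftrightarrow> (\<exists>V q. q \<in> Mor C V X \<and> q \<in> den \<and> f \<cdot> q = g \<cdot> q)"
proof
  assume "Q f = Q g"
  then have "frac (Id C X) f = frac (Id C X) g" using Q_frac[OF f] Q_frac[OF g] by simp
  then obtain V u u' where u: "u \<in> Mor C V (Dom C (Id C X))" "u \<in> den"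
    "u' \<in> Mor C V (Dom C (Id C X))" "Id C X \<cdot> u = Id C X \<cdot> u'" "f \<cdot> u = g \<cdot> u'"
    by (rule frac_eqE) (use f g in simp_all)
  then have "u \<in> Mor C V X" "u = u'" using f by simp_all
  with u show "\<exists>V q. q \<in> Mor C V X \<and> q \<in> den \<and> f \<cdot> q = g \<cdot> q" by blast
next
  assume "\<exists>V q. q \<in> Mor C V X \<and> q \<in> den \<and> f \<cdot> q = g \<cdot> q"
  then obtain V q where q: "q \<in> Mor C V X" "q \<in> den" "f \<cdot> q = g \<cdot> q" by blast
  have "Q f \<odot> Q q = Q g \<odot> Q q" using f g q by (simp flip: Q.FA_Cmp_simp)
  then show "Q f = Q g"
    by (rule L.iso_cancel_right[OF Q_iso[OF q(2)], rotated -1]) (use f g q in simp_all)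
qed

text \<open>Classes are added through representatives with the same denominator, so additive laws
  need one. The Ore square of the two denominators provides it, and its second leg is a denominator
  by two-of-three.\<close>

lemma frac_common:
  assumes "\<alpha> \<in> Mor L X Y" "\<beta> \<in> Mor L X Z"
  obtains W s f g where "s \<in> Mor C W X" "s \<in> den" "f \<in> Mor C W Y" "g \<in> Mor C W Z"
    "\<alpha> = frac s f" "\<beta> = frac s g"
proof -
  obtain W s f where s: "s \<in> Mor C W X" "s \<in> den" "f \<in> Mor C W Y" "\<alpha> = frac s f"
    using Mor_L_E[OF assms(1)] .
  obtain V t g where t: "t \<in> Mor C V X" "t \<in> den" "g \<in> Mor C V Z" "\<beta> = frac t g"
    using Mor_L_E[OF assms(2)] .
  obtain P p q where p: "p \<in> Mor C P W" "p \<in> den" "q \<in> Mor C P V" "s \<cdot> p = t \<cdot> q"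
    using den_Ore[OF t(1,2) s(1)] .
  have sp: "s \<cdot> p \<in> Mor C P X" "s \<cdot> p \<in> den" "f \<cdot> p \<in> Mor C P Y" "g \<cdot> q \<in> Mor C P Z"
    using s(1-3) t(1,3) p(1-3) by simp_all
  have q: "q \<in> den" using den_two_of_three(2)[OF p(3) t(1)] sp(2) t(2) p(4) by simp
  have "\<alpha> = frac (s \<cdot> p) (f \<cdot> p)" using frac_refine[OF s(1-3) p(1,2)] s(4) by simp
  moreover have "\<beta> = frac (s \<cdot> p) (g \<cdot> q)" using frac_refine[OF t(1-3) p(3) q] t(4) p(4) by simp
  ultimately show thesis using that sp by blast
qed

text \<open>The content is independence of representatives: the refinements that identify
  \<open>f\<close> with \<open>f'\<close> and \<open>g\<close> with \<open>g'\<close> are unrelated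
  and have to be merged into one.\<close>

lemma Add_frac:
  assumes s: "s \<in> Mor C W X" "s \<in> den" and f: "f \<in> Mor C W Y" and g: "g \<in> Mor C W Y"
  shows "Add L (frac s f) (frac s g) = frac s (Add C f g)"
proof -
  have eq: "Add L (frac s f) (frac s g) = \<Union>{frac s' (Add C f' g') | s' f' g'.
    (s', f') \<in> frac s f \<and> (s', g') \<in> frac s g}" (is "_ = \<Union>?S")
    by (rule verdier_quotient_sels(6))
  have "(s, f) \<in> frac s f" "(s, g) \<in> frac s g"
    using s f g fraction_rel_refl by (simp_all add: frac_mem_iff)
  then have "frac s (Add C f g) \<in> ?S" by blast
  moreover have "x = frac s (Add C f g)" if xS: "x \<in> ?S" for x
  proof -
    obtain s' f' g' where x: "x = frac s' (Add C f' g')"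
      and sf: "((s, f), (s', f')) \<in> fraction_rel C N" and sg: "((s, g), (s', g')) \<in> fraction_rel C N"
      using xS unfolding frac_mem_iff by blast
    obtain U u u' where u: "u \<in> Mor C U (Dom C s)" "u \<in> den" "u' \<in> Mor C U (Dom C s')" "u' \<in> den"
      and su: "s \<cdot> u = s' \<cdot> u'" and fu: "f \<cdot> u = f' \<cdot> u'"
      and sf': "(s', f') \<in> fractions C N" "Cod C s' = Cod C s" "Cod C f' = Cod C f"
      using fraction_relE[OF sf] by metis
    obtain V v v' where v: "v \<in> Mor C V (Dom C s)" "v \<in> den" "v' \<in> Mor C V (Dom C s')" "v' \<in> den"
      and sv: "s \<cdot> v = s' \<cdot> v'" and gv: "g \<cdot> v = g' \<cdot> v'"
      and sg': "(s', g') \<in> fractions C N" "Cod C s' = Cod C s" "Cod C g' = Cod C g"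
      using fraction_relE[OF sg] by metis
    obtain P a b where a: "a \<in> Mor C P V" "a \<in> den" "b \<in> Mor C P U" "v \<cdot> a = u \<cdot> b"
      using den_Ore[OF u(1,2) v(1)] .
    have "s' \<cdot> (u' \<cdot> b) = s \<cdot> (u \<cdot> b)" using s sf' u(1,3) a(3) by (simp add: Cmp_ext[OF su])
    also have "\<dots> = s' \<cdot> (v' \<cdot> a)" using s sf' v(1,3) a(1) by (simp add: Cmp_ext[OF sv] flip: a(4))
    finally have "s' \<cdot> (u' \<cdot> b) = s' \<cdot> (v' \<cdot> a)" .
    moreover have "s' \<in> Mor C (Dom C s') X" "s' \<in> den" "u' \<cdot> b \<in> Mor C P (Dom C s')"
      "v' \<cdot> a \<in> Mor C P (Dom C s')" using s sf' u(3) v(3) a(1,3) by simp_all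
    \<comment> \<open>\<open>u' \<cdot> b\<close> and \<open>v' \<cdot> a\<close> are only known to
      agree after \<open>s'\<close>; restricting to \<open>R\<close> makes them equal.\<close>
    ultimately obtain R r where r: "r \<in> Mor C R P" "r \<in> den" "(u' \<cdot> b) \<cdot> r = (v' \<cdot> a) \<cdot> r"
      using den_cancel by metis
    have b: "b \<in> den" using den_two_of_three(2)[OF a(3) u(1)] a(1,2) u(2) v(1,2) by (simp flip: a(4))
    have r': "u' \<cdot> (b \<cdot> r) = v' \<cdot> (a \<cdot> r)" using r a(1,3) u(3) v(3) by simp
    have m: "u \<cdot> (b \<cdot> r) \<in> Mor C R W" "u' \<cdot> (b \<cdot> r) \<in> Mor C R (Dom C s')"
      using u(1,3) a(3) r(1) s by simp_all
    have 1: "f \<cdot> (u \<cdot> (b \<cdot> r)) = f' \<cdot> (u' \<cdot> (b \<cdot> r))"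
      using f s(1) sf' u(1,3) a(3) r(1) by (simp add: Cmp_ext[OF fu])
    have "g \<cdot> (u \<cdot> (b \<cdot> r)) = g \<cdot> (v \<cdot> (a \<cdot> r))"
      using u(1) v(1) a(1,3) r(1) by (simp add: Cmp_ext[OF a(4)])
    also have "\<dots> = g' \<cdot> (u' \<cdot> (b \<cdot> r))"
      unfolding r' using g s(1) sg' v(1,3) a(1) r(1) by (simp add: Cmp_ext[OF gv])
    finally have 2: "g \<cdot> (u \<cdot> (b \<cdot> r)) = g' \<cdot> (u' \<cdot> (b \<cdot> r))" .
    have "frac s (Add C f g) = frac s' (Add C f' g')"
    proof (rule frac_eqI[of s W X _ Y s' "Dom C s'" _ "u \<cdot> (b \<cdot> r)" R "u' \<cdot> (b \<cdot> r)"])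
      show "s \<cdot> (u \<cdot> (b \<cdot> r)) = s' \<cdot> (u' \<cdot> (b \<cdot> r))"
        using s(1) sf' u(1,3) a(3) r(1) by (simp add: Cmp_ext[OF su])
      show "Add C f g \<cdot> (u \<cdot> (b \<cdot> r)) = Add C f' g' \<cdot> (u' \<cdot> (b \<cdot> r))"
        using f g s sf' sg' m 1 2 by (simp add: Cmp_Add_distrib del: Cmp_assoc_simp)
    qed (use s f g sf' sg' u(1,2) a(3) b r(1,2) m in simp_all)
    then show ?thesis using x by simp
  qed
  ultimately show ?thesis unfolding eq using Union_const[of ?S] by blast
qed

end

context category
begin

lemma iso_lift:
  assumes "is_isomorphism C a" "a \<in> Mor C X Y" "x \<in> Mor C W Y"
  obtains y where "y \<in> Mor C W X" "a \<cdot> y = x"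
proof -
  obtain b where b: "b \<in> Mor C Y X" "a \<cdot> b = Id C Y" using is_isomorphismE[OF assms(1,2)] .
  have "b \<cdot> x \<in> Mor C W X" "a \<cdot> (b \<cdot> x) = x" using assms b by (simp_all add: Cmp_ext[OF b(2)])
  then show thesis by (rule that)
qed

lemma iso_extend:
  assumes "is_isomorphism C a" "a \<in> Mor C X Y" "x \<in> Mor C X Z"
  obtains y where "y \<in> Mor C Y Z" "y \<cdot> a = x"
proof -
  obtain b where b: "b \<in> Mor C Y X" "b \<cdot> a = Id C X" using is_isomorphismE[OF assms(1,2)] .
  have "x \<cdot> b \<in> Mor C Y Z" "(x \<cdot> b) \<cdot> a = x" using assms b by simp_all
  then show thesis by (rule that)
qed

end

context verdier
begin

lemma Q_Add: "f \<in> Mor C X Y \<Longrightarrow> g \<in> Mor C X Y \<Longrightarrow> Q (Add C f g) = Add L (Q f) (Q g)"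
proof -
  assume f: "f \<in> Mor C X Y" and g: "g \<in> Mor C X Y"
  have X: "Id C X \<in> Mor C X X" "Id C X \<in> den" and "Add C f g \<in> Mor C X Y" using f g by simp_all
  then show ?thesis using Add_frac[OF X f g] Q_frac f g by metis
qed

lemma Zero_L:
  assumes "X \<in> Ob C" "Y \<in> Ob C"
  shows "Zero L X Y = Q (Zero C X Y)" "Zero L X Y \<in> Mor L X Y"
proof -
  have m: "Zero C X Y \<in> Mor C X Y" using assms by simp
  show "Zero L X Y = Q (Zero C X Y)" using Q_frac[OF m] by (simp add: verdier_quotient_sels)
  then show "Zero L X Y \<in> Mor L X Y" using m by simp
qed

lemma frac_Zero:
  assumes s: "s \<in> Mor C W X" "s \<in> den" and Y: "Y \<in> Ob C"
  shows "frac s (Zero C W Y) = Zero L X Y"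
proof -
  have X: "Id C X \<in> Mor C X X" "Id C X \<in> den" and W: "Id C W \<in> Mor C W W" using s by simp_all
  have 0: "Zero C W Y \<in> Mor C W Y" "Zero C X Y \<in> Mor C X Y" using s Y by simp_all
  show ?thesis unfolding verdier_quotient_sels(7)
    by (rule frac_eqI[OF s 0(1) X 0(2) W s(1)]) (use s Y in simp_all)
qed

lemma Q_Cmp_frac:
  assumes s: "s \<in> Mor C W X" "s \<in> den" and f: "f \<in> Mor C W Y" and g: "g \<in> Mor C Y Z"
  shows "Q g \<odot> frac s f = frac s (g \<cdot> f)"
proof -
  have m: "g \<cdot> f \<in> Mor C W Z" using f g by simp
  show ?thesis
  proof (rule L.iso_cancel_right[OF Q_iso[OF s(2)]])
    show "(Q g \<odot> frac s f) \<odot> Q s = frac s (g \<cdot> f) \<odot> Q s"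
      using frac_Q[OF s f] frac_Q[OF s m] frac_Mor[OF s f] s f g by simp
  qed (use frac_Mor[OF s f] frac_Mor[OF s m] s f g in simp_all)
qed

text \<open>The first two arrows are \<open>Q f\<close> and \<open>Q g\<close> after the inverse of
  \<open>Q s\<close>. So a common denominator of that inverse and of the third arrow serves all
  three.\<close>

lemma frac_common3:
  assumes "\<alpha> \<in> Mor L X Y" "\<beta> \<in> Mor L X Y" "\<gamma> \<in> Mor L X Y"
  obtains W s f g h where "s \<in> Mor C W X" "s \<in> den" "f \<in> Mor C W Y" "g \<in> Mor C W Y" "h \<in> Mor C W Y"
    "\<alpha> = frac s f" "\<beta> = frac s g" "\<gamma> = frac s h"
proof -
  obtain W s f g where s: "s \<in> Mor C W X" "s \<in> den" and f: "f \<in> Mor C W Y" "\<alpha> = frac s f"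
    and g: "g \<in> Mor C W Y" "\<beta> = frac s g"
    using frac_common[OF assms(1,2)] by metis
  have W: "Id C W \<in> Mor C W W" using s by simp
  obtain P r a h where r: "r \<in> Mor C P X" "r \<in> den" "a \<in> Mor C P W" "h \<in> Mor C P Y"
    "frac s (Id C W) = frac r a" "\<gamma> = frac r h"
    using frac_common[OF frac_Mor[OF s W] assms(3)] .
  have "\<alpha> = frac r (f \<cdot> a)" using Q_Cmp_frac[OF s W f(1)] Q_Cmp_frac[OF r(1-3) f(1)] r(5) f by simp
  moreover have "\<beta> = frac r (g \<cdot> a)" using Q_Cmp_frac[OF s W g(1)] Q_Cmp_frac[OF r(1-3) g(1)] r(5) g by simp
  moreover have "f \<cdot> a \<in> Mor C P Y" "g \<cdot> a \<in> Mor C P Y" using f g r by simp_all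
  ultimately show thesis using that r(1,2,4,6) by blast
qed

lemma comm_group_L:
  assumes "X \<in> Ob C" "Y \<in> Ob C" shows "comm_group (Mor_group L X Y)"
proof (rule comm_groupI)
  note G = Mor_group_def[of L X Y]
  fix \<alpha> \<beta> assume "\<alpha> \<in> carrier (Mor_group L X Y)" "\<beta> \<in> carrier (Mor_group L X Y)"
  then have m: "\<alpha> \<in> Mor L X Y" "\<beta> \<in> Mor L X Y" by (simp_all add: G)
  obtain W s f g where s: "s \<in> Mor C W X" "s \<in> den" and f: "f \<in> Mor C W Y" and g: "g \<in> Mor C W Y"
    and eq: "\<alpha> = frac s f" "\<beta> = frac s g"
    using frac_common[OF m] by metis
  have fg: "Add C f g \<in> Mor C W Y" using f g by simp
  show "\<alpha> \<otimes>\<^bsub>Mor_group L X Y\<^esub> \<beta> \<in> carrier (Mor_group L X Y)"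
    using Add_frac[OF s f g] frac_Mor[OF s fg] eq by (simp add: G)
  show "\<alpha> \<otimes>\<^bsub>Mor_group L X Y\<^esub> \<beta> = \<beta> \<otimes>\<^bsub>Mor_group L X Y\<^esub> \<alpha>"
    using Add_frac[OF s f g] Add_frac[OF s g f] Add_commute[of f g] f g eq by (simp add: G)
next
  note G = Mor_group_def[of L X Y]
  show "\<one>\<^bsub>Mor_group L X Y\<^esub> \<in> carrier (Mor_group L X Y)"
    using Zero_L[OF assms] by (simp add: G)
next
  note G = Mor_group_def[of L X Y]
  fix \<alpha> \<beta> \<gamma> assume "\<alpha> \<in> carrier (Mor_group L X Y)" "\<beta> \<in> carrier (Mor_group L X Y)"
    "\<gamma> \<in> carrier (Mor_group L X Y)"
  then have m: "\<alpha> \<in> Mor L X Y" "\<beta> \<in> Mor L X Y" "\<gamma> \<in> Mor L X Y" by (simp_all add: G)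
  obtain W s f g h where s: "s \<in> Mor C W X" "s \<in> den" and f: "f \<in> Mor C W Y" and g: "g \<in> Mor C W Y"
    and h: "h \<in> Mor C W Y" and eq: "\<alpha> = frac s f" "\<beta> = frac s g" "\<gamma> = frac s h"
    using frac_common3[OF m] by metis
  have fg: "Add C f g \<in> Mor C W Y" and gh: "Add C g h \<in> Mor C W Y" using f g h by simp_all
  show "(\<alpha> \<otimes>\<^bsub>Mor_group L X Y\<^esub> \<beta>) \<otimes>\<^bsub>Mor_group L X Y\<^esub> \<gamma> = \<alpha> \<otimes>\<^bsub>Mor_group L X Y\<^esub> (\<beta> \<otimes>\<^bsub>Mor_group L X Y\<^esub> \<gamma>)"
    using Add_frac[OF s f g] Add_frac[OF s g h] Add_frac[OF s fg h] Add_frac[OF s f gh]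
      Add_assoc[of f g h] f g h eq by (simp add: G)
next
  note G = Mor_group_def[of L X Y]
  fix \<alpha> assume "\<alpha> \<in> carrier (Mor_group L X Y)"
  then have m: "\<alpha> \<in> Mor L X Y" by (simp add: G)
  obtain W s f where s: "s \<in> Mor C W X" "s \<in> den" and f: "f \<in> Mor C W Y" and eq: "\<alpha> = frac s f"
    using Mor_L_E[OF m] .
  have 0: "Zero C W Y \<in> Mor C W Y" and nf: "Neg C f \<in> Mor C W Y" using f by simp_all
  note z = frac_Zero[OF s assms(2)]
  show "\<one>\<^bsub>Mor_group L X Y\<^esub> \<otimes>\<^bsub>Mor_group L X Y\<^esub> \<alpha> = \<alpha>"
    using Add_frac[OF s 0 f] z eq f by (simp add: G)
  show "\<exists>\<beta> \<in> carrier (Mor_group L X Y). \<beta> \<otimes>\<^bsub>Mor_group L X Y\<^esub> \<alpha> = \<one>\<^bsub>Mor_group L X Y\<^esub>"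
    using Add_frac[OF s nf f] z eq f frac_Mor[OF s nf]
    by (intro bexI[of _ "frac s (Neg C f)"]) (simp_all add: G)
qed

lemma Cmp_Add_L_left:
  assumes "\<alpha> \<in> Mor L X Y" "\<beta> \<in> Mor L Y Z" "\<beta>' \<in> Mor L Y Z"
  shows "Add L \<beta> \<beta>' \<odot> \<alpha> = Add L (\<beta> \<odot> \<alpha>) (\<beta>' \<odot> \<alpha>)"
proof -
  obtain W s f where s: "s \<in> Mor C W X" "s \<in> den" "f \<in> Mor C W Y" and \<alpha>: "\<alpha> = frac s f"
    using Mor_L_E[OF assms(1)] .
  obtain V t g g' where t: "t \<in> Mor C V Y" "t \<in> den" and g: "g \<in> Mor C V Z" "g' \<in> Mor C V Z"
    and \<beta>: "\<beta> = frac t g" "\<beta>' = frac t g'"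
    using frac_common[OF assms(2,3)] by metis
  obtain P p q where p: "p \<in> Mor C P W" "p \<in> den" "q \<in> Mor C P V" "f \<cdot> p = t \<cdot> q"
    using den_Ore[OF t s(3)] .
  have gg: "Add C g g' \<in> Mor C V Z" using g by simp
  have sp: "s \<cdot> p \<in> Mor C P X" "s \<cdot> p \<in> den" "g \<cdot> q \<in> Mor C P Z" "g' \<cdot> q \<in> Mor C P Z"
    using s g p(1-3) by simp_all
  have "Add L \<beta> \<beta>' \<odot> \<alpha> = frac (s \<cdot> p) (Add C g g' \<cdot> q)"
    unfolding \<alpha> \<beta> Add_frac[OF t g] by (rule Cmp_frac[OF s t gg p])
  also have "\<dots> = frac (s \<cdot> p) (Add C (g \<cdot> q) (g' \<cdot> q))" using g p by (simp add: Cmp_Add_distrib)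
  also have "\<dots> = Add L (frac (s \<cdot> p) (g \<cdot> q)) (frac (s \<cdot> p) (g' \<cdot> q))"
    by (rule Add_frac[OF sp, symmetric])
  finally show ?thesis
    unfolding \<alpha> \<beta> Cmp_frac[OF s t g(1) p] Cmp_frac[OF s t g(2) p] .
qed

lemma Cmp_Add_L_right:
  assumes "\<alpha> \<in> Mor L X Y" "\<alpha>' \<in> Mor L X Y" "\<beta> \<in> Mor L Y Z"
  shows "\<beta> \<odot> Add L \<alpha> \<alpha>' = Add L (\<beta> \<odot> \<alpha>) (\<beta> \<odot> \<alpha>')"
proof -
  obtain W s f f' where s: "s \<in> Mor C W X" "s \<in> den" and f: "f \<in> Mor C W Y" "f' \<in> Mor C W Y"
    and \<alpha>: "\<alpha> = frac s f" "\<alpha>' = frac s f'"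
    using frac_common[OF assms(1,2)] by metis
  obtain V t g where t: "t \<in> Mor C V Y" "t \<in> den" "g \<in> Mor C V Z" and \<beta>: "\<beta> = frac t g"
    using Mor_L_E[OF assms(3)] .
  obtain P0 p0 q0 where p0: "p0 \<in> Mor C P0 W" "p0 \<in> den" "q0 \<in> Mor C P0 V" "f \<cdot> p0 = t \<cdot> q0"
    using den_Ore[OF t(1,2) f(1)] .
  \<comment> \<open>A single \<open>p\<close> must lift both numerators along \<open>t\<close>, so
    the square for \<open>f'\<close> is built on top of the one for \<open>f\<close>.\<close>
  have "f' \<cdot> p0 \<in> Mor C P0 Y" using f p0(1) by simp
  then obtain P r q' where r: "r \<in> Mor C P P0" "r \<in> den" "q' \<in> Mor C P V" "(f' \<cdot> p0) \<cdot> r = t \<cdot> q'"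
    using den_Ore[OF t(1,2)] by metis
  define p q where "p = p0 \<cdot> r" and "q = q0 \<cdot> r"
  have p: "p \<in> Mor C P W" "p \<in> den" and q: "q \<in> Mor C P V"
    using p0(1-3) r(1,2) by (simp_all add: p_def q_def)
  have fp: "f \<cdot> p = t \<cdot> q" unfolding p_def q_def using f t(1) p0(1,3) r(1) by (simp add: Cmp_ext[OF p0(4)])
  have fp': "f' \<cdot> p = t \<cdot> q'" using r f p0(1) by (simp add: p_def)
  have ff: "Add C f f' \<in> Mor C W Y" "Add C q q' \<in> Mor C P V" using f q r by simp_all
  have ffp: "Add C f f' \<cdot> p = t \<cdot> Add C q q'"
    using f p(1) q r(3) t fp fp' by (simp add: Cmp_Add_distrib)
  have sp: "s \<cdot> p \<in> Mor C P X" "s \<cdot> p \<in> den" "g \<cdot> q \<in> Mor C P Z" "g \<cdot> q' \<in> Mor C P Z"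
    using s t p q r(3) by simp_all
  have "\<beta> \<odot> Add L \<alpha> \<alpha>' = frac (s \<cdot> p) (g \<cdot> Add C q q')"
    unfolding \<alpha> \<beta> Add_frac[OF s f] by (rule Cmp_frac[OF s ff(1) t p ff(2) ffp])
  also have "\<dots> = frac (s \<cdot> p) (Add C (g \<cdot> q) (g \<cdot> q'))" using t q r(3) by (simp add: Cmp_Add_distrib)
  also have "\<dots> = Add L (frac (s \<cdot> p) (g \<cdot> q)) (frac (s \<cdot> p) (g \<cdot> q'))"
    by (rule Add_frac[OF sp, symmetric])
  finally show ?thesis
    unfolding \<alpha> \<beta> Cmp_frac[OF s f(1) t p q fp] Cmp_frac[OF s f(2) t p r(3) fp'] .
qed

lemma zero_object_L:
  assumes z: "zero_object C z" shows "zero_object L z"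
proof -
  have zO: "z \<in> Ob C" using z by (simp add: zero_object_def)
  have "\<alpha> = Zero L X z" if \<alpha>: "\<alpha> \<in> Mor L X z" for \<alpha> X
  proof -
    obtain W s f where s: "s \<in> Mor C W X" "s \<in> den" "f \<in> Mor C W z" "\<alpha> = frac s f"
      using Mor_L_E[OF \<alpha>] .
    then show ?thesis using zero_object_Mor(1)[OF z s(3)] frac_Zero[OF s(1,2) zO] by simp
  qed
  moreover have "\<alpha> = Zero L z X" if \<alpha>: "\<alpha> \<in> Mor L z X" for \<alpha> X
  proof -
    obtain W s f where s: "s \<in> Mor C W z" "s \<in> den" "f \<in> Mor C W X" "\<alpha> = frac s f" "\<alpha> \<odot> Q s = Q f"
      using Q_E[OF \<alpha>] .
    \<comment> \<open>As \<open>z\<close> is a zero object, the zero arrow is a section of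
      \<open>s\<close>. Composing the cleared equation with it expresses \<open>\<alpha>\<close>
      through a zero arrow.\<close>
    have 0: "Zero C z W \<in> Mor C z W" "s \<cdot> Zero C z W = Id C z" "f \<cdot> Zero C z W = Zero C z X"
      using s(1-3) z by (simp_all add: zero_object_iff)
    have "\<alpha> = \<alpha> \<odot> Q (s \<cdot> Zero C z W)" using \<alpha> 0 zO by simp
    also have "\<dots> = Q (f \<cdot> Zero C z W)" using \<alpha> s(1,3) 0(1) by (simp add: L.Cmp_ext[OF s(5)] del: Cmp_Zero_simps)
    finally show ?thesis using Zero_L(1)[OF zO] s(3) 0(3) by simp
  qed
  ultimately show ?thesis
    unfolding zero_object_def using zO Zero_L(2) by (metis Ob_verdier_quotient)
qed

lemma additive_category_L: "additive_category L"
proof (intro additive_category.intro additive_category_axioms.intro category_L)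
  show "\<And>X Y. X \<in> Ob L \<Longrightarrow> Y \<in> Ob L \<Longrightarrow> comm_group (Mor_group L X Y)"
    using comm_group_L by simp
  show "\<exists>Z. zero_object L Z" using ex_zero_object zero_object_L by blast
next
  fix X Y assume "X \<in> Ob L" "Y \<in> Ob L"
  then have XY: "X \<in> Ob C" "Y \<in> Ob C" by simp_all
  obtain Z i j p q where Z: "Z \<in> Ob C" and
    m: "i \<in> Mor C X Z" "j \<in> Mor C Y Z" "p \<in> Mor C Z X" "q \<in> Mor C Z Y"
    and e: "p \<cdot> i = Id C X" "q \<cdot> j = Id C Y" "p \<cdot> j = Zero C Y X" "q \<cdot> i = Zero C X Y"
      "Add C (i \<cdot> p) (j \<cdot> q) = Id C Z"
    using ex_direct_sum[OF XY] unfolding direct_sum_def by blast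
  have ij: "i \<cdot> p \<in> Mor C Z Z" "j \<cdot> q \<in> Mor C Z Z" using m by simp_all
  have "Q p \<odot> Q i = Id L X \<and> Q q \<odot> Q j = Id L Y \<and> Q p \<odot> Q j = Zero L Y X \<and>
    Q q \<odot> Q i = Zero L X Y \<and> Add L (Q i \<odot> Q p) (Q j \<odot> Q q) = Id L Z"
    using m e Q_Add[OF ij] Z XY Q.FA_Id[of Z] Q.FA_Id[of X] Q.FA_Id[of Y]
    by (simp add: Zero_L del: Q.FA_Cmp_simp Q.FA_Id_simp flip: Q.FA_Cmp_simp)
  moreover have "Q i \<in> Mor L X Z" "Q j \<in> Mor L Y Z" "Q p \<in> Mor L Z X" "Q q \<in> Mor L Z Y"
    using m by simp_all
  ultimately have "direct_sum L X Y Z" unfolding direct_sum_def using Z by (metis Ob_verdier_quotient)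
  then show "\<exists>Z. direct_sum L X Y Z" by blast
qed (rule Cmp_Add_L_left Cmp_Add_L_right; assumption)+

end

sublocale verdier \<subseteq> L: additive_category "verdier_quotient C N"
  by (rule additive_category_L)

sublocale verdier \<subseteq> Q: additive_cat_functor C "verdier_quotient C N" "quotient_functor C N"
  by unfold_locales (rule Q_Add)

lemma (in verdier) Q_zeroE:
  assumes f: "f \<in> Mor C X Y" "Q f = Zero L X Y"
  obtains V q where "q \<in> Mor C V X" "q \<in> den" "f \<cdot> q = Zero C V Y"
proof -
  have "Q f = Q (Zero C X Y)" "Zero C X Y \<in> Mor C X Y" using f by simp_all
  then obtain V q where q: "q \<in> Mor C V X" "q \<in> den" "f \<cdot> q = Zero C X Y \<cdot> q"
    using Q_eq_iff[OF f(1)] by blast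
  then have "f \<cdot> q = Zero C V Y" using f(1) by simp
  with q(1,2) show thesis by (rule that)
qed

text \<open>Instantiated with the suspension, which yields the suspension of the quotient, and with
  the inclusion of a full subcategory, which yields the canonical functors.\<close>

locale verdier_functor = C: verdier C N + D: verdier D M + F: additive_cat_functor C D F
  for C :: "('o, 'm) triangulated_data" and N
    and D :: "('p, 'q) triangulated_data" and M and F :: "('o, 'm, 'p, 'q) functor_data" +
  assumes FA_den: "s \<in> denominators C N \<Longrightarrow> FA F s \<in> denominators D M"
begin

abbreviation I where "I \<equiv> induced_functor D M F"

lemma FO_induced [simp]: "FO I X = FO F X"
  by (simp add: induced_functor_def)

text \<open>The induced arrow is a union over the whole class. Applying \<open>F\<close> to a
  comparison of two roofs compares their images, so all members of the union agree.\<close>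

lemma FA_induced:
  assumes s: "s \<in> Mor C W X" "s \<in> C.den" "f \<in> Mor C W Y"
  shows "FA I (C.frac s f) = D.frac (FA F s) (FA F f)"
proof -
  have "(s, f) \<in> C.frac s f" using s C.fraction_rel_refl by (simp add: C.frac_mem_iff)
  moreover have "(case z of (s', f') \<Rightarrow> D.frac (FA F s') (FA F f')) = D.frac (FA F s) (FA F f)"
    if z: "z \<in> C.frac s f" for z
  proof -
    obtain s' f' where z': "z = (s', f')" by (cases z)
    then have "((s, f), (s', f')) \<in> fraction_rel C N" using z by (simp add: C.frac_mem_iff)
    then obtain V u u' where u: "u \<in> Mor C V (Dom C s)" "u \<in> C.den" "u' \<in> Mor C V (Dom C s')"
      "u' \<in> C.den" "s \<cdot>\<^bsub>C\<^esub> u = s' \<cdot>\<^bsub>C\<^esub> u'" "f \<cdot>\<^bsub>C\<^esub> u = f' \<cdot>\<^bsub>C\<^esub> u'"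
      "(s', f') \<in> fractions C N" "Cod C s' = Cod C s" "Cod C f' = Cod C f"
      by (rule C.fraction_relE)
    have e: "FA F s \<cdot>\<^bsub>D\<^esub> FA F u = FA F s' \<cdot>\<^bsub>D\<^esub> FA F u'" "FA F f \<cdot>\<^bsub>D\<^esub> FA F u = FA F f' \<cdot>\<^bsub>D\<^esub> FA F u'"
      using s u by (simp_all flip: F.FA_Cmp_simp)
    have "D.frac (FA F s) (FA F f) = D.frac (FA F s') (FA F f')"
      by (rule D.frac_eqI[of _ "FO F W" "FO F X" _ "FO F Y" _ "FO F (Dom C s')" _
            "FA F u" "FO F V" "FA F u'"])
        (use s u(1-4,7-9) e FA_den[of s] FA_den[of s'] FA_den[of u'] in simp_all)
    then show ?thesis using z' by simp
  qed
  ultimately show ?thesis unfolding induced_functor_def by auto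
qed

lemma FA_induced_Q:
  assumes f: "f \<in> Mor C X Y" shows "FA I (C.Q f) = D.Q (FA F f)"
proof -
  have X: "Id C X \<in> Mor C X X" "Id C X \<in> C.den" using f by simp_all
  have Ff: "FA F f \<in> Mor D (FO F X) (FO F Y)" using f by simp
  show ?thesis using FA_induced[OF X f] C.Q_frac[OF f] D.Q_frac[OF Ff] f by simp
qed

lemma induced_functor: "cat_functor C.L D.L I"
proof (intro cat_functor.intro cat_functor_axioms.intro C.category_L D.category_L)
  fix X assume "X \<in> Ob C.L"
  then have X: "X \<in> Ob C" by simp
  then show "FO I X \<in> Ob D.L" by simp
  have Id: "Id C X \<in> Mor C X X" using X by simp
  show "FA I (Id C.L X) = Id D.L (FO I X)"
    using FA_induced_Q[OF Id] X C.Q.FA_Id[OF X] D.Q.FA_Id[of "FO F X"] by simp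
next
  fix \<alpha> X Y assume \<alpha>: "\<alpha> \<in> Mor C.L X Y"
  obtain W s f where s: "s \<in> Mor C W X" "s \<in> C.den" "f \<in> Mor C W Y" "\<alpha> = C.frac s f"
    using C.Mor_L_E[OF \<alpha>] .
  have Fs: "FA F s \<in> Mor D (FO F W) (FO F X)" "FA F s \<in> D.den" "FA F f \<in> Mor D (FO F W) (FO F Y)"
    using s FA_den by simp_all
  show "FA I \<alpha> \<in> Mor D.L (FO I X) (FO I Y)"
    using FA_induced[OF s(1-3)] D.frac_Mor[OF Fs] s(4) by simp
  fix \<beta> Z assume \<beta>: "\<beta> \<in> Mor C.L Y Z"
  obtain V t g where t: "t \<in> Mor C V Y" "t \<in> C.den" "g \<in> Mor C V Z" "\<beta> = C.frac t g"
    using C.Mor_L_E[OF \<beta>] .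
  have Ft: "FA F t \<in> Mor D (FO F V) (FO F Y)" "FA F t \<in> D.den" "FA F g \<in> Mor D (FO F V) (FO F Z)"
    using t FA_den by simp_all
  obtain P p q where p: "p \<in> Mor C P W" "p \<in> C.den" "q \<in> Mor C P V" "f \<cdot>\<^bsub>C\<^esub> p = t \<cdot>\<^bsub>C\<^esub> q"
    "C.frac t g \<cdot>\<^bsub>C.L\<^esub> C.frac s f = C.frac (s \<cdot>\<^bsub>C\<^esub> p) (g \<cdot>\<^bsub>C\<^esub> q)"
    using C.frac_ex[OF s(1-3) t(1-3)] .
  have sp: "s \<cdot>\<^bsub>C\<^esub> p \<in> Mor C P X" "s \<cdot>\<^bsub>C\<^esub> p \<in> C.den" "g \<cdot>\<^bsub>C\<^esub> q \<in> Mor C P Z"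
    using s t p(1-3) by simp_all
  have Fp: "FA F p \<in> Mor D (FO F P) (FO F W)" "FA F p \<in> D.den" "FA F q \<in> Mor D (FO F P) (FO F V)"
    using p FA_den by simp_all
  have e: "FA F f \<cdot>\<^bsub>D\<^esub> FA F p = FA F t \<cdot>\<^bsub>D\<^esub> FA F q"
    using s t p by (simp flip: F.FA_Cmp_simp)
  show "FA I (\<beta> \<cdot>\<^bsub>C.L\<^esub> \<alpha>) = FA I \<beta> \<cdot>\<^bsub>D.L\<^esub> FA I \<alpha>"
    unfolding s(4) t(4) p(5) FA_induced[OF sp] FA_induced[OF s(1-3)] FA_induced[OF t(1-3)]
      D.Cmp_frac[OF Fs Ft Fp e]
    using s t p(1-3) by simp
qed

lemma induced_additive: "additive_cat_functor C.L D.L I"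
proof (intro additive_cat_functor.intro additive_cat_functor_axioms.intro induced_functor
    C.additive_category_L D.additive_category_L)
  fix \<alpha> \<beta> X Y assume m: "\<alpha> \<in> Mor C.L X Y" "\<beta> \<in> Mor C.L X Y"
  obtain W s f g where s: "s \<in> Mor C W X" "s \<in> C.den" and f: "f \<in> Mor C W Y" and g: "g \<in> Mor C W Y"
    and eq: "\<alpha> = C.frac s f" "\<beta> = C.frac s g"
    using C.frac_common[OF m] by metis
  have fg: "Add C f g \<in> Mor C W Y" using f g by simp
  have F: "FA F s \<in> Mor D (FO F W) (FO F X)" "FA F s \<in> D.den" "FA F f \<in> Mor D (FO F W) (FO F Y)"
    "FA F g \<in> Mor D (FO F W) (FO F Y)"
    using s f g FA_den by simp_all
  show "FA I (Add C.L \<alpha> \<beta>) = Add D.L (FA I \<alpha>) (FA I \<beta>)"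
    unfolding eq C.Add_frac[OF s f g] FA_induced[OF s fg] FA_induced[OF s f] FA_induced[OF s g]
      D.Add_frac[OF F]
    using f g by simp
qed

end

section \<open>Exact triangles in the Verdier quotient\<close>

context verdier
begin

section \<open>The suspension of the quotient\<close>

lemma sus_verdier_functor: "verdier_functor C N C N (Sus C)"
proof (intro verdier_functor.intro verdier_functor_axioms.intro)
  show "verdier C N" by unfold_locales
  then show "verdier C N" .
  show "additive_cat_functor C C (Sus C)" by unfold_locales
  show "susA s \<in> den" if "s \<in> den" for s using that den_sus[of s] by simp
qed

lemmas FO_Sus_L = verdier_functor.FO_induced[OF sus_verdier_functor, folded verdier_quotient_sels(8)]
lemmas Sus_frac = verdier_functor.FA_induced[OF sus_verdier_functor, folded verdier_quotient_sels(8)]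
lemmas Sus_Q = verdier_functor.FA_induced_Q[OF sus_verdier_functor, folded verdier_quotient_sels(8)]
lemmas Sus_L_additive = verdier_functor.induced_additive[OF sus_verdier_functor, folded verdier_quotient_sels(8)]

declare FO_Sus_L [simp]

lemma Sus_Q_simp [simp]: "f \<in> Ar C \<Longrightarrow> FA (Sus L) (Q f) = Q (susA f)"
  by (rule Sus_Q[of f "Dom C f" "Cod C f"]) simp

end

sublocale verdier \<subseteq> SL: additive_cat_functor "verdier_quotient C N" "verdier_quotient C N" "Sus (verdier_quotient C N)"
  by (rule Sus_L_additive)

context verdier
begin

lemma Dom_Cod_L [simp]: "\<alpha> \<in> Ar L \<Longrightarrow> Dom L \<alpha> \<in> Ob C" "\<alpha> \<in> Ar L \<Longrightarrow> Cod L \<alpha> \<in> Ob C"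
  using L.Dom_Ob[of \<alpha>] L.Cod_Ob[of \<alpha>] by simp_all

text \<open>Every apex is isomorphic to a suspension, and after this replacement both legs of a roof
  between suspensions can be desuspended; this is fullness. For faithfulness the kernel criterion
  applies, and the denominator that kills a suspended numerator is desuspended in the same
  way.\<close>

lemma Sus_L_fully_faithful: "fully_faithful_functor L L (Sus L)"
proof (intro fully_faithful_functor.intro fully_faithful_functor_axioms.intro SL.cat_functor_axioms)
  fix X Y \<eta> assume "X \<in> Ob L" "Y \<in> Ob L" and \<eta>: "\<eta> \<in> Mor L (FO (Sus L) X) (FO (Sus L) Y)"
  then have XY: "X \<in> Ob C" "Y \<in> Ob C" by simp_all
  have \<eta>: "\<eta> \<in> Mor L (susO X) (susO Y)" using \<eta> by simp
  obtain W s f where s: "s \<in> Mor C W (susO X)" "s \<in> den" "f \<in> Mor C W (susO Y)" "\<eta> = frac s f"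
    using Mor_L_E[OF \<eta>] .
  have "W \<in> Ob C" using s by simp
  then obtain W' e where e: "W' \<in> Ob C" "e \<in> Mor C (susO W') W" "is_isomorphism C e" by (rule sus_essE)
  have "s \<cdot> e \<in> Mor C (susO W') (susO X)" "f \<cdot> e \<in> Mor C (susO W') (susO Y)" using s e by simp_all
  then obtain s' f' where s': "s' \<in> Mor C W' X" "s \<cdot> e = susA s'"
    and f': "f' \<in> Mor C W' Y" "f \<cdot> e = susA f'"
    using sus.fullE[OF e(1)] XY by metis
  have "s \<cdot> e \<in> den" using s(1,2) e(2) den_iso[OF e(3)] by simp
  then have d: "s' \<in> den" using s' den_sus[of s'] by simp
  have "FA (Sus L) (frac s' f') = frac (s \<cdot> e) (f \<cdot> e)"
    unfolding Sus_frac[OF s'(1) d f'(1)] s'(2) f'(2) ..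
  also have "\<dots> = \<eta>" using frac_refine[OF s(1-3) e(2) den_iso[OF e(3)]] s(4) by simp
  finally show "\<exists>\<alpha> \<in> Mor L X Y. FA (Sus L) \<alpha> = \<eta>" using frac_Mor[OF s'(1) d f'(1)] by blast
next
  fix \<alpha> \<beta> X Y assume m: "\<alpha> \<in> Mor L X Y" "\<beta> \<in> Mor L X Y" "FA (Sus L) \<alpha> = FA (Sus L) \<beta>"
  show "\<alpha> = \<beta>"
  proof (rule SL.faithfulI[OF _ m])
    fix X Y \<alpha> assume \<alpha>: "\<alpha> \<in> Mor L X Y" and 0: "FA (Sus L) \<alpha> = Zero L (FO (Sus L) X) (FO (Sus L) Y)"
    obtain W s f where s: "s \<in> Mor C W X" "s \<in> den" "f \<in> Mor C W Y" "\<alpha> \<odot> Q s = Q f"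
      using Q_E[OF \<alpha>] by metis
    have "Q (susA f) = FA (Sus L) (\<alpha> \<odot> Q s)" using s by simp
    also have "\<dots> = Zero L (susO W) (susO Y)" using \<alpha> s(1,3) 0 by simp
    finally have "susA f \<in> Mor C (susO W) (susO Y)" "Q (susA f) = Zero L (susO W) (susO Y)"
      using s by simp_all
    then obtain V q where q: "q \<in> Mor C V (susO W)" "q \<in> den" "susA f \<cdot> q = Zero C V (susO Y)"
      by (rule Q_zeroE)
    have "V \<in> Ob C" using q by simp
    then obtain V' e where e: "V' \<in> Ob C" "e \<in> Mor C (susO V') V" "is_isomorphism C e" by (rule sus_essE)
    have "q \<cdot> e \<in> Mor C (susO V') (susO W)" using q e by simp
    then obtain q' where q': "q' \<in> Mor C V' W" "q \<cdot> e = susA q'" using sus.fullE[OF e(1)] s(1) by (metis Mor_iff)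
    have "q \<cdot> e \<in> den" using q(1,2) e(2) den_iso[OF e(3)] by simp
    then have d: "q' \<in> den" using q' den_sus[of q'] by simp
    have "susA (f \<cdot> q') = susA f \<cdot> (q \<cdot> e)" using s q' by simp
    also have "\<dots> = Zero C (susO V') (susO Y)" using s(3) q(1) e(2) by (simp add: Cmp_ext[OF q(3)])
    finally have "f \<cdot> q' = Zero C V' Y"
      by (intro sus.faithful[of "f \<cdot> q'" V' Y]) (use s q' in simp_all)
    then have "Q f = Q (Zero C W Y)" using Q_eq_iff[OF s(3), of "Zero C W Y"] q' d s by auto
    then have *: "\<alpha> \<odot> Q s = Zero L X Y \<odot> Q s" using s \<alpha> by simp
    show "\<alpha> = Zero L X Y"
      by (rule L.iso_cancel_right[OF Q_iso[OF s(2)] _ _ _ _ *]) (use \<alpha> s in simp_all)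
  qed
qed

lemma Sus_L_equivalence: "equivalence_functor L L (Sus L)"
proof (rule fully_faithful_functor.equivalence_functorI[OF Sus_L_fully_faithful])
  fix Y assume "Y \<in> Ob L"
  then have "Y \<in> Ob C" by simp
  then obtain X e where e: "X \<in> Ob C" "e \<in> Mor C (susO X) Y" "is_isomorphism C e" by (rule sus_essE)
  show "\<exists>X \<in> Ob L. isomorphic L (FO (Sus L) X) Y"
    using Q.isomorphic_FO[OF isomorphicI[OF e(2,3)]] e(1) by (intro bexI[of _ X]) simp_all
qed

text \<open>The triangles of the quotient are defined before \<open>Tri\<close> is added to the
  record, hence through isomorphism in \<open>localization\<close>. Isomorphism of triangles never
  consults \<open>Tri\<close>, so it may be read in the quotient itself.\<close>

lemma isomorphic_triangles_localization:
  "isomorphic_triangles (localization C N) = isomorphic_triangles L"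
proof -
  have loc: "Ar (localization C N) = Ar L" "Dom (localization C N) = Dom L" "Cod (localization C N) = Cod L"
    "Id (localization C N) = Id L" "Cmp (localization C N) = Cmp L" "Sus (localization C N) = Sus L"
    by (simp_all add: verdier_quotient_def suspended_data.defs triangulated_data.defs localization_def)
  show ?thesis
    by (intro ext) (simp only: isomorphic_triangles_def candidate_triangle_def triangle_morphism_def
        is_isomorphism_def Mor_def loc)
qed

lemma Tri_L: "Tri L = {t. \<exists>(f, g, h) \<in> Tri C. isomorphic_triangles L (Q f, Q g, Q h) t}"
  unfolding isomorphic_triangles_localization[symmetric]
  by (simp add: verdier_quotient_def suspended_data.defs triangulated_data.defs)

lemma triangle_L_I:
  assumes T: "triangle C X Y Z f g h"
    and m: "\<phi> \<in> Mor L X' Y'" "\<gamma> \<in> Mor L Y' Z'" "\<psi> \<in> Mor L Z' (susO X')"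
    and a: "a \<in> Mor L X X'" "is_isomorphism L a" and b: "b \<in> Mor L Y Y'" "is_isomorphism L b"
    and c: "c \<in> Mor L Z Z'" "is_isomorphism L c"
    and e: "b \<odot> Q f = \<phi> \<odot> a" "c \<odot> Q g = \<gamma> \<odot> b" "FA (Sus L) a \<odot> Q h = \<psi> \<odot> c"
  shows "triangle L X' Y' Z' \<phi> \<gamma> \<psi>"
proof -
  note t = triangle_Mor[OF T]
  have "triangle_morphism L (Q f, Q g, Q h) (\<phi>, \<gamma>, \<psi>) a b c"
    using m a b c e t(1-3) by (simp add: triangle_morphism_def)
  moreover have "candidate_triangle L (Q f, Q g, Q h)" "candidate_triangle L (\<phi>, \<gamma>, \<psi>)"
    unfolding candidate_triangle_def using m t(1-3) by simp_all
  ultimately have "isomorphic_triangles L (Q f, Q g, Q h) (\<phi>, \<gamma>, \<psi>)"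
    unfolding isomorphic_triangles_def using a b c by blast
  then show ?thesis using t(4) m unfolding triangle_def Tri_L by auto
qed

lemma triangle_L_E:
  assumes "(\<phi>, \<gamma>, \<psi>) \<in> Tri L"
  obtains X Y Z f g h a b c where "triangle C X Y Z f g h"
    "\<phi> \<in> Mor L (Dom L \<phi>) (Cod L \<phi>)" "\<gamma> \<in> Mor L (Cod L \<phi>) (Cod L \<gamma>)"
    "\<psi> \<in> Mor L (Cod L \<gamma>) (susO (Dom L \<phi>))"
    "a \<in> Mor L X (Dom L \<phi>)" "is_isomorphism L a" "b \<in> Mor L Y (Cod L \<phi>)" "is_isomorphism L b"
    "c \<in> Mor L Z (Cod L \<gamma>)" "is_isomorphism L c"
    "b \<odot> Q f = \<phi> \<odot> a" "c \<odot> Q g = \<gamma> \<odot> b" "FA (Sus L) a \<odot> Q h = \<psi> \<odot> c"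
proof -
  obtain f g h where T: "(f, g, h) \<in> Tri C" and iso: "isomorphic_triangles L (Q f, Q g, Q h) (\<phi>, \<gamma>, \<psi>)"
    using assms unfolding Tri_L by blast
  note T' = triangleI[OF T]
  note t = triangle_Mor[OF T']
  obtain a b c where tm: "triangle_morphism L (Q f, Q g, Q h) (\<phi>, \<gamma>, \<psi>) a b c"
    and i: "is_isomorphism L a" "is_isomorphism L b" "is_isomorphism L c"
    and c: "candidate_triangle L (\<phi>, \<gamma>, \<psi>)"
    using iso unfolding isomorphic_triangles_def by blast
  have m: "\<phi> \<in> Mor L (Dom L \<phi>) (Cod L \<phi>)" "\<gamma> \<in> Mor L (Cod L \<phi>) (Cod L \<gamma>)"
    "\<psi> \<in> Mor L (Cod L \<gamma>) (susO (Dom L \<phi>))"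
    using c by (simp_all add: candidate_triangle_def)
  have abc: "a \<in> Mor L (Dom C f) (Dom L \<phi>)" "b \<in> Mor L (Cod C f) (Cod L \<phi>)" "c \<in> Mor L (Cod C g) (Cod L \<gamma>)"
    "b \<odot> Q f = \<phi> \<odot> a" "c \<odot> Q g = \<gamma> \<odot> b" "FA (Sus L) a \<odot> Q h = \<psi> \<odot> c"
    using tm t(1-3) unfolding triangle_morphism_def by (simp_all del: L.Mor_iff)
  show thesis
    by (rule that[OF T' m abc(1) i(1) abc(2) i(2) abc(3) i(3) abc(4-6)])
qed

lemma Q_triangle: "triangle C X Y Z f g h \<Longrightarrow> triangle L X Y Z (Q f) (Q g) (Q h)"
  using triangle_Mor[of C X Y Z f g h]
  by (intro triangle_L_I[of X Y Z f g h _ X Y _ Z _ "Id L X" "Id L Y" "Id L Z"]) simp_all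

text \<open>Clearing denominators presents \<open>(\<alpha>, \<beta>)\<close> by two commuting
  squares in \<open>C\<close> that start at one arrow \<open>k2\<close>: one ends at
  \<open>f\<close> and has denominators as sides, the other ends at \<open>f'\<close>. Both extend
  to the cone of \<open>k2\<close>, the first by a denominator, which can be inverted.\<close>

lemma triangle_L_map_Q:
  assumes T: "triangle C X Y Z f g h" and T': "triangle C X' Y' Z' f' g' h'"
    and \<alpha>: "\<alpha> \<in> Mor L X X'" and \<beta>: "\<beta> \<in> Mor L Y Y'" and eq: "\<beta> \<odot> Q f = Q f' \<odot> \<alpha>"
  obtains \<gamma> where "\<gamma> \<in> Mor L Z Z'" "\<gamma> \<odot> Q g = Q g' \<odot> \<beta>" "FA (Sus L) \<alpha> \<odot> Q h = Q h' \<odot> \<gamma>"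
proof -
  note t = triangle_Mor(1-3)[OF T] triangle_Mor(1-3)[OF T']
  obtain W s a where s: "s \<in> Mor C W X" "s \<in> den" and a: "a \<in> Mor C W X'" and \<alpha>s: "\<alpha> \<odot> Q s = Q a"
    using Q_E[OF \<alpha>] by metis
  obtain V t b where t': "t \<in> Mor C V Y" "t \<in> den" and b: "b \<in> Mor C V Y'" and \<beta>t: "\<beta> \<odot> Q t = Q b"
    using Q_E[OF \<beta>] by metis
  have "f \<cdot> s \<in> Mor C W Y" using t s by simp
  then obtain W1 r k where r: "r \<in> Mor C W1 W" "r \<in> den" and k: "k \<in> Mor C W1 V" and frk: "(f \<cdot> s) \<cdot> r = t \<cdot> k"
    using den_Ore[OF t'] by metis
  have fsr: "f \<cdot> (s \<cdot> r) = t \<cdot> k" using frk t(1) s r by simp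
  have "Q (b \<cdot> k) = \<beta> \<odot> Q (t \<cdot> k)" using b k t' \<beta> by (simp add: L.Cmp_ext[OF \<beta>t])
  also have "\<dots> = \<beta> \<odot> (Q f \<odot> Q (s \<cdot> r))" using t(1) s r by (simp flip: fsr)
  also have "\<dots> = Q f' \<odot> (\<alpha> \<odot> (Q s \<odot> Q r))" using t s r \<alpha> \<beta> by (simp add: L.Cmp_ext[OF eq])
  also have "\<dots> = Q (f' \<cdot> (a \<cdot> r))" using t s r a \<alpha> by (simp add: L.Cmp_ext[OF \<alpha>s])
  finally have "Q (b \<cdot> k) = Q (f' \<cdot> (a \<cdot> r))" .
  moreover have "b \<cdot> k \<in> Mor C W1 Y'" "f' \<cdot> (a \<cdot> r) \<in> Mor C W1 Y'" using t b k a r by simp_all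
  \<comment> \<open>The square of numerators is only known to commute in the quotient. Precomposing
    with \<open>q\<close> makes it commute in \<open>C\<close>, as TR3 there requires.\<close>
  ultimately obtain W2 q where q: "q \<in> Mor C W2 W1" "q \<in> den" "(b \<cdot> k) \<cdot> q = (f' \<cdot> (a \<cdot> r)) \<cdot> q"
    using Q_eq_iff by metis
  define s2 a2 k2 where "s2 = s \<cdot> (r \<cdot> q)" and "a2 = a \<cdot> (r \<cdot> q)" and "k2 = k \<cdot> q"
  have s2: "s2 \<in> Mor C W2 X" "s2 \<in> den" and a2: "a2 \<in> Mor C W2 X'" and k2: "k2 \<in> Mor C W2 V"
    using s a r k q(1,2) by (simp_all add: s2_def a2_def k2_def)
  have fs2: "f \<cdot> s2 = t \<cdot> k2"
    using t(1) s(1) r(1) q(1) t'(1) k Cmp_ext[OF fsr, of q] by (simp add: s2_def k2_def)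
  have bk2: "b \<cdot> k2 = f' \<cdot> a2" using t b k a r q by (simp add: k2_def a2_def)
  have \<alpha>s2: "\<alpha> \<odot> Q s2 = Q a2"
    using \<alpha> s a r q(1) by (simp add: s2_def a2_def L.Cmp_ext[OF \<alpha>s])
  obtain Z0 l m where K: "triangle C W2 V Z0 k2 l m" using cone_ex[OF k2] .
  note lm = triangle_Mor(1-3)[OF K]
  obtain z where z: "z \<in> Mor C Z0 Z" "z \<in> den" "z \<cdot> l = g \<cdot> t" "susA s2 \<cdot> m = h \<cdot> z"
    using den_completion[OF T K s2 t' fs2] .
  obtain c where c: "c \<in> Mor C Z0 Z'" "c \<cdot> l = g' \<cdot> b" "susA a2 \<cdot> m = h' \<cdot> c"
    using triangle_map[OF K T' a2 b bk2] .
  \<comment> \<open>\<open>\<gamma>\<close> is the fraction with denominator \<open>z\<close> and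
    numerator \<open>c\<close>.\<close>
  obtain \<gamma> where \<gamma>: "\<gamma> \<in> Mor L Z Z'" "\<gamma> \<odot> Q z = Q c"
    using L.iso_extend[OF Q_iso[OF z(2)], of Z0 Z "Q c" Z'] z(1) c(1) by auto
  have zl: "Q z \<odot> Q l = Q g \<odot> Q t" and cl: "Q c \<odot> Q l = Q g' \<odot> Q b"
    and sm: "Q (susA s2) \<odot> Q m = Q h \<odot> Q z" and am: "Q (susA a2) \<odot> Q m = Q h' \<odot> Q c"
    using z c t t' b lm s2 a2 by (simp_all flip: Q.FA_Cmp_simp)
  have 1: "(\<gamma> \<odot> Q g) \<odot> Q t = (Q g' \<odot> \<beta>) \<odot> Q t"
  proof -
    have "(\<gamma> \<odot> Q g) \<odot> Q t = \<gamma> \<odot> (Q z \<odot> Q l)" using \<gamma>(1) t t' by (simp add: zl)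
    also have "\<dots> = Q g' \<odot> Q b" using \<gamma>(1) z(1) lm by (simp add: L.Cmp_ext[OF \<gamma>(2)] cl)
    also have "\<dots> = (Q g' \<odot> \<beta>) \<odot> Q t" using \<beta> t t' by (simp add: \<beta>t)
    finally show ?thesis .
  qed
  have \<alpha>s2': "FA (Sus L) \<alpha> \<odot> Q (susA s2) = Q (susA a2)"
    using arg_cong[OF \<alpha>s2, of "FA (Sus L)"] \<alpha> s2 a2 by simp
  have 2: "(FA (Sus L) \<alpha> \<odot> Q h) \<odot> Q z = (Q h' \<odot> \<gamma>) \<odot> Q z"
  proof -
    have "(FA (Sus L) \<alpha> \<odot> Q h) \<odot> Q z = FA (Sus L) \<alpha> \<odot> (Q (susA s2) \<odot> Q m)"
      using \<alpha> t z(1) by (simp add: sm)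
    also have "\<dots> = Q h' \<odot> Q c" using \<alpha> s2 a2 lm by (simp add: L.Cmp_ext[OF \<alpha>s2'] am)
    also have "\<dots> = (Q h' \<odot> \<gamma>) \<odot> Q z" using \<gamma> t z(1) by simp
    finally show ?thesis .
  qed
  show thesis
  proof (rule that[OF \<gamma>(1)])
    show "\<gamma> \<odot> Q g = Q g' \<odot> \<beta>"
      by (rule L.iso_cancel_right[OF Q_iso[OF t'(2)] _ _ _ _ 1]) (use \<gamma>(1) \<beta> t t' in simp_all)
    show "FA (Sus L) \<alpha> \<odot> Q h = Q h' \<odot> \<gamma>"
      by (rule L.iso_cancel_right[OF Q_iso[OF z(2)] _ _ _ _ 2]) (use \<gamma>(1) \<alpha> t z(1) in simp_all)
  qed
qed

text \<open>Every triangle of the quotient is isomorphic to the image of one in \<open>C\<close>.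
  The square is carried there by these isomorphisms, filled by \<open>triangle_L_map_Q\<close>, and
  carried back.\<close>

lemma TR3_L:
  assumes T: "(\<phi>, \<gamma>, \<psi>) \<in> Tri L" and T': "(\<phi>', \<gamma>', \<psi>') \<in> Tri L"
    and \<alpha>: "\<alpha> \<in> Mor L (Dom L \<phi>) (Dom L \<phi>')" and \<beta>: "\<beta> \<in> Mor L (Cod L \<phi>) (Cod L \<phi>')"
    and eq: "\<beta> \<odot> \<phi> = \<phi>' \<odot> \<alpha>"
  shows "\<exists>\<zeta>. triangle_morphism L (\<phi>, \<gamma>, \<psi>) (\<phi>', \<gamma>', \<psi>') \<alpha> \<beta> \<zeta>"
proof -
  obtain X Y Z f g h a b c where C: "triangle C X Y Z f g h"
    and m: "\<phi> \<in> Mor L (Dom L \<phi>) (Cod L \<phi>)" "\<gamma> \<in> Mor L (Cod L \<phi>) (Cod L \<gamma>)"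
      "\<psi> \<in> Mor L (Cod L \<gamma>) (susO (Dom L \<phi>))"
    and a: "a \<in> Mor L X (Dom L \<phi>)" "is_isomorphism L a" and b: "b \<in> Mor L Y (Cod L \<phi>)" "is_isomorphism L b"
    and c: "c \<in> Mor L Z (Cod L \<gamma>)" "is_isomorphism L c"
    and e: "b \<odot> Q f = \<phi> \<odot> a" "c \<odot> Q g = \<gamma> \<odot> b" "FA (Sus L) a \<odot> Q h = \<psi> \<odot> c"
    using triangle_L_E[OF T] .
  obtain X' Y' Z' f' g' h' a' b' c' where C': "triangle C X' Y' Z' f' g' h'"
    and m': "\<phi>' \<in> Mor L (Dom L \<phi>') (Cod L \<phi>')" "\<gamma>' \<in> Mor L (Cod L \<phi>') (Cod L \<gamma>')"
      "\<psi>' \<in> Mor L (Cod L \<gamma>') (susO (Dom L \<phi>'))"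
    and a': "a' \<in> Mor L X' (Dom L \<phi>')" "is_isomorphism L a'" and b': "b' \<in> Mor L Y' (Cod L \<phi>')" "is_isomorphism L b'"
    and c': "c' \<in> Mor L Z' (Cod L \<gamma>')" "is_isomorphism L c'"
    and e': "b' \<odot> Q f' = \<phi>' \<odot> a'" "c' \<odot> Q g' = \<gamma>' \<odot> b'" "FA (Sus L) a' \<odot> Q h' = \<psi>' \<odot> c'"
    using triangle_L_E[OF T'] .
  note t = triangle_Mor(1-3)[OF C] triangle_Mor(1-3)[OF C']
  have "\<alpha> \<odot> a \<in> Mor L X (Dom L \<phi>')" using \<alpha> a(1) by simp
  then obtain \<alpha>0 where \<alpha>0: "\<alpha>0 \<in> Mor L X X'" "a' \<odot> \<alpha>0 = \<alpha> \<odot> a" by (rule L.iso_lift[OF a'(2,1)])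
  have "\<beta> \<odot> b \<in> Mor L Y (Cod L \<phi>')" using \<beta> b(1) by simp
  then obtain \<beta>0 where \<beta>0: "\<beta>0 \<in> Mor L Y Y'" "b' \<odot> \<beta>0 = \<beta> \<odot> b" by (rule L.iso_lift[OF b'(2,1)])
  have "b' \<odot> (\<beta>0 \<odot> Q f) = \<beta> \<odot> (b \<odot> Q f)"
    using \<beta>0(1) \<beta> b(1) b'(1) t by (simp add: L.Cmp_ext[OF \<beta>0(2)])
  also have "\<dots> = \<phi>' \<odot> (\<alpha> \<odot> a)" using \<alpha> \<beta> m(1) m'(1) a(1) by (simp add: e(1) L.Cmp_ext[OF eq])
  also have "\<dots> = \<phi>' \<odot> (a' \<odot> \<alpha>0)" by (simp only: \<alpha>0(2))
  also have "\<dots> = b' \<odot> (Q f' \<odot> \<alpha>0)"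
    using \<alpha>0(1) m'(1) a'(1) b'(1) t by (simp add: L.Cmp_ext[OF e'(1)])
  finally have *: "b' \<odot> (\<beta>0 \<odot> Q f) = b' \<odot> (Q f' \<odot> \<alpha>0)" .
  have "\<beta>0 \<odot> Q f = Q f' \<odot> \<alpha>0"
    by (rule L.iso_cancel_left[OF b'(2) _ _ _ _ *]) (use \<alpha>0(1) \<beta>0(1) b'(1) t in simp_all)
  then obtain \<zeta>0 where \<zeta>0: "\<zeta>0 \<in> Mor L Z Z'" "\<zeta>0 \<odot> Q g = Q g' \<odot> \<beta>0"
    "FA (Sus L) \<alpha>0 \<odot> Q h = Q h' \<odot> \<zeta>0"
    by (rule triangle_L_map_Q[OF C C' \<alpha>0(1) \<beta>0(1)])
  have "c' \<odot> \<zeta>0 \<in> Mor L Z (Cod L \<gamma>')" using \<zeta>0(1) c'(1) by simp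
  then obtain \<zeta> where \<zeta>: "\<zeta> \<in> Mor L (Cod L \<gamma>) (Cod L \<gamma>')" "\<zeta> \<odot> c = c' \<odot> \<zeta>0"
    by (rule L.iso_extend[OF c(2,1)])
  have 1: "(\<zeta> \<odot> \<gamma>) \<odot> b = (\<gamma>' \<odot> \<beta>) \<odot> b"
  proof -
    have "(\<zeta> \<odot> \<gamma>) \<odot> b = \<zeta> \<odot> (c \<odot> Q g)" using \<zeta>(1) m b(1) by (simp add: e(2))
    also have "\<dots> = c' \<odot> (Q g' \<odot> \<beta>0)"
      using \<zeta>(1) c(1) t c'(1) \<zeta>0(1) by (simp add: L.Cmp_ext[OF \<zeta>(2)] \<zeta>0(2))
    also have "\<dots> = \<gamma>' \<odot> (b' \<odot> \<beta>0)" using t c'(1) \<beta>0(1) m' b'(1) by (simp add: L.Cmp_ext[OF e'(2)])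
    also have "\<dots> = (\<gamma>' \<odot> \<beta>) \<odot> b" using m'(2) \<beta> b(1) by (simp add: \<beta>0(2))
    finally show ?thesis .
  qed
  have a\<alpha>: "FA (Sus L) a' \<odot> FA (Sus L) \<alpha>0 = FA (Sus L) \<alpha> \<odot> FA (Sus L) a"
    using arg_cong[OF \<alpha>0(2), of "FA (Sus L)"] \<alpha>0(1) a'(1) \<alpha> a(1) by simp
  have 2: "(FA (Sus L) \<alpha> \<odot> \<psi>) \<odot> c = (\<psi>' \<odot> \<zeta>) \<odot> c"
  proof -
    have "(FA (Sus L) \<alpha> \<odot> \<psi>) \<odot> c = FA (Sus L) \<alpha> \<odot> (FA (Sus L) a \<odot> Q h)"
      using \<alpha> m(3) c(1) by (simp add: e(3))
    also have "\<dots> = FA (Sus L) a' \<odot> (FA (Sus L) \<alpha>0 \<odot> Q h)"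
      using \<alpha> a(1) a'(1) \<alpha>0(1) t by (simp add: L.Cmp_ext[OF a\<alpha>])
    also have "\<dots> = FA (Sus L) a' \<odot> (Q h' \<odot> \<zeta>0)" by (simp only: \<zeta>0(3))
    also have "\<dots> = \<psi>' \<odot> (c' \<odot> \<zeta>0)" using a'(1) t \<zeta>0(1) m'(3) c'(1) by (simp add: L.Cmp_ext[OF e'(3)])
    also have "\<dots> = (\<psi>' \<odot> \<zeta>) \<odot> c" using m'(3) \<zeta>(1) c(1) by (simp add: \<zeta>(2))
    finally show ?thesis .
  qed
  have "\<zeta> \<odot> \<gamma> = \<gamma>' \<odot> \<beta>"
    by (rule L.iso_cancel_right[OF b(2) _ _ _ _ 1]) (use \<zeta>(1) m m' \<beta> b(1) in simp_all)
  moreover have "FA (Sus L) \<alpha> \<odot> \<psi> = \<psi>' \<odot> \<zeta>"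
    by (rule L.iso_cancel_right[OF c(2) _ _ _ _ 2]) (use \<zeta>(1) m m' \<alpha> c(1) in simp_all)
  ultimately have "triangle_morphism L (\<phi>, \<gamma>, \<psi>) (\<phi>', \<gamma>', \<psi>') \<alpha> \<beta> \<zeta>"
    unfolding triangle_morphism_def using \<alpha> \<beta> \<zeta>(1) eq by (simp del: L.Mor_iff)
  then show ?thesis ..
qed

text \<open>The denominator of a roof is invertible in the quotient, so a cone of the numerator
  serves as a cone of the fraction.\<close>

lemma TR1_ex_L:
  assumes "\<phi> \<in> Ar L" shows "\<exists>\<gamma> \<psi>. (\<phi>, \<gamma>, \<psi>) \<in> Tri L"
proof -
  define X Y where "X = Dom L \<phi>" and "Y = Cod L \<phi>"
  have \<phi>: "\<phi> \<in> Mor L X Y" using assms L.Dom_Ob_simp[of \<phi>] L.Cod_Ob_simp[of \<phi>] by (simp add: X_def Y_def)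
  obtain W s f where s: "s \<in> Mor C W X" "s \<in> den" and f: "f \<in> Mor C W Y" and eq: "\<phi> \<odot> Q s = Q f"
    using Q_E[OF \<phi>] by metis
  obtain Z g h where T: "triangle C W Y Z f g h" using cone_ex[OF f] .
  note t = triangle_Mor(1-3)[OF T]
  have "triangle L X Y Z \<phi> (Q g) (Q (susA s \<cdot> h))"
    by (rule triangle_L_I[OF T \<phi>, of _ _ _ "Q s" "Id L Y" "Id L Z"])
      (use t s Q_iso[OF s(2)] eq f in simp_all)
  from triangle_Mor(4)[OF this] show ?thesis by blast
qed

lemma TR1_Id_L:
  assumes X: "X \<in> Ob L" and Z: "zero_object L Z"
  shows "(Id L X, Zero L X Z, Zero L Z (FO (Sus L) X)) \<in> Tri L"
proof -
  obtain z where z: "zero_object C z" using ex_zero_object by blast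
  have XC: "X \<in> Ob C" using X by simp
  have zO: "z \<in> Ob C" "Z \<in> Ob C" using z Z by (simp_all add: zero_object_def)
  have "triangle L X X Z (Id L X) (Zero L X Z) (Zero L Z (susO X))"
    by (rule triangle_L_I[OF triangle_Id[OF XC z], of _ _ _ _ _ _ "Id L X" "Id L X" "Zero L z Z"])
      (use XC zO L.zero_object_isomorphic(2)[OF zero_object_L[OF z] Z] in simp_all)
  then show ?thesis using triangle_Mor(4) by simp
qed

lemma TR2_L_rotate:
  assumes T: "(\<phi>, \<gamma>, \<psi>) \<in> Tri L"
  shows "(\<gamma>, \<psi>, Neg L (FA (Sus L) \<phi>)) \<in> Tri L"
proof -
  obtain X Y Z f g h a b c where C: "triangle C X Y Z f g h"
    and m: "\<phi> \<in> Mor L (Dom L \<phi>) (Cod L \<phi>)" "\<gamma> \<in> Mor L (Cod L \<phi>) (Cod L \<gamma>)"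
      "\<psi> \<in> Mor L (Cod L \<gamma>) (susO (Dom L \<phi>))"
    and a: "a \<in> Mor L X (Dom L \<phi>)" "is_isomorphism L a" and b: "b \<in> Mor L Y (Cod L \<phi>)" "is_isomorphism L b"
    and c: "c \<in> Mor L Z (Cod L \<gamma>)" "is_isomorphism L c"
    and e: "b \<odot> Q f = \<phi> \<odot> a" "c \<odot> Q g = \<gamma> \<odot> b" "FA (Sus L) a \<odot> Q h = \<psi> \<odot> c"
    using triangle_L_E[OF T] .
  note t = triangle_Mor(1-3)[OF C]
  have e': "FA (Sus L) b \<odot> Q (susA f) = FA (Sus L) \<phi> \<odot> FA (Sus L) a"
    using arg_cong[OF e(1), of "FA (Sus L)"] a(1) b(1) m(1) t by simp
  have "triangle L (Cod L \<phi>) (Cod L \<gamma>) (susO (Dom L \<phi>)) \<gamma> \<psi> (Neg L (FA (Sus L) \<phi>))"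
    by (rule triangle_L_I[OF rotate[OF C], of _ _ _ _ _ _ b c "FA (Sus L) a"])
      (use m a b c e e' t in simp_all)
  then show ?thesis by (rule triangle_Mor(4))
qed

text \<open>A triangle of \<open>C\<close> can be rotated back when its last vertex is a suspension.
  So \<open>Z0\<close> is replaced by some \<open>susO X1\<close>, the rotation is undone in
  \<open>C\<close>, and the comparison with \<open>X\<close> is desuspended because the suspension
  of the quotient is fully faithful.\<close>

lemma TR2_L_back:
  assumes c0: "candidate_triangle L (\<phi>, \<gamma>, \<psi>)" and T: "(\<gamma>, \<psi>, Neg L (FA (Sus L) \<phi>)) \<in> Tri L"
  shows "(\<phi>, \<gamma>, \<psi>) \<in> Tri L"
proof -
  define X Y Z where "X = Dom L \<phi>" and "Y = Cod L \<phi>" and "Z = Cod L \<gamma>"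
  have \<phi>: "\<phi> \<in> Mor L X Y" and \<gamma>: "\<gamma> \<in> Mor L Y Z" and \<psi>: "\<psi> \<in> Mor L Z (susO X)"
    using c0 L.Dom_Ob_simp[of \<phi>] L.Cod_Ob_simp[of \<phi>] L.Cod_Ob_simp[of \<gamma>]
    by (simp_all add: candidate_triangle_def X_def Y_def Z_def)
  have d: "Dom L \<gamma> = Y" "Cod L \<gamma> = Z" "Cod L \<psi> = susO X" using \<gamma> \<psi> by simp_all
  obtain X0 Y0 Z0 f0 g0 h0 a b c where C: "triangle C X0 Y0 Z0 f0 g0 h0"
    and a: "a \<in> Mor L X0 Y" "is_isomorphism L a" and b: "b \<in> Mor L Y0 Z" "is_isomorphism L b"
    and c: "c \<in> Mor L Z0 (susO X)" "is_isomorphism L c"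
    and e: "b \<odot> Q f0 = \<gamma> \<odot> a" "c \<odot> Q g0 = \<psi> \<odot> b"
      "FA (Sus L) a \<odot> Q h0 = Neg L (FA (Sus L) \<phi>) \<odot> c"
    using triangle_L_E[OF T, unfolded d] by metis
  note t = triangle_Mor(1-3)[OF C]
  have "Z0 \<in> Ob C" using t by simp
  then obtain X1 i where i: "X1 \<in> Ob C" "i \<in> Mor C (susO X1) Z0" "is_isomorphism C i" by (rule sus_essE)
  obtain i' where i': "i' \<in> Mor C Z0 (susO X1)" "i' \<cdot> i = Id C (susO X1)" "i \<cdot> i' = Id C Z0" "is_isomorphism C i'"
    using is_isomorphismE[OF i(3,2)] .
  \<comment> \<open>The sign is the one that rotating a triangle introduces.\<close>
  have hi: "Neg C (h0 \<cdot> i) \<in> Mor C (susO X1) (susO X0)" and X0: "X0 \<in> Ob C" using t i by simp_all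
  obtain k where k: "k \<in> Mor C X1 X0" "Neg C (h0 \<cdot> i) = susA k"
    using sus.fullE[OF i(1) X0 hi] .
  have k': "h0 \<cdot> i = Neg C (susA k)" using Neg_Neg[of "h0 \<cdot> i"] t i by (simp add: k(2))
  have "triangle C X0 Y0 (susO X1) f0 (i' \<cdot> g0) (Neg C (susA k))"
    by (rule triangle_iso[OF C, of _ _ _ _ _ _ "Id C X0" "Id C Y0" i'])
      (use t i i' k in \<open>simp_all flip: k'\<close>)
  then have K: "triangle C X1 X0 Y0 k f0 (i' \<cdot> g0)" by (rule rotate_back[OF k(1)])
  interpret FF: fully_faithful_functor L L "Sus L" by (rule Sus_L_fully_faithful)
  have ci: "c \<odot> Q i \<in> Mor L (FO (Sus L) X1) (FO (Sus L) X)" using c i by simp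
  have "X1 \<in> Ob L" "X \<in> Ob L" using i \<phi> by simp_all
  then obtain d where d: "d \<in> Mor L X1 X" "c \<odot> Q i = FA (Sus L) d" using FF.fullE[OF _ _ ci] by metis
  have "is_isomorphism L (FA (Sus L) d)" unfolding d(2)[symmetric] using c i by simp
  then have diso: "is_isomorphism L d" by (rule FF.reflects_isomorphism[OF d(1)])
  have "FA (Sus L) (a \<odot> Q k) = Neg L (FA (Sus L) a \<odot> Q (h0 \<cdot> i))"
    unfolding k' using a(1) k(1) by simp
  also have "\<dots> = Neg L (Neg L (FA (Sus L) \<phi> \<odot> (c \<odot> Q i)))"
    using a(1) t i c(1) \<phi> by (simp add: L.Cmp_ext[OF e(3)])
  also have "\<dots> = FA (Sus L) (\<phi> \<odot> d)" using \<phi> c(1) i d(1) by (simp add: d(2))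
  finally have "a \<odot> Q k = \<phi> \<odot> d"
    by (rule FF.faithful[of _ X1 Y, rotated 2]) (use a(1) k(1) \<phi> d(1) in simp_all)
  moreover have "FA (Sus L) d \<odot> Q (i' \<cdot> g0) = \<psi> \<odot> b"
  proof -
    have ii: "Q i \<odot> Q i' = Id L Z0" using i i' t Q.FA_Id[of Z0] by (simp del: Q.FA_Cmp_simp flip: Q.FA_Cmp_simp)
    have "FA (Sus L) d \<odot> Q (i' \<cdot> g0) = c \<odot> (Q i \<odot> (Q i' \<odot> Q g0))"
      unfolding d(2)[symmetric] using c(1) i i' t by simp
    also have "\<dots> = c \<odot> Q g0" using i i' t by (simp add: L.Cmp_ext[OF ii])
    finally show ?thesis using e(2) by simp
  qed
  ultimately have "triangle L X Y Z \<phi> \<gamma> \<psi>"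
    by (intro triangle_L_I[OF K \<phi> \<gamma> \<psi> d(1) diso a b _ e(1)])
  then show ?thesis by (rule triangle_Mor(4))
qed

lemma Tri_iso_L:
  assumes T: "t \<in> Tri L" and iso: "isomorphic_triangles L t t'" shows "t' \<in> Tri L"
proof -
  obtain \<phi> \<gamma> \<psi> where t: "t = (\<phi>, \<gamma>, \<psi>)" by (cases t)
  obtain \<phi>' \<gamma>' \<psi>' where t': "t' = (\<phi>', \<gamma>', \<psi>')" by (cases t')
  obtain X Y Z f g h a b c where C: "triangle C X Y Z f g h"
    and m: "\<phi> \<in> Mor L (Dom L \<phi>) (Cod L \<phi>)" "\<gamma> \<in> Mor L (Cod L \<phi>) (Cod L \<gamma>)"
      "\<psi> \<in> Mor L (Cod L \<gamma>) (susO (Dom L \<phi>))"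
    and a: "a \<in> Mor L X (Dom L \<phi>)" "is_isomorphism L a" and b: "b \<in> Mor L Y (Cod L \<phi>)" "is_isomorphism L b"
    and c: "c \<in> Mor L Z (Cod L \<gamma>)" "is_isomorphism L c"
    and e: "b \<odot> Q f = \<phi> \<odot> a" "c \<odot> Q g = \<gamma> \<odot> b" "FA (Sus L) a \<odot> Q h = \<psi> \<odot> c"
    using triangle_L_E[OF T[unfolded t]] .
  note ct = triangle_Mor(1-3)[OF C]
  obtain a' b' c' where tm: "triangle_morphism L (\<phi>, \<gamma>, \<psi>) (\<phi>', \<gamma>', \<psi>') a' b' c'"
    and i: "is_isomorphism L a'" "is_isomorphism L b'" "is_isomorphism L c'"
    and cand: "candidate_triangle L (\<phi>', \<gamma>', \<psi>')"
    using iso unfolding isomorphic_triangles_def t t' by blast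
  have m': "\<phi>' \<in> Mor L (Dom L \<phi>') (Cod L \<phi>')" "\<gamma>' \<in> Mor L (Cod L \<phi>') (Cod L \<gamma>')"
    "\<psi>' \<in> Mor L (Cod L \<gamma>') (susO (Dom L \<phi>'))"
    using cand by (simp_all add: candidate_triangle_def)
  have abc: "a' \<in> Mor L (Dom L \<phi>) (Dom L \<phi>')" "b' \<in> Mor L (Cod L \<phi>) (Cod L \<phi>')" "c' \<in> Mor L (Cod L \<gamma>) (Cod L \<gamma>')"
    "b' \<odot> \<phi> = \<phi>' \<odot> a'" "c' \<odot> \<gamma> = \<gamma>' \<odot> b'" "FA (Sus L) a' \<odot> \<psi> = \<psi>' \<odot> c'"
    using tm unfolding triangle_morphism_def by (simp_all del: L.Mor_iff)
  have "triangle L (Dom L \<phi>') (Cod L \<phi>') (Cod L \<gamma>') \<phi>' \<gamma>' \<psi>'"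
  proof (rule triangle_L_I[OF C m', of "a' \<odot> a" "b' \<odot> b" "c' \<odot> c"])
    show "(b' \<odot> b) \<odot> Q f = \<phi>' \<odot> (a' \<odot> a)"
      using ct m m' a(1) b(1) abc(1,2) by (simp add: e(1) L.Cmp_ext[OF abc(4)])
    show "(c' \<odot> c) \<odot> Q g = \<gamma>' \<odot> (b' \<odot> b)"
      using ct m m' c(1) b(1) abc(2,3) by (simp add: e(2) L.Cmp_ext[OF abc(5)])
    show "FA (Sus L) (a' \<odot> a) \<odot> Q h = \<psi>' \<odot> (c' \<odot> c)"
      using ct m m' c(1) a(1) abc(1,3) by (simp add: e(3) L.Cmp_ext[OF abc(6)])
  qed (use a b c i abc(1-3) in simp_all)
  then show ?thesis unfolding t' by (rule triangle_Mor(4))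
qed

lemma pretriangulated_L: "pretriangulated_category L"
proof (intro pretriangulated_category.intro pretriangulated_category_axioms.intro additive_category_L)
  show "equivalence_functor L L (Sus L)" by (rule Sus_L_equivalence)
  show "additive_functor L L (Sus L)" by (rule SL.additive_functor_axioms)
  show "candidate_triangle L t" if "t \<in> Tri L" for t
    using that unfolding Tri_L isomorphic_triangles_def by blast
  show "(\<phi>, \<gamma>, \<psi>) \<in> Tri L \<longleftrightarrow> (\<gamma>, \<psi>, Neg L (FA (Sus L) \<phi>)) \<in> Tri L"
    if "candidate_triangle L (\<phi>, \<gamma>, \<psi>)" for \<phi> \<gamma> \<psi>
    using TR2_L_rotate TR2_L_back[OF that] by blast
qed (rule Tri_iso_L TR1_Id_L TR1_ex_L TR3_L; assumption)+

end

sublocale verdier \<subseteq> L: pretriangulated_category "verdier_quotient C N"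
  by (rule pretriangulated_L)

context verdier
begin

text \<open>Denominators are chosen so that the given pair is represented by a composable pair
  \<open>k\<close>, \<open>b\<close> of \<open>C\<close>, to which the octahedral axiom applies. The
  cones obtained there differ from the prescribed ones by isomorphisms \<open>c1\<close>,
  \<open>c2\<close>, \<open>c3\<close> from the five lemma, and these transport \<open>u0\<close>
  and \<open>v0\<close>.\<close>

lemma TR4_L:
  assumes "(\<phi>, p, d) \<in> Tri L" and "(\<psi>, p', d') \<in> Tri L" and "Cod L \<phi> = Dom L \<psi>"
    and "(\<psi> \<odot> \<phi>, p'', d'') \<in> Tri L"
  shows "\<exists>u v. (u, v, FA (Sus L) p \<odot> d') \<in> Tri L \<and>
        triangle_morphism L (\<phi>, p, d) (\<psi> \<odot> \<phi>, p'', d'') (Id L (Dom L \<phi>)) \<psi> u \<and>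
        triangle_morphism L (\<psi> \<odot> \<phi>, p'', d'') (\<psi>, p', d') \<phi> (Id L (Cod L \<psi>)) v"
proof -
  define X Y Z A B D where "X = Dom L \<phi>" and "Y = Cod L \<phi>" and "Z = Cod L \<psi>"
    and "A = Cod L p" and "B = Cod L p'" and "D = Cod L p''"
  have F: "triangle L X Y A \<phi> p d" using L.triangleI[OF assms(1)] by (simp add: X_def Y_def A_def)
  have G: "triangle L Y Z B \<psi> p' d'"
    using L.triangleI[OF assms(2)] assms(3) by (simp add: Z_def Y_def B_def)
  note m = triangle_Mor(1-3)[OF F] triangle_Mor(1-3)[OF G]
  have H: "triangle L X Z D (\<psi> \<odot> \<phi>) p'' d''" using L.triangleI[OF assms(4)] m by (simp add: D_def)
  note m = m triangle_Mor(2,3)[OF H]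
  obtain W s a where s: "s \<in> Mor C W X" "s \<in> den" and a: "a \<in> Mor C W Y" and \<phi>s: "\<phi> \<odot> Q s = Q a"
    using Q_E[OF m(1)] by metis
  obtain V t b where t: "t \<in> Mor C V Y" "t \<in> den" and b: "b \<in> Mor C V Z" and \<psi>t: "\<psi> \<odot> Q t = Q b"
    using Q_E[OF m(4)] by metis
  \<comment> \<open>The numerator of \<open>\<phi>\<close> ends at \<open>Y\<close>, while that of
    \<open>\<psi>\<close> starts at the apex \<open>V\<close>. Lifting along \<open>t\<close> makes
    them composable.\<close>
  obtain W1 r k where r: "r \<in> Mor C W1 W" "r \<in> den" and k: "k \<in> Mor C W1 V" and ark: "a \<cdot> r = t \<cdot> k"
    using den_Ore[OF t a] by metis
  define s1 where "s1 = s \<cdot> r"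
  have s1: "s1 \<in> Mor C W1 X" "s1 \<in> den" using s r by (simp_all add: s1_def)
  have "\<phi> \<odot> Q s1 = Q (a \<cdot> r)" using m(1) s a r(1) by (simp add: s1_def L.Cmp_ext[OF \<phi>s])
  then have \<phi>s1: "Q t \<odot> Q k = \<phi> \<odot> Q s1" unfolding ark using t k by simp
  have bk: "b \<cdot> k \<in> Mor C W1 Z" using b k by simp
  obtain A0 p0 d0 where K: "triangle C W1 V A0 k p0 d0" using cone_ex[OF k] .
  obtain B0 p0' d0' where B: "triangle C V Z B0 b p0' d0'" using cone_ex[OF b] .
  obtain D0 p0'' d0'' where M: "triangle C W1 Z D0 (b \<cdot> k) p0'' d0''" using cone_ex[OF bk] .
  obtain u0 v0 where uv: "triangle C A0 D0 B0 u0 v0 (susA p0 \<cdot> d0')"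
    "u0 \<cdot> p0 = p0'' \<cdot> b" "d0'' \<cdot> u0 = d0" "v0 \<cdot> p0'' = p0'" "susA k \<cdot> d0'' = d0' \<cdot> v0"
    using octahedral[OF K B M] .
  note m0 = triangle_Mor(1-3)[OF K] triangle_Mor(1-3)[OF B] triangle_Mor(2,3)[OF M] triangle_Mor(1-2)[OF uv(1)]
  have Qs: "Q s1 \<in> Mor L W1 X" "is_isomorphism L (Q s1)" and Qt: "Q t \<in> Mor L V Y" "is_isomorphism L (Q t)"
    and Z: "Id L Z \<in> Mor L Z Z" "is_isomorphism L (Id L Z)"
    using s1 t m Q_iso by simp_all
  obtain c1 where c1: "c1 \<in> Mor L A0 A" "is_isomorphism L c1" "c1 \<odot> Q p0 = p \<odot> Q t"
    "FA (Sus L) (Q s1) \<odot> Q d0 = d \<odot> c1"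
    by (rule L.triangle_iso_ex[OF Q_triangle[OF K] F Qs Qt \<phi>s1])
  have "Id L Z \<odot> Q b = \<psi> \<odot> Q t" using b m by (simp add: \<psi>t)
  from L.triangle_iso_ex[OF Q_triangle[OF B] G Qt Z this]
  obtain c2 where c2: "c2 \<in> Mor L B0 B" "is_isomorphism L c2" "c2 \<odot> Q p0' = p' \<odot> Id L Z"
    "FA (Sus L) (Q t) \<odot> Q d0' = d' \<odot> c2" .
  have "Q (b \<cdot> k) = \<psi> \<odot> (Q t \<odot> Q k)" using m t b k by (simp add: L.Cmp_ext[OF \<psi>t])
  then have "Id L Z \<odot> Q (b \<cdot> k) = (\<psi> \<odot> \<phi>) \<odot> Q s1" unfolding \<phi>s1 using bk m s1 by simp
  from L.triangle_iso_ex[OF Q_triangle[OF M] H Qs Z this]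
  obtain c3 where c3: "c3 \<in> Mor L D0 D" "is_isomorphism L c3" "c3 \<odot> Q p0'' = p'' \<odot> Id L Z"
    "FA (Sus L) (Q s1) \<odot> Q d0'' = d'' \<odot> c3" .
  have c2p: "c2 \<odot> Q p0' = p'" and c3p: "c3 \<odot> Q p0'' = p''" using c2(3) c3(3) m by simp_all
  have "c3 \<odot> Q u0 \<in> Mor L A0 D" using c3(1) m0 by simp
  then obtain u where u: "u \<in> Mor L A D" "u \<odot> c1 = c3 \<odot> Q u0" by (rule L.iso_extend[OF c1(2,1)])
  have "c2 \<odot> Q v0 \<in> Mor L D0 B" using c2(1) m0 by simp
  then obtain v where v: "v \<in> Mor L D B" "v \<odot> c3 = c2 \<odot> Q v0" by (rule L.iso_extend[OF c3(2,1)])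
  have q: "Q u0 \<odot> Q p0 = Q p0'' \<odot> Q b" "Q d0'' \<odot> Q u0 = Q d0" "Q v0 \<odot> Q p0'' = Q p0'"
    "Q (susA k) \<odot> Q d0'' = Q d0' \<odot> Q v0"
    using uv(2-5) m0 b k by (simp_all flip: Q.FA_Cmp_simp)
  have Sc1: "FA (Sus L) c1 \<odot> Q (susA p0) = FA (Sus L) p \<odot> Q (susA t)"
    using arg_cong[OF c1(3), of "FA (Sus L)"] c1(1) m m0 t by simp
  have S\<phi>: "Q (susA t) \<odot> Q (susA k) = FA (Sus L) \<phi> \<odot> Q (susA s1)"
    using arg_cong[OF \<phi>s1, of "FA (Sus L)"] m m0 t s1 k by simp
  have d0: "Q (susA s1) \<odot> Q d0 = d \<odot> c1" and d0': "Q (susA t) \<odot> Q d0' = d' \<odot> c2"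
    and d0'': "Q (susA s1) \<odot> Q d0'' = d'' \<odot> c3"
    using c1(4) c2(4) c3(4) s1 t by simp_all
  have T: "triangle L A D B u v (FA (Sus L) p \<odot> d')"
  proof (rule L.triangle_iso[OF Q_triangle[OF uv(1)], of _ _ _ _ _ _ c1 c3 c2])
    have "FA (Sus L) c1 \<odot> (Q (susA p0) \<odot> Q d0') = FA (Sus L) p \<odot> (Q (susA t) \<odot> Q d0')"
      using c1(1) m m0 t by (simp add: L.Cmp_ext[OF Sc1])
    also have "\<dots> = (FA (Sus L) p \<odot> d') \<odot> c2" unfolding d0' using m c2(1) by simp
    finally show "FA (Sus L) c1 \<odot> Q (susA p0 \<cdot> d0') = (FA (Sus L) p \<odot> d') \<odot> c2" using m0 by simp
  qed (use u v c1 c2 c3 m in simp_all)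
  \<comment> \<open>The commutation laws are reduced to those of the octahedron in \<open>C\<close>,
    mostly after composing with an isomorphism that is then cancelled.\<close>
  have 1: "(u \<odot> p) \<odot> Q t = (p'' \<odot> \<psi>) \<odot> Q t"
  proof -
    have "(u \<odot> p) \<odot> Q t = u \<odot> (c1 \<odot> Q p0)" using u(1) m t by (simp add: c1(3))
    also have "\<dots> = c3 \<odot> (Q p0'' \<odot> Q b)"
      using u(1) c1(1) c3(1) m0 by (simp add: L.Cmp_ext[OF u(2)] q(1))
    also have "\<dots> = (p'' \<odot> \<psi>) \<odot> Q t" using c3(1) m m0 b t by (simp add: L.Cmp_ext[OF c3p] \<psi>t)
    finally show ?thesis .
  qed
  have up: "u \<odot> p = p'' \<odot> \<psi>"
    by (rule L.iso_cancel_right[OF Qt(2) _ _ _ _ 1]) (use u(1) m t in simp_all)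
  have 2: "(d'' \<odot> u) \<odot> c1 = d \<odot> c1"
  proof -
    have "(d'' \<odot> u) \<odot> c1 = d'' \<odot> (c3 \<odot> Q u0)" using u m c1(1) by simp
    also have "\<dots> = Q (susA s1) \<odot> (Q d0'' \<odot> Q u0)"
      using m m0 c3(1) s1 by (simp add: L.Cmp_ext[OF d0''[symmetric]])
    also have "\<dots> = d \<odot> c1" unfolding q(2) by (rule d0)
    finally show ?thesis .
  qed
  have du: "d'' \<odot> u = d"
    by (rule L.iso_cancel_right[OF c1(2) _ _ _ _ 2]) (use u(1) m c1(1) in simp_all)
  have 3: "(v \<odot> p'') = p'"
  proof -
    have "v \<odot> p'' = v \<odot> (c3 \<odot> Q p0'')" by (simp only: c3p)
    also have "\<dots> = c2 \<odot> (Q v0 \<odot> Q p0'')" using v c3(1) c2(1) m0 by (simp add: L.Cmp_ext[OF v(2)])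
    also have "\<dots> = p'" unfolding q(3) by (rule c2p)
    finally show ?thesis .
  qed
  have 4: "(FA (Sus L) \<phi> \<odot> d'') \<odot> c3 = (d' \<odot> v) \<odot> c3"
  proof -
    have "(FA (Sus L) \<phi> \<odot> d'') \<odot> c3 = FA (Sus L) \<phi> \<odot> (Q (susA s1) \<odot> Q d0'')"
      unfolding d0'' using m c3(1) by simp
    also have "\<dots> = Q (susA t) \<odot> (Q (susA k) \<odot> Q d0'')"
      using m m0 s1 t k by (simp add: L.Cmp_ext[OF S\<phi>])
    also have "\<dots> = d' \<odot> (c2 \<odot> Q v0)"
      unfolding q(4) using m m0 t c2(1) by (simp add: L.Cmp_ext[OF d0'])
    also have "\<dots> = (d' \<odot> v) \<odot> c3" using m v c3(1) by simp
    finally show ?thesis .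
  qed
  have dv: "FA (Sus L) \<phi> \<odot> d'' = d' \<odot> v"
    by (rule L.iso_cancel_right[OF c3(2) _ _ _ _ 4]) (use v(1) m c3(1) in simp_all)
  have "triangle_morphism L (\<phi>, p, d) (\<psi> \<odot> \<phi>, p'', d'') (Id L (Dom L \<phi>)) \<psi> u"
    using m u(1) up du by (simp add: triangle_morphism_def)
  moreover have "triangle_morphism L (\<psi> \<odot> \<phi>, p'', d'') (\<psi>, p', d') \<phi> (Id L (Cod L \<psi>)) v"
    using m v(1) 3 dv by (simp add: triangle_morphism_def)
  ultimately show ?thesis using triangle_Mor(4)[OF T] by blast
qed

theorem triangulated_category_L: "triangulated_category L"
proof (intro triangulated_category.intro triangulated_category_axioms.intro additive_category_L)
qed (rule L.Sus_equivalence L.Sus_additive L.Tri_candidate L.Tri_iso L.TR1_Id L.TR1_ex L.TR2 L.TR3 TR4_L; assumption)+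

end

sublocale verdier \<subseteq> L: triangulated_category "verdier_quotient C N"
  by (rule triangulated_category_L)

section \<open>Quotients of triangulated subcategories\<close>

context verdier
begin

text \<open>The locale is read differently here: \<open>N\<close> is not the kernel of a quotient
  but the subcategory that receives a triangulated structure.\<close>

abbreviation Sub :: "('o, 'm) triangulated_data" where "Sub \<equiv> full_subcategory C N"

lemma Sub_sels:
  "Ob Sub = N" "Ar Sub = {f \<in> Ar C. Dom C f \<in> N \<and> Cod C f \<in> N}" "Dom Sub = Dom C" "Cod Sub = Cod C"
  "Id Sub = Id C" "Cmp Sub = Cmp C" "Add Sub = Add C" "Zero Sub = Zero C" "Sus Sub = Sus C"
  "Tri Sub = {(f, g, h) \<in> Tri C. Dom C f \<in> N \<and> Cod C f \<in> N \<and> Cod C g \<in> N}"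
  by (simp_all add: full_subcategory_def)

lemma Mor_Sub_iff: "f \<in> Mor Sub X Y \<longleftrightarrow> f \<in> Mor C X Y \<and> X \<in> N \<and> Y \<in> N"
  by (auto simp: Mor_def Sub_sels)

lemma Mor_Sub: "X \<in> N \<Longrightarrow> Y \<in> N \<Longrightarrow> Mor Sub X Y = Mor C X Y"
  using Mor_Sub_iff by blast

lemma category_Sub: "category Sub"
proof
  show "\<And>f. f \<in> Ar Sub \<Longrightarrow> Dom Sub f \<in> Ob Sub" "\<And>f. f \<in> Ar Sub \<Longrightarrow> Cod Sub f \<in> Ob Sub"
    by (simp_all add: Sub_sels)
  show "\<And>X. X \<in> Ob Sub \<Longrightarrow> Id Sub X \<in> Mor Sub X X"
    unfolding Mor_Sub_iff by (simp add: Sub_sels)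
  show "\<And>f X Y g Z. f \<in> Mor Sub X Y \<Longrightarrow> g \<in> Mor Sub Y Z \<Longrightarrow> g \<cdot>\<^bsub>Sub\<^esub> f \<in> Mor Sub X Z"
    "\<And>f X Y. f \<in> Mor Sub X Y \<Longrightarrow> f \<cdot>\<^bsub>Sub\<^esub> Id Sub X = f"
    "\<And>f X Y. f \<in> Mor Sub X Y \<Longrightarrow> Id Sub Y \<cdot>\<^bsub>Sub\<^esub> f = f"
    "\<And>f W X g Y h Z. f \<in> Mor Sub W X \<Longrightarrow> g \<in> Mor Sub X Y \<Longrightarrow> h \<in> Mor Sub Y Z \<Longrightarrow>
      h \<cdot>\<^bsub>Sub\<^esub> (g \<cdot>\<^bsub>Sub\<^esub> f) = (h \<cdot>\<^bsub>Sub\<^esub> g) \<cdot>\<^bsub>Sub\<^esub> f"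
    unfolding Mor_Sub_iff by (simp_all add: Sub_sels)
qed

lemma Mor_group_Sub: "X \<in> N \<Longrightarrow> Y \<in> N \<Longrightarrow> Mor_group Sub X Y = Mor_group C X Y"
  by (simp add: Mor_group_def Mor_Sub Sub_sels)

lemma Neg_Sub: "f \<in> Mor Sub X Y \<Longrightarrow> Neg Sub f = Neg C f"
  unfolding Mor_Sub_iff by (simp add: Neg_def Mor_group_Sub Sub_sels)

lemma additive_category_Sub: "additive_category Sub"
proof (intro additive_category.intro additive_category_axioms.intro category_Sub)
  show "comm_group (Mor_group Sub X Y)" if "X \<in> Ob Sub" "Y \<in> Ob Sub" for X Y
  proof -
    have XY: "X \<in> N" "Y \<in> N" using that by (simp_all add: Sub_sels)
    then show ?thesis using Mor_comm_group[of X Y] by (simp add: Mor_group_Sub)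
  qed
  show "\<And>f X Y g Z g'. f \<in> Mor Sub X Y \<Longrightarrow> g \<in> Mor Sub Y Z \<Longrightarrow> g' \<in> Mor Sub Y Z \<Longrightarrow>
      Add Sub g g' \<cdot>\<^bsub>Sub\<^esub> f = Add Sub (g \<cdot>\<^bsub>Sub\<^esub> f) (g' \<cdot>\<^bsub>Sub\<^esub> f)"
    "\<And>f X Y f' g Z. f \<in> Mor Sub X Y \<Longrightarrow> f' \<in> Mor Sub X Y \<Longrightarrow> g \<in> Mor Sub Y Z \<Longrightarrow>
      g \<cdot>\<^bsub>Sub\<^esub> Add Sub f f' = Add Sub (g \<cdot>\<^bsub>Sub\<^esub> f) (g \<cdot>\<^bsub>Sub\<^esub> f')"
    unfolding Mor_Sub_iff by (simp_all add: Sub_sels Cmp_Add_distrib)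
  obtain z where z: "zero_object C z" using ex_zero_object by blast
  then have "z \<in> N" using N_zero by simp
  moreover have "\<exists>!f. f \<in> Mor C X z" "\<exists>!f. f \<in> Mor C z X" if "X \<in> N" for X
    using z N_Ob[OF that] unfolding zero_object_def by blast+
  ultimately have "zero_object Sub z" unfolding zero_object_def by (simp add: Sub_sels Mor_Sub del: Mor_iff)
  then show "\<exists>Z. zero_object Sub Z" ..
  fix X Y assume "X \<in> Ob Sub" "Y \<in> Ob Sub"
  then have XY: "X \<in> N" "Y \<in> N" by (simp_all add: Sub_sels)
  then obtain Z where Z: "direct_sum C X Y Z" using ex_direct_sum[of X Y] by auto
  then have "Z \<in> N" using N_direct_sum XY by simp
  with Z XY have "direct_sum Sub X Y Z"
    unfolding direct_sum_def by (simp add: Sub_sels Mor_Sub del: Mor_iff)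
  then show "\<exists>Z. direct_sum Sub X Y Z" ..
qed

lemma is_isomorphism_Sub:
  assumes "f \<in> Mor Sub X Y" shows "is_isomorphism Sub f \<longleftrightarrow> is_isomorphism C f"
proof -
  have "f \<in> Mor C X Y" "X \<in> N" "Y \<in> N" using assms by (simp_all add: Mor_Sub_iff del: Mor_iff)
  then show ?thesis unfolding is_isomorphism_def by (simp add: Sub_sels Mor_Sub)
qed

lemma isomorphic_Sub: "X \<in> N \<Longrightarrow> Y \<in> N \<Longrightarrow> isomorphic Sub X Y \<longleftrightarrow> isomorphic C X Y"
  unfolding isomorphic_def using is_isomorphism_Sub[of _ X Y] Mor_Sub[of X Y] by auto

lemma zero_object_Sub: "zero_object Sub Z \<longleftrightarrow> Z \<in> N \<and> zero_object C Z"
proof -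
  interpret S: additive_category Sub by (rule additive_category_Sub)
  show ?thesis unfolding S.zero_object_iff zero_object_iff by (auto simp: Sub_sels)
qed

lemma Sus_Sub_functor: "cat_functor Sub Sub (Sus Sub)"
proof (intro cat_functor.intro cat_functor_axioms.intro category_Sub)
  show "\<And>X. X \<in> Ob Sub \<Longrightarrow> FO (Sus Sub) X \<in> Ob Sub"
    "\<And>X. X \<in> Ob Sub \<Longrightarrow> FA (Sus Sub) (Id Sub X) = Id Sub (FO (Sus Sub) X)"
    by (simp_all add: Sub_sels N_sus)
  show "\<And>f X Y. f \<in> Mor Sub X Y \<Longrightarrow> FA (Sus Sub) f \<in> Mor Sub (FO (Sus Sub) X) (FO (Sus Sub) Y)"
    "\<And>f X Y g Z. f \<in> Mor Sub X Y \<Longrightarrow> g \<in> Mor Sub Y Z \<Longrightarrow>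
      FA (Sus Sub) (g \<cdot>\<^bsub>Sub\<^esub> f) = FA (Sus Sub) g \<cdot>\<^bsub>Sub\<^esub> FA (Sus Sub) f"
    unfolding Mor_Sub_iff by (simp_all add: Sub_sels N_sus)
qed

text \<open>Fullness and faithfulness are inherited since the subcategory is full. Essential
  surjectivity holds because an object whose suspension lies in \<open>N\<close> lies in
  \<open>N\<close> itself.\<close>

lemma Sus_Sub_equivalence: "equivalence_functor Sub Sub (Sus Sub)"
proof -
  interpret F: fully_faithful_functor Sub Sub "Sus Sub"
  proof (intro fully_faithful_functor.intro fully_faithful_functor_axioms.intro Sus_Sub_functor)
    fix X Y h assume "X \<in> Ob Sub" "Y \<in> Ob Sub" "h \<in> Mor Sub (FO (Sus Sub) X) (FO (Sus Sub) Y)"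
    then have "X \<in> N" "Y \<in> N" "h \<in> Mor C (susO X) (susO Y)"
      unfolding Mor_Sub_iff by (simp_all add: Sub_sels)
    then show "\<exists>f \<in> Mor Sub X Y. FA (Sus Sub) f = h"
      using sus.full[of X Y h] by (simp add: Sub_sels Mor_Sub del: Mor_iff)
  next
    fix f g X Y assume "f \<in> Mor Sub X Y" "g \<in> Mor Sub X Y" "FA (Sus Sub) f = FA (Sus Sub) g"
    then have "f \<in> Mor C X Y" "g \<in> Mor C X Y" "susA f = susA g"
      unfolding Mor_Sub_iff by (simp_all add: Sub_sels)
    then show "f = g" by (rule sus.faithful)
  qed
  show ?thesis
  proof (rule F.equivalence_functorI)
    fix Y assume "Y \<in> Ob Sub"
    then have Y: "Y \<in> N" by (simp add: Sub_sels)
    then have "Y \<in> Ob C" by simp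
    then obtain X e where X: "X \<in> Ob C" and "e \<in> Mor C (susO X) Y" "is_isomorphism C e" by (rule sus_essE)
    then have i: "isomorphic C (susO X) Y" using isomorphicI by blast
    then have "susO X \<in> N" using N_iso[OF Y isomorphic_sym] by blast
    then show "\<exists>X \<in> Ob Sub. isomorphic Sub (FO (Sus Sub) X) Y"
      using i X Y N_sus[OF X] isomorphic_Sub[of "susO X" Y]
      by (intro bexI[of _ X]) (simp_all add: Sub_sels)
  qed
qed

lemma triangle_Sub_iff:
  "triangle Sub X Y Z f g h \<longleftrightarrow> triangle C X Y Z f g h \<and> X \<in> N \<and> Y \<in> N \<and> Z \<in> N"
  unfolding triangle_def Mor_Sub_iff by (auto simp: Sub_sels N_sus)

lemma triangle_Sub_I:
  assumes T: "(f, g, h) \<in> Tri Sub"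
  shows "triangle C (Dom C f) (Cod C f) (Cod C g) f g h" "Dom C f \<in> N" "Cod C f \<in> N" "Cod C g \<in> N"
  using T triangleI[of f g h] by (auto simp: Sub_sels)

lemma candidate_triangle_Sub: "candidate_triangle Sub t \<Longrightarrow> candidate_triangle C t"
  unfolding candidate_triangle_def by (auto simp: Sub_sels)

lemma triangle_morphism_Sub:
  assumes "Dom C f \<in> N" "Cod C f \<in> N" "Cod C g \<in> N" "Dom C f' \<in> N" "Cod C f' \<in> N" "Cod C g' \<in> N"
  shows "triangle_morphism Sub (f, g, h) (f', g', h') a b c \<longleftrightarrow>
    triangle_morphism C (f, g, h) (f', g', h') a b c"
  unfolding triangle_morphism_def using assms by (simp add: Sub_sels Mor_Sub)

text \<open>Cones of arrows in \<open>N\<close> have their vertex in \<open>N\<close>, and fillers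
  between such triangles belong to the subcategory because it is full, so each axiom
  restricts.\<close>

theorem triangulated_category_Sub: "triangulated_category Sub"
proof (intro triangulated_category.intro triangulated_category_axioms.intro additive_category_Sub)
  show "equivalence_functor Sub Sub (Sus Sub)" by (rule Sus_Sub_equivalence)
  have "FA (Sus Sub) (Add Sub f g) = Add Sub (FA (Sus Sub) f) (FA (Sus Sub) g)"
    if "f \<in> Mor Sub X Y" "g \<in> Mor Sub X Y" for f g X Y
    using that unfolding Mor_Sub_iff by (simp add: Sub_sels)
  then show "additive_functor Sub Sub (Sus Sub)"
    unfolding additive_functor_def using Sus_Sub_functor by blast
  show cand: "candidate_triangle Sub t" if "t \<in> Tri Sub" for t
  proof -
    obtain f g h where t: "t = (f, g, h)" by (cases t)
    note T = triangle_Sub_I[OF that[unfolded t]]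
    show ?thesis unfolding t candidate_triangle_def
      using triangle_Mor(1-3)[OF T(1)] T(2-4) by (simp add: Sub_sels N_sus)
  qed
  show "t' \<in> Tri Sub" if t: "t \<in> Tri Sub" and iso: "isomorphic_triangles Sub t t'" for t t'
  proof -
    obtain f g h where te: "t = (f, g, h)" by (cases t)
    obtain f' g' h' where te': "t' = (f', g', h')" by (cases t')
    note T = triangle_Sub_I[OF t[unfolded te]]
    obtain a b c where tm: "triangle_morphism Sub (f, g, h) (f', g', h') a b c"
      and i: "is_isomorphism Sub a" "is_isomorphism Sub b" "is_isomorphism Sub c"
      and c: "candidate_triangle Sub t" "candidate_triangle Sub t'"
      using iso unfolding isomorphic_triangles_def te te' by blast
    have N': "Dom C f' \<in> N" "Cod C f' \<in> N" "Cod C g' \<in> N"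
      using c(2) unfolding te' candidate_triangle_def by (simp_all add: Sub_sels)
    have "a \<in> Mor Sub (Dom C f) (Dom C f')" "b \<in> Mor Sub (Cod C f) (Cod C f')" "c \<in> Mor Sub (Cod C g) (Cod C g')"
      using tm unfolding triangle_morphism_def by (simp_all add: Sub_sels(3,4))
    then have "is_isomorphism C a" "is_isomorphism C b" "is_isomorphism C c"
      using i is_isomorphism_Sub by blast+
    moreover have "triangle_morphism C (f, g, h) (f', g', h') a b c"
      using tm triangle_morphism_Sub T(2-4) N' by blast
    ultimately have "isomorphic_triangles C (f, g, h) (f', g', h')"
      unfolding isomorphic_triangles_def using c candidate_triangle_Sub te te' by blast
    then have "(f', g', h') \<in> Tri C" by (rule Tri_iso[OF triangle_Mor(4)[OF T(1)]])
    then show ?thesis using N' by (simp add: te' Sub_sels)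
  qed
  show "(Id Sub X, Zero Sub X Z, Zero Sub Z (FO (Sus Sub) X)) \<in> Tri Sub"
    if "X \<in> Ob Sub" "zero_object Sub Z" for X Z
  proof -
    have XZ: "X \<in> N" "zero_object C Z" "Z \<in> N" using that by (simp_all add: Sub_sels zero_object_Sub)
    then show ?thesis using TR1_Id[of X Z] by (simp add: Sub_sels)
  qed
  show "\<exists>g h. (f, g, h) \<in> Tri Sub" if "f \<in> Ar Sub" for f
  proof -
    have f: "f \<in> Mor C (Dom C f) (Cod C f)" "Dom C f \<in> N" "Cod C f \<in> N" using that by (simp_all add: Sub_sels)
    obtain Z g h where T: "triangle C (Dom C f) (Cod C f) Z f g h" using cone_ex[OF f(1)] .
    then have "triangle Sub (Dom C f) (Cod C f) Z f g h" using N_third[OF T] f triangle_Sub_iff by blast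
    from triangle_Mor(4)[OF this] show ?thesis by blast
  qed
  show "(f, g, h) \<in> Tri Sub \<longleftrightarrow> (g, h, Neg Sub (FA (Sus Sub) f)) \<in> Tri Sub"
    if c: "candidate_triangle Sub (f, g, h)" for f g h
  proof -
    have m: "f \<in> Ar C" "Dom C f \<in> N" "Cod C f \<in> N" "Dom C g = Cod C f" "Cod C g \<in> N" "Cod C h = susO (Dom C f)"
      using c unfolding candidate_triangle_def by (simp_all add: Sub_sels)
    have "susA f \<in> Mor Sub (susO (Dom C f)) (susO (Cod C f))" unfolding Mor_Sub_iff using m N_sus by simp
    then have "Neg Sub (FA (Sus Sub) f) = Neg C (susA f)" using Neg_Sub by (simp add: Sub_sels)
    then show ?thesis using TR2[OF candidate_triangle_Sub[OF c]] m N_sus by (simp add: Sub_sels)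
  qed
  show "\<exists>c. triangle_morphism Sub (f, g, h) (f', g', h') a b c"
    if T: "(f, g, h) \<in> Tri Sub" "(f', g', h') \<in> Tri Sub"
      and a: "a \<in> Mor Sub (Dom Sub f) (Dom Sub f')" and b: "b \<in> Mor Sub (Cod Sub f) (Cod Sub f')"
      and eq: "b \<cdot>\<^bsub>Sub\<^esub> f = f' \<cdot>\<^bsub>Sub\<^esub> a" for f g h f' g' h' a b
  proof -
    note T1 = triangle_Sub_I[OF T(1)] and T2 = triangle_Sub_I[OF T(2)]
    have "a \<in> Mor C (Dom C f) (Dom C f')" "b \<in> Mor C (Cod C f) (Cod C f')" "b \<cdot> f = f' \<cdot> a"
      using a b eq unfolding Mor_Sub_iff by (simp_all only: Sub_sels)
    from TR3[OF triangle_Mor(4)[OF T1(1)] triangle_Mor(4)[OF T2(1)] this]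
    show ?thesis using triangle_morphism_Sub T1(2-4) T2(2-4) by blast
  qed
  show "\<exists>u v. (u, v, FA (Sus Sub) p \<cdot>\<^bsub>Sub\<^esub> d') \<in> Tri Sub \<and>
        triangle_morphism Sub (f, p, d) (g \<cdot>\<^bsub>Sub\<^esub> f, p'', d'') (Id Sub (Dom Sub f)) g u \<and>
        triangle_morphism Sub (g \<cdot>\<^bsub>Sub\<^esub> f, p'', d'') (g, p', d') f (Id Sub (Cod Sub g)) v"
    if T: "(f, p, d) \<in> Tri Sub" "(g, p', d') \<in> Tri Sub" "Cod Sub f = Dom Sub g"
      "(g \<cdot>\<^bsub>Sub\<^esub> f, p'', d'') \<in> Tri Sub" for f p d g p' d' p'' d''
  proof -
    note T1 = triangle_Sub_I[OF T(1)] and T2 = triangle_Sub_I[OF T(2)]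
      and T3 = triangle_Sub_I[OF T(4)[unfolded Sub_sels(6)]]
    have "Cod C f = Dom C g" using T(3) by (simp add: Sub_sels)
    from TR4[OF triangle_Mor(4)[OF T1(1)] triangle_Mor(4)[OF T2(1)] this triangle_Mor(4)[OF T3(1)]]
    obtain u v where uv: "(u, v, susA p \<cdot> d') \<in> Tri C"
      "triangle_morphism C (f, p, d) (g \<cdot> f, p'', d'') (Id C (Dom C f)) g u"
      "triangle_morphism C (g \<cdot> f, p'', d'') (g, p', d') f (Id C (Cod C g)) v" by blast
    \<comment> \<open>The new triangle connects the three given cones, which already lie in
      \<open>N\<close>.\<close>
    have "u \<in> Mor C (Cod C p) (Cod C p'')" "v \<in> Mor C (Cod C p'') (Cod C p')"
      using uv(2,3) unfolding triangle_morphism_def prod.case by blast+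
    then have "Dom C u \<in> N" "Cod C u \<in> N" "Cod C v \<in> N"
      using T1(4) T2(4) T3(4) by simp_all
    then have "(u, v, susA p \<cdot> d') \<in> Tri Sub" using uv(1) by (simp add: Sub_sels)
    moreover have "triangle_morphism Sub (f, p, d) (g \<cdot> f, p'', d'') (Id C (Dom C f)) g u"
      using uv(2) unfolding triangle_morphism_Sub[OF T1(2-4) T3(2-4)] .
    moreover have "triangle_morphism Sub (g \<cdot> f, p'', d'') (g, p', d') f (Id C (Cod C g)) v"
      using uv(3) unfolding triangle_morphism_Sub[OF T3(2-4) T2(2-4)] .
    ultimately show ?thesis unfolding Sub_sels by blast
  qed
qed

end

text \<open>The functor goes from the quotient of the full subcategory \<open>A\<close> by
  \<open>B\<close> to the quotient of \<open>C\<close> by \<open>N\<close>. With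
  \<open>(A, B, N)\<close> equal to \<open>(P, P \<inter> M, M)\<close> and to
  \<open>(M, P \<inter> M, P)\<close> the same lemmas serve both equivalences.\<close>

locale canonical = C: verdier C N + A: verdier C A + B: verdier C B
  for C :: "('o, 'm) triangulated_data" (structure) and A B N +
  assumes BA: "B \<subseteq> A" and BN: "B \<subseteq> N"
begin

lemma triangulated_subcategory_Sub: "triangulated_subcategory A.Sub B"
  unfolding triangulated_subcategory_def
proof (intro conjI)
  show "B \<subseteq> Ob A.Sub" using BA by (simp add: A.Sub_sels)
  obtain z where "zero_object C z" using C.ex_zero_object by blast
  then show "\<exists>Z \<in> B. zero_object A.Sub Z" using B.N_zero A.N_zero A.zero_object_Sub by blast
  show "\<forall>X \<in> B. \<forall>Y \<in> Ob A.Sub. isomorphic A.Sub X Y \<longrightarrow> Y \<in> B"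
    using A.isomorphic_Sub B.N_iso BA by (auto simp: A.Sub_sels)
  show "\<forall>X \<in> Ob A.Sub. X \<in> B \<longleftrightarrow> FO (Sus A.Sub) X \<in> B"
    using B.N_sus by (simp add: A.Sub_sels)
  show "\<forall>(f, g, h) \<in> Tri A.Sub. Dom A.Sub f \<in> B \<and> Cod A.Sub f \<in> B \<longrightarrow> Cod A.Sub g \<in> B"
  proof (safe)
    fix f g h assume T: "(f, g, h) \<in> Tri A.Sub" and "Dom A.Sub f \<in> B" "Cod A.Sub f \<in> B"
    then have "Dom C f \<in> B" "Cod C f \<in> B" by (simp_all add: A.Sub_sels)
    then show "Cod A.Sub g \<in> B" using B.N_third[OF A.triangle_Sub_I(1)[OF T]] by (simp add: A.Sub_sels)
  qed
qed

lemma verdier_Sub: "verdier A.Sub B"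
proof -
  interpret T: triangulated_category A.Sub by (rule A.triangulated_category_Sub)
  show ?thesis by unfold_locales (rule triangulated_subcategory_Sub)
qed

text \<open>The cone of an arrow between objects of \<open>A\<close> already lies in
  \<open>A\<close>, so both conditions test the same object for membership in
  \<open>B\<close>.\<close>

lemma den_Sub_iff:
  assumes s: "s \<in> Mor C X Y" and XY: "X \<in> A" "Y \<in> A"
  shows "s \<in> denominators A.Sub B \<longleftrightarrow> s \<in> B.den"
proof -
  interpret D: verdier A.Sub B by (rule verdier_Sub)
  obtain Z g h where T: "triangle C X Y Z s g h" using C.cone_ex[OF s] .
  then have T': "triangle A.Sub X Y Z s g h" using A.N_third[OF T] XY A.triangle_Sub_iff by blast
  show ?thesis using D.den_iff_cone[OF T'] B.den_iff_cone[OF T] by blast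
qed

lemma den_mono: "s \<in> B.den \<Longrightarrow> s \<in> C.den"
  using BN unfolding denominators_def by blast

end

sublocale canonical \<subseteq> D: verdier "full_subcategory C A" B
  by (rule verdier_Sub)

lemma (in canonical) canonical_verdier_functor: "verdier_functor A.Sub B C N id_functor"
proof (intro verdier_functor.intro verdier_functor_axioms.intro)
  show "verdier A.Sub B" by (rule verdier_Sub)
  show "verdier C N" by unfold_locales
  show "additive_cat_functor A.Sub C id_functor"
  proof (intro additive_cat_functor.intro additive_cat_functor_axioms.intro cat_functor.intro
      cat_functor_axioms.intro A.category_Sub A.additive_category_Sub)
    show "category C" "additive_category C" by unfold_locales
  qed (auto simp: A.Sub_sels Mor_def)
  show "FA id_functor s \<in> C.den" if s: "s \<in> denominators A.Sub B" for s
  proof -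
    have "s \<in> Ar A.Sub" using s by simp
    then have "s \<in> Mor C (Dom C s) (Cod C s)" "Dom C s \<in> A" "Cod C s \<in> A" by (simp_all add: A.Sub_sels)
    then show ?thesis using s den_Sub_iff den_mono by auto
  qed
qed

sublocale canonical \<subseteq> F: verdier_functor "full_subcategory C A" B C N id_functor
  by (rule canonical_verdier_functor)

context canonical
begin

abbreviation can where "can \<equiv> canonical_functor C N"

lemma can_eq: "can = F.I"
  by (simp add: canonical_functor_def)

lemma can_functor: "cat_functor D.L C.L can"
  unfolding can_eq by (rule F.induced_functor)

lemma can_frac:
  assumes "s \<in> Mor C W X" "s \<in> B.den" "f \<in> Mor C W Y" "W \<in> A" "X \<in> A" "Y \<in> A"
  shows "D.frac s f \<in> Mor D.L X Y" "FA can (D.frac s f) = C.frac s f"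
proof -
  have m: "s \<in> Mor A.Sub W X" "s \<in> D.den" "f \<in> Mor A.Sub W Y"
    using assms den_Sub_iff[of s W X] by (simp_all add: A.Mor_Sub_iff del: C.Mor_iff D.Mor_iff)
  show "D.frac s f \<in> Mor D.L X Y" by (rule D.frac_Mor[OF m])
  show "FA can (D.frac s f) = C.frac s f" using F.FA_induced[OF m] by (simp add: can_eq)
qed

lemma Mor_D_E:
  assumes "\<alpha> \<in> Mor D.L X Y"
  obtains W s f where "s \<in> Mor C W X" "s \<in> B.den" "f \<in> Mor C W Y" "W \<in> A" "X \<in> A" "Y \<in> A"
    "\<alpha> = D.frac s f" "s \<in> D.den" "FA can \<alpha> = C.frac s f"
proof -
  obtain W s f where m: "s \<in> Mor A.Sub W X" "s \<in> D.den" "f \<in> Mor A.Sub W Y" "\<alpha> = D.frac s f"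
    using D.Mor_L_E[OF assms] .
  then have m': "s \<in> Mor C W X" "f \<in> Mor C W Y" "W \<in> A" "X \<in> A" "Y \<in> A"
    by (simp_all add: A.Mor_Sub_iff del: C.Mor_iff D.Mor_iff)
  then have "s \<in> B.den" using m(2) den_Sub_iff by blast
  then show thesis using that m' m(2,4) can_frac(2) by metis
qed

lemma can_Q: "f \<in> Mor A.Sub X Y \<Longrightarrow> FA can (D.Q f) = C.Q f"
  using F.FA_induced_Q[of f X Y] by (simp add: can_eq)

lemma can_Sus:
  assumes \<alpha>: "\<alpha> \<in> Mor D.L X Y"
  shows "FA can (FA (Sus D.L) \<alpha>) = FA (Sus C.L) (FA can \<alpha>)"
proof -
  obtain W s f where s: "s \<in> Mor C W X" "s \<in> B.den" "f \<in> Mor C W Y" "W \<in> A" "X \<in> A" "Y \<in> A"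
    "\<alpha> = D.frac s f" "s \<in> D.den" "FA can \<alpha> = C.frac s f"
    using Mor_D_E[OF \<alpha>] .
  have m: "s \<in> Mor A.Sub W X" "f \<in> Mor A.Sub W Y"
    using s by (simp_all add: A.Mor_Sub_iff del: C.Mor_iff D.Mor_iff)
  have "C.susA s \<in> Mor C (C.susO W) (C.susO X)" "C.susA s \<in> B.den" "C.susA f \<in> Mor C (C.susO W) (C.susO Y)"
    "C.susO W \<in> A" "C.susO X \<in> A" "C.susO Y \<in> A"
    using s B.den_sus A.N_sus by simp_all
  from can_frac(2)[OF this] show ?thesis
    unfolding s(9) C.Sus_frac[OF s(1) den_mono[OF s(2)] s(3)]
    using D.Sus_frac[OF m(1) s(8) m(2)] by (simp add: s(7) A.Sub_sels)
qed

lemma can_additive: "additive_cat_functor D.L C.L can"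
  unfolding can_eq by (rule F.induced_additive)

text \<open>The functor fixes objects and commutes strictly with the suspensions, so identities
  serve as connecting isomorphism. For exactness it is applied to an isomorphism between a triangle
  of the source and an image triangle.\<close>

theorem can_triangle_functor: "triangle_functor D.L C.L can (\<lambda>X. Id C.L (FO (Sus C) X))"
  unfolding triangle_functor_def
proof (intro conjI D.triangulated_category_L C.triangulated_category_L)
  interpret K: additive_cat_functor D.L C.L can by (rule can_additive)
  have FO: "FO can X = X" for X by (simp add: can_eq)
  show "additive_functor D.L C.L can" by (rule K.additive_functor_axioms)
  have SO: "FO (Sus D.L) X = C.susO X" for X by (simp add: A.Sub_sels)
  show "natural_iso D.L C.L (comp_functor can (Sus D.L)) (comp_functor (Sus C.L) can)
     (\<lambda>X. Id C.L (FO (Sus C) X))"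
    unfolding natural_iso_def
  proof (intro conjI ballI)
    fix X assume "X \<in> Ob D.L"
    then have X: "X \<in> Ob C" by (simp add: A.Sub_sels)
    then show "Id C.L (C.susO X) \<in> Mor C.L (FO (comp_functor can (Sus D.L)) X) (FO (comp_functor (Sus C.L) can) X)"
      by (simp add: FO A.Sub_sels)
    show "is_isomorphism C.L (Id C.L (C.susO X))" using X by simp
  next
    fix \<alpha> assume \<alpha>: "\<alpha> \<in> Ar D.L"
    define X Y where "X = Dom D.L \<alpha>" and "Y = Cod D.L \<alpha>"
    have m: "\<alpha> \<in> Mor D.L X Y" using \<alpha> by (simp add: X_def Y_def)
    have m': "FA can \<alpha> \<in> Mor C.L X Y" using K.FA_Mor[OF m] by (simp add: FO)
    then have "FA (Sus C.L) (FA can \<alpha>) \<in> Mor C.L (C.susO X) (C.susO Y)" by simp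
    then have "Id C.L (C.susO Y) \<cdot>\<^bsub>C.L\<^esub> FA (Sus C.L) (FA can \<alpha>) = FA (Sus C.L) (FA can \<alpha>) \<cdot>\<^bsub>C.L\<^esub> Id C.L (C.susO X)"
      by simp
    then show "Id C.L (C.susO (Cod D.L \<alpha>)) \<cdot>\<^bsub>C.L\<^esub> FA (comp_functor can (Sus D.L)) \<alpha> =
      FA (comp_functor (Sus C.L) can) \<alpha> \<cdot>\<^bsub>C.L\<^esub> Id C.L (C.susO (Dom D.L \<alpha>))"
      using can_Sus[OF m] by (simp add: X_def Y_def)
  qed
  have "(FA can \<phi>, FA can \<gamma>, Id C.L (C.susO (Dom D.L \<phi>)) \<cdot>\<^bsub>C.L\<^esub> FA can \<psi>) \<in> Tri C.L"
    if T: "(\<phi>, \<gamma>, \<psi>) \<in> Tri D.L" for \<phi> \<gamma> \<psi>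
  proof -
    obtain X Y Z f g h a b c where S: "triangle A.Sub X Y Z f g h"
      and m: "\<phi> \<in> Mor D.L (Dom D.L \<phi>) (Cod D.L \<phi>)" "\<gamma> \<in> Mor D.L (Cod D.L \<phi>) (Cod D.L \<gamma>)"
        "\<psi> \<in> Mor D.L (Cod D.L \<gamma>) (FO (Sus A.Sub) (Dom D.L \<phi>))"
      and a: "a \<in> Mor D.L X (Dom D.L \<phi>)" "is_isomorphism D.L a"
      and b: "b \<in> Mor D.L Y (Cod D.L \<phi>)" "is_isomorphism D.L b"
      and c: "c \<in> Mor D.L Z (Cod D.L \<gamma>)" "is_isomorphism D.L c"
      and e: "b \<cdot>\<^bsub>D.L\<^esub> D.Q f = \<phi> \<cdot>\<^bsub>D.L\<^esub> a" "c \<cdot>\<^bsub>D.L\<^esub> D.Q g = \<gamma> \<cdot>\<^bsub>D.L\<^esub> b"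
        "FA (Sus D.L) a \<cdot>\<^bsub>D.L\<^esub> D.Q h = \<psi> \<cdot>\<^bsub>D.L\<^esub> c"
      by (rule D.triangle_L_E[OF T])
    have CT: "triangle C X Y Z f g h" using S A.triangle_Sub_iff by blast
    note t = triangle_Mor(1-3)[OF S]
    note k = K.FA_Mor[OF m(1)] K.FA_Mor[OF m(2)] K.FA_Mor[OF m(3)] K.FA_Mor[OF a(1)] K.FA_Mor[OF b(1)] K.FA_Mor[OF c(1)]
    note k = k[unfolded FO]
    have sA: "FO (Sus A.Sub) X' = C.susO X'" for X' by (simp add: A.Sub_sels)
    have e': "FA can b \<cdot>\<^bsub>C.L\<^esub> C.Q f = FA can \<phi> \<cdot>\<^bsub>C.L\<^esub> FA can a"
      "FA can c \<cdot>\<^bsub>C.L\<^esub> C.Q g = FA can \<gamma> \<cdot>\<^bsub>C.L\<^esub> FA can b"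
      "FA (Sus C.L) (FA can a) \<cdot>\<^bsub>C.L\<^esub> C.Q h = FA can \<psi> \<cdot>\<^bsub>C.L\<^esub> FA can c"
      using arg_cong[OF e(1), of "FA can"] arg_cong[OF e(2), of "FA can"] arg_cong[OF e(3), of "FA can"]
        can_Q[OF t(1)] can_Q[OF t(2)] can_Q[OF t(3)] can_Sus[OF a(1)] m a b c t by simp_all
    have "triangle C.L (Dom D.L \<phi>) (Cod D.L \<phi>) (Cod D.L \<gamma>) (FA can \<phi>) (FA can \<gamma>) (FA can \<psi>)"
      by (rule C.triangle_L_I[OF CT k(1,2) k(3)[unfolded sA] k(4) _ k(5) _ k(6) _ e'])
        (use a b c in simp_all)
    moreover have "Id C.L (C.susO (Dom D.L \<phi>)) \<cdot>\<^bsub>C.L\<^esub> FA can \<psi> = FA can \<psi>"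
      using k(3)[unfolded sA] by simp
    ultimately show ?thesis using triangle_Mor(4) by metis
  qed
  then show "\<forall>(\<phi>, \<gamma>, \<psi>) \<in> Tri D.L.
      (FA can \<phi>, FA can \<gamma>, Id C.L (C.susO (Dom D.L \<phi>)) \<cdot>\<^bsub>C.L\<^esub> FA can \<psi>) \<in> Tri C.L" by blast
qed

text \<open>By additivity, faithfulness only has to be checked on arrows that come from \<open>C\<close>.\<close>

lemma can_triangle_equivalenceI:
  assumes full: "\<And>X Y W s f. X \<in> A \<Longrightarrow> Y \<in> A \<Longrightarrow> s \<in> Mor C W X \<Longrightarrow> s \<in> C.den \<Longrightarrow> f \<in> Mor C W Y \<Longrightarrow>
      \<exists>W' s' f'. W' \<in> A \<and> s' \<in> Mor C W' X \<and> s' \<in> B.den \<and> f' \<in> Mor C W' Y \<and> C.frac s' f' = C.frac s f"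
    and faithful: "\<And>W Y f V q. W \<in> A \<Longrightarrow> Y \<in> A \<Longrightarrow> f \<in> Mor C W Y \<Longrightarrow> q \<in> Mor C V W \<Longrightarrow> q \<in> C.den \<Longrightarrow>
      f \<cdot> q = Zero C V Y \<Longrightarrow> \<exists>V' q'. V' \<in> A \<and> q' \<in> Mor C V' W \<and> q' \<in> B.den \<and> f \<cdot> q' = Zero C V' Y"
    and ess: "\<And>Z. Z \<in> Ob C \<Longrightarrow> \<exists>X \<in> A. isomorphic C.L X Z"
  shows "triangle_equivalence D.L C.L can (\<lambda>X. Id C.L (FO (Sus C) X))"
  unfolding triangle_equivalence_def
proof (intro conjI can_triangle_functor)
  interpret K: additive_cat_functor D.L C.L can by (rule can_additive)
  have FO: "FO can X = X" for X by (simp add: can_eq)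
  interpret K: fully_faithful_functor D.L C.L can
  proof (intro fully_faithful_functor.intro fully_faithful_functor_axioms.intro can_functor)
    fix X Y \<eta> assume "X \<in> Ob D.L" "Y \<in> Ob D.L" and \<eta>: "\<eta> \<in> Mor C.L (FO can X) (FO can Y)"
    then have XY: "X \<in> A" "Y \<in> A" by (simp_all add: A.Sub_sels)
    obtain W s f where s: "s \<in> Mor C W X" "s \<in> C.den" "f \<in> Mor C W Y" "\<eta> = C.frac s f"
      using C.Mor_L_E[OF \<eta>[unfolded FO]] .
    obtain W' s' f' where s': "W' \<in> A" "s' \<in> Mor C W' X" "s' \<in> B.den" "f' \<in> Mor C W' Y"
      "C.frac s' f' = C.frac s f" using full[OF XY s(1-3)] by blast
    show "\<exists>\<alpha> \<in> Mor D.L X Y. FA can \<alpha> = \<eta>"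
      using can_frac[OF s'(2-4,1) XY] s'(5) s(4) by metis
  next
    fix \<alpha> \<beta> X Y assume m: "\<alpha> \<in> Mor D.L X Y" "\<beta> \<in> Mor D.L X Y" "FA can \<alpha> = FA can \<beta>"
    show "\<alpha> = \<beta>"
    proof (rule K.faithfulI[OF _ m])
      fix X Y \<alpha> assume \<alpha>: "\<alpha> \<in> Mor D.L X Y" and 0: "FA can \<alpha> = Zero C.L (FO can X) (FO can Y)"
      obtain W s f where s: "s \<in> Mor C W X" "s \<in> B.den" "f \<in> Mor C W Y" "W \<in> A" "X \<in> A" "Y \<in> A"
        "\<alpha> = D.frac s f" "s \<in> D.den" "FA can \<alpha> = C.frac s f"
        using Mor_D_E[OF \<alpha>] .
      \<comment> \<open>Clearing the denominator shows that the numerator vanishes in the target, so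
        some \<open>q\<close> kills it. The assumption \<open>faithful\<close> exchanges
        \<open>q\<close> for a denominator inside \<open>A\<close>, and then the numerator vanishes
        in the source too.\<close>
      have "C.Q f = C.frac s f \<cdot>\<^bsub>C.L\<^esub> C.Q s" using C.frac_Q[OF s(1) den_mono[OF s(2)] s(3)] by simp
      also have "C.frac s f = Zero C.L X Y" using 0 s(9) by (simp add: FO)
      also have "Zero C.L X Y \<cdot>\<^bsub>C.L\<^esub> C.Q s = Zero C.L W Y" using s by simp
      finally obtain V q where q: "q \<in> Mor C V W" "q \<in> C.den" "f \<cdot> q = Zero C V Y"
        by (rule C.Q_zeroE[OF s(3)])
      obtain V' q' where q': "V' \<in> A" "q' \<in> Mor C V' W" "q' \<in> B.den" "f \<cdot> q' = Zero C V' Y"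
        using faithful[OF s(4,6,3) q] by blast
      have m: "s \<in> Mor A.Sub W X" "f \<in> Mor A.Sub W Y" "q' \<in> Mor A.Sub V' W" "Zero C W Y \<in> Mor A.Sub W Y"
        "q' \<in> D.den"
        using s q' den_Sub_iff[of q' V' W] by (simp_all add: A.Mor_Sub_iff del: C.Mor_iff D.Mor_iff, simp)
      have "f \<cdot>\<^bsub>A.Sub\<^esub> q' = Zero C W Y \<cdot>\<^bsub>A.Sub\<^esub> q'" using q' s by (simp add: A.Sub_sels)
      then have "D.Q f = D.Q (Zero C W Y)" using D.Q_eq_iff[OF m(2,4)] m(3,5) by blast
      also have "\<dots> = Zero D.L W Y" using s D.Q.FA_Zero[of W Y] by (simp add: A.Sub_sels)
      finally have "D.Q f = Zero D.L W Y" .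
      then have *: "\<alpha> \<cdot>\<^bsub>D.L\<^esub> D.Q s = Zero D.L X Y \<cdot>\<^bsub>D.L\<^esub> D.Q s"
        using D.frac_Q[OF m(1) s(8) m(2)] s m(1) by (simp add: A.Sub_sels)
      show "\<alpha> = Zero D.L X Y"
        by (rule D.L.iso_cancel_right[OF D.Q_iso[OF s(8)] _ _ _ _ *]) (use \<alpha> m(1) in simp_all)
    qed
  qed
  show "equivalence_functor D.L C.L can"
    by (rule K.equivalence_functorI) (use ess in \<open>simp add: FO A.Sub_sels\<close>)
qed

end

section \<open>The subcategories \<open>\<U>\<^sub>+\<close> and \<open>\<U>\<^sub>-\<close>\<close>

lemma Sus_image_mono: "U \<subseteq> W \<Longrightarrow> Sus_image C U \<subseteq> Sus_image C W"
  unfolding Sus_image_def by blast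

lemma Sus_inv_image_mono: "U \<subseteq> W \<Longrightarrow> Sus_inv_image C U \<subseteq> Sus_inv_image C W"
  unfolding Sus_inv_image_def by blast

text \<open>What both halves of a pre-weight structure share. Their closures under the suspension
  run in opposite directions and are stated separately.\<close>

definition extension_closed :: "('o, 'm, 'z) triangulated_data_scheme \<Rightarrow> 'o set \<Rightarrow> bool" where
  "extension_closed C W \<longleftrightarrow> W \<subseteq> Ob C \<and> (\<exists>Z \<in> W. zero_object C Z) \<and> star C W W \<subseteq> W"

context pretriangulated_category
begin

lemma starI: "triangle C X Z Y f g h \<Longrightarrow> X \<in> A \<Longrightarrow> Y \<in> B \<Longrightarrow> Z \<in> star C A B"
proof -
  assume T: "triangle C X Z Y f g h" and "X \<in> A" "Y \<in> B"
  then have "Dom C f \<in> A \<and> Cod C f = Z \<and> Cod C g \<in> B" using triangle_Mor(1,2)[OF T] by simp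
  then show ?thesis using triangle_Mor(4)[OF T] unfolding star_def by blast
qed

lemma starE:
  assumes "Z \<in> star C A B"
  obtains X Y f g h where "triangle C X Z Y f g h" "X \<in> A" "Y \<in> B"
  using assms triangleI unfolding star_def by blast

text \<open>An object isomorphic to \<open>X\<close> is an extension of \<open>X\<close> by a zero
  object. This is where closure under isomorphism comes from, as
  \<open>full_additive_subcategory\<close> does not contain it.\<close>

lemma extension_closed_iso:
  assumes W: "extension_closed C W" and X: "X \<in> W" and iso: "isomorphic C X Y"
  shows "Y \<in> W"
proof -
  obtain f where f: "f \<in> Mor C X Y" "is_isomorphism C f" using iso by (rule isomorphicE)
  obtain z where z: "z \<in> W" "zero_object C z" using W unfolding extension_closed_def by blast
  have O: "X \<in> Ob C" "z \<in> Ob C" using f z by (simp_all add: zero_object_def)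
  have "triangle C X Y z f (Zero C Y z) (Zero C z (susO X))"
    by (rule triangle_iso[OF triangle_Id[OF O(1) z(2)], of _ _ _ _ _ _ "Id C X" f "Id C z"])
      (use f O in simp_all)
  then have "Y \<in> star C W W" using X z(1) starI by blast
  then show ?thesis using W unfolding extension_closed_def by blast
qed

lemma extension_closed_triangle:
  assumes "extension_closed C W" "triangle C X Z Y f g h" "X \<in> W" "Y \<in> W"
  shows "Z \<in> W"
  using assms starI unfolding extension_closed_def by blast

lemma Sus_inv_image_iff:
  assumes "extension_closed C W"
  shows "X \<in> Sus_inv_image C W \<longleftrightarrow> X \<in> Ob C \<and> susO X \<in> W"
  unfolding Sus_inv_image_def
  using extension_closed_iso[OF assms] isomorphic_sym isomorphic_refl[of "susO X"] by auto

lemma extension_closed_Sus_inv_image: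
  assumes W: "extension_closed C W" shows "extension_closed C (Sus_inv_image C W)"
  unfolding extension_closed_def
proof (intro conjI subsetI)
  show "X \<in> Ob C" if "X \<in> Sus_inv_image C W" for X using that Sus_inv_image_iff[OF W] by blast
  obtain z where z: "z \<in> W" "zero_object C z" using W unfolding extension_closed_def by blast
  have "susO z \<in> W"
    using extension_closed_iso[OF W z(1) zero_object_isomorphic(1)[OF z(2) sus.zero_object_FO[OF z(2)]]] .
  moreover have "z \<in> Ob C" using z by (simp add: zero_object_def)
  ultimately show "\<exists>Z \<in> Sus_inv_image C W. zero_object C Z"
    using z Sus_inv_image_iff[OF W] by blast
  fix Z assume "Z \<in> star C (Sus_inv_image C W) (Sus_inv_image C W)"
  then obtain X Y f g h where T: "triangle C X Z Y f g h" and XY: "X \<in> Sus_inv_image C W" "Y \<in> Sus_inv_image C W"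
    by (rule starE)
  have "susO Z \<in> W"
    using extension_closed_triangle[OF W triangle_sus[OF T]] XY Sus_inv_image_iff[OF W] by blast
  moreover have "Z \<in> Ob C" using triangle_Mor(1)[OF T] by simp
  ultimately show "Z \<in> Sus_inv_image C W" using Sus_inv_image_iff[OF W] by blast
qed

lemma Sus_image_iff:
  assumes "extension_closed C W" "X \<in> Ob C"
  shows "susO X \<in> Sus_image C W \<longleftrightarrow> X \<in> W"
proof
  assume "susO X \<in> Sus_image C W"
  then obtain X' where X': "X' \<in> W" "isomorphic C (susO X') (susO X)" unfolding Sus_image_def by blast
  then have "X' \<in> Ob C" using assms(1) unfolding extension_closed_def by blast
  then have "isomorphic C X' X" using sus.reflects_isomorphic[OF _ assms(2) X'(2)] by blast
  then show "X \<in> W" using extension_closed_iso[OF assms(1) X'(1)] by blast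
next
  assume "X \<in> W"
  then show "susO X \<in> Sus_image C W" unfolding Sus_image_def using assms(2) isomorphic_refl[of "susO X"] by auto
qed

lemma Sus_image_isoI: "X \<in> W \<Longrightarrow> isomorphic C (susO X) Y \<Longrightarrow> Y \<in> Sus_image C W"
  unfolding Sus_image_def using isomorphic_Ob by blast

text \<open>A triangle whose outer vertices are suspensions up to isomorphism is replaced by one
  with all vertices suspended; full faithfulness of the suspension then gives a triangle with outer
  vertices in \<open>W\<close>.\<close>

lemma extension_closed_Sus_image:
  assumes W: "extension_closed C W" shows "extension_closed C (Sus_image C W)"
  unfolding extension_closed_def
proof (intro conjI subsetI)
  show "X \<in> Ob C" if "X \<in> Sus_image C W" for X using that unfolding Sus_image_def by blast
  obtain z where z: "z \<in> W" "zero_object C z" using W unfolding extension_closed_def by blast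
  have "z \<in> Ob C" using z by (simp add: zero_object_def)
  then have "susO z \<in> Sus_image C W" using Sus_image_iff[OF W] z(1) by blast
  then show "\<exists>Z \<in> Sus_image C W. zero_object C Z" using sus.zero_object_FO[OF z(2)] by blast
  fix Z assume "Z \<in> star C (Sus_image C W) (Sus_image C W)"
  then obtain X Y f g h where T: "triangle C X Z Y f g h" and XY: "X \<in> Sus_image C W" "Y \<in> Sus_image C W"
    by (rule starE)
  note t = triangle_Mor(1-3)[OF T]
  obtain X' where X': "X' \<in> W" "isomorphic C (susO X') X" using XY(1) unfolding Sus_image_def by blast
  obtain Y' where Y': "Y' \<in> W" "isomorphic C (susO Y') Y" using XY(2) unfolding Sus_image_def by blast
  have O: "X' \<in> Ob C" "Y' \<in> Ob C" using X' Y' W unfolding extension_closed_def by blast+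
  obtain a where a: "a \<in> Mor C X (susO X')" "is_isomorphism C a" using isomorphic_sym[OF X'(2)] by (rule isomorphicE)
  obtain c where c: "c \<in> Mor C Y (susO Y')" "is_isomorphism C c" using isomorphic_sym[OF Y'(2)] by (rule isomorphicE)
  have "Z \<in> Ob C" using t by simp
  then obtain Z' e where e: "Z' \<in> Ob C" "e \<in> Mor C (susO Z') Z" "is_isomorphism C e" by (rule sus_essE)
  obtain b where b: "b \<in> Mor C Z (susO Z')" "is_isomorphism C b" using is_isomorphismE[OF e(3,2)] by metis
  have "b \<cdot> f \<in> Mor C X (susO Z')" "c \<cdot> g \<in> Mor C Z (susO Y')" "susA a \<cdot> h \<in> Mor C Y (susO (susO X'))"
    using t a b c by simp_all
  then obtain f' g' h' where f': "f' \<in> Mor C (susO X') (susO Z')" "f' \<cdot> a = b \<cdot> f"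
    and g': "g' \<in> Mor C (susO Z') (susO Y')" "g' \<cdot> b = c \<cdot> g"
    and h': "h' \<in> Mor C (susO Y') (susO (susO X'))" "h' \<cdot> c = susA a \<cdot> h"
    using iso_extend[OF a(2,1)] iso_extend[OF b(2,1)] iso_extend[OF c(2,1)] by metis
  have T': "triangle C (susO X') (susO Z') (susO Y') f' g' h'"
    by (rule triangle_iso[OF T f'(1) g'(1) h'(1) a(1) b(1) c(1) a(2) b(2) c(2)])
      (use f' g' h' in simp_all)
  obtain u v where u: "u \<in> Mor C X' Z'" "f' = susA u" and v: "v \<in> Mor C Z' Y'" "g' = susA v"
    using sus.fullE[OF O(1) e(1) f'(1)] sus.fullE[OF e(1) O(2) g'(1)] by metis
  \<comment> \<open>Suspending a triangle negates its last arrow, so it is \<open>Neg C h'\<close>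
    that is desuspended.\<close>
  have "Neg C h' \<in> Mor C (susO Y') (susO (susO X'))" "susO X' \<in> Ob C" using h' O by simp_all
  then obtain w where w: "w \<in> Mor C Y' (susO X')" "Neg C h' = susA w"
    using sus.fullE[OF O(2)] by metis
  have hw: "h' = Neg C (susA w)" using Neg_Neg[of h'] h'(1) by (simp add: w(2))
  have "triangle C X' Z' Y' u v w"
    by (rule triangle_sus_back[OF T'[unfolded u(2) v(2) hw] u(1) v(1) w(1)])
  then have "Z' \<in> W" using extension_closed_triangle[OF W] X'(1) Y'(1) by blast
  then show "Z \<in> Sus_image C W" using Sus_image_isoI isomorphicI[OF e(2,3)] by blast
qed

text \<open>After rotation the cone of an arrow from \<open>X\<close> to \<open>Y\<close> is an
  extension of \<open>Y\<close> and the suspension of \<open>X\<close>. These two may sit at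
  different levels of the chain, but both lie at the larger one, where closure under extensions
  applies.\<close>

lemma triangulated_subcategory_Union:
  fixes W :: "nat \<Rightarrow> 'o set"
  assumes W: "\<And>n. extension_closed C (W n)" and inc: "\<And>n. W n \<subseteq> W (Suc n)"
    and up: "\<And>n X. X \<in> W n \<Longrightarrow> \<exists>m. susO X \<in> W m"
    and down: "\<And>n X. X \<in> Ob C \<Longrightarrow> susO X \<in> W n \<Longrightarrow> \<exists>m. X \<in> W m"
  shows "triangulated_subcategory C (\<Union>n. W n)"
  unfolding triangulated_subcategory_def
proof (intro conjI)
  have "W n \<subseteq> Ob C" for n using W[of n] unfolding extension_closed_def by blast
  then show "(\<Union>n. W n) \<subseteq> Ob C" by blast
  have "\<exists>Z \<in> W 0. zero_object C Z" using W[of 0] unfolding extension_closed_def by blast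
  then show "\<exists>Z \<in> \<Union>n. W n. zero_object C Z" by blast
  show "\<forall>X \<in> \<Union>n. W n. \<forall>Y \<in> Ob C. isomorphic C X Y \<longrightarrow> Y \<in> (\<Union>n. W n)"
  proof (intro ballI impI)
    fix X Y assume "X \<in> (\<Union>n. W n)" and XY: "isomorphic C X Y"
    then obtain n where "X \<in> W n" by blast
    from extension_closed_iso[OF W this XY] show "Y \<in> (\<Union>n. W n)" by blast
  qed
  show "\<forall>X \<in> Ob C. X \<in> (\<Union>n. W n) \<longleftrightarrow> susO X \<in> (\<Union>n. W n)"
  proof (intro ballI iffI)
    fix X assume "X \<in> (\<Union>n. W n)"
    then obtain n where "X \<in> W n" by blast
    from up[OF this] show "susO X \<in> (\<Union>n. W n)" by blast
  next
    fix X assume X: "X \<in> Ob C" "susO X \<in> (\<Union>n. W n)"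
    then obtain n where "susO X \<in> W n" by blast
    from down[OF X(1) this] show "X \<in> (\<Union>n. W n)" by blast
  qed
  have mono: "W m \<subseteq> W n" if "m \<le> n" for m n
    using that inc by (rule lift_Suc_mono_le[rotated])
  have cone: "Z \<in> (\<Union>n. W n)" if T: "triangle C X Y Z f g h" and X: "X \<in> (\<Union>n. W n)" and Y: "Y \<in> (\<Union>n. W n)"
    for X Y Z f g h
  proof -
    obtain k where "X \<in> W k" using X by blast
    then obtain m where m: "susO X \<in> W m" using up by blast
    obtain n where n: "Y \<in> W n" using Y by blast
    have "susO X \<in> W (max m n)" "Y \<in> W (max m n)"
      using m n mono[of m "max m n"] mono[of n "max m n"] by auto
    then have "Z \<in> W (max m n)" using extension_closed_triangle[OF W rotate[OF T]] by blast
    then show ?thesis by blast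
  qed
  show "\<forall>(f, g, h) \<in> Tri C. Dom C f \<in> (\<Union>n. W n) \<and> Cod C f \<in> (\<Union>n. W n) \<longrightarrow> Cod C g \<in> (\<Union>n. W n)"
  proof
    fix t assume t: "t \<in> Tri C"
    obtain f g h where te: "t = (f, g, h)" by (cases t)
    show "case t of (f, g, h) \<Rightarrow>
      Dom C f \<in> (\<Union>n. W n) \<and> Cod C f \<in> (\<Union>n. W n) \<longrightarrow> Cod C g \<in> (\<Union>n. W n)"
      unfolding te prod.case by (intro impI, elim conjE, rule cone[OF triangleI[OF t[unfolded te]]])
  qed
qed

text \<open>Both closure properties pass from \<open>W\<close> to \<open>Sus_image C W\<close>, and
  induction carries them along. The chain grows because each \<open>X\<close> in \<open>W\<close> is
  up to isomorphism a suspension \<open>susO Y\<close>, and desuspension keeps \<open>Y\<close> in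
  \<open>W\<close>.\<close>

lemma Sus_image_funpow:
  assumes U: "extension_closed C U" "Sus_inv_image C U \<subseteq> U"
  shows "extension_closed C ((Sus_image C ^^ n) U)" "Sus_inv_image C ((Sus_image C ^^ n) U) \<subseteq> (Sus_image C ^^ n) U"
    "(Sus_image C ^^ n) U \<subseteq> (Sus_image C ^^ Suc n) U"
proof -
  have inc: "W \<subseteq> Sus_image C W" if W: "extension_closed C W" "Sus_inv_image C W \<subseteq> W" for W
  proof
    fix X assume X: "X \<in> W"
    then have XO: "X \<in> Ob C" using W(1) unfolding extension_closed_def by blast
    then obtain Y e where e: "Y \<in> Ob C" "e \<in> Mor C (susO Y) X" "is_isomorphism C e" by (rule sus_essE)
    have i: "isomorphic C (susO Y) X" using isomorphicI[OF e(2,3)] .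
    then have "susO Y \<in> W" using extension_closed_iso[OF W(1) X] isomorphic_sym by blast
    then have "Y \<in> W" using W e(1) Sus_inv_image_iff[OF W(1)] by blast
    then show "X \<in> Sus_image C W" using Sus_image_isoI i by blast
  qed
  have both: "extension_closed C ((Sus_image C ^^ n) U) \<and>
      Sus_inv_image C ((Sus_image C ^^ n) U) \<subseteq> (Sus_image C ^^ n) U" for n
  proof (induction n)
    case (Suc n)
    let ?W = "(Sus_image C ^^ n) U"
    have W: "extension_closed C ?W" "Sus_inv_image C ?W \<subseteq> ?W" using Suc.IH by blast+
    have W': "extension_closed C (Sus_image C ?W)" by (rule extension_closed_Sus_image[OF W(1)])
    then have "Sus_inv_image C (Sus_image C ?W) \<subseteq> Sus_image C ?W"
      using Sus_inv_image_iff[OF W'] Sus_image_iff[OF W(1)] inc[OF W] by blast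
    with W' show ?case by simp
  qed (use U in simp)
  then show "extension_closed C ((Sus_image C ^^ n) U)" "Sus_inv_image C ((Sus_image C ^^ n) U) \<subseteq> (Sus_image C ^^ n) U"
    by blast+
  then show "(Sus_image C ^^ n) U \<subseteq> (Sus_image C ^^ Suc n) U" using inc by simp
qed

text \<open>The mirror image: here closure under the suspension itself makes the preimages
  grow.\<close>

lemma Sus_inv_image_funpow:
  assumes V: "extension_closed C V" "Sus_image C V \<subseteq> V"
  shows "extension_closed C ((Sus_inv_image C ^^ n) V)" "Sus_image C ((Sus_inv_image C ^^ n) V) \<subseteq> (Sus_inv_image C ^^ n) V"
    "(Sus_inv_image C ^^ n) V \<subseteq> (Sus_inv_image C ^^ Suc n) V"
proof -
  have inc: "W \<subseteq> Sus_inv_image C W" if W: "extension_closed C W" "Sus_image C W \<subseteq> W" for W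
  proof
    fix X assume X: "X \<in> W"
    then have "X \<in> Ob C" using W(1) unfolding extension_closed_def by blast
    then show "X \<in> Sus_inv_image C W" using X W Sus_image_iff[OF W(1)] Sus_inv_image_iff[OF W(1)] by blast
  qed
  have both: "extension_closed C ((Sus_inv_image C ^^ n) V) \<and>
      Sus_image C ((Sus_inv_image C ^^ n) V) \<subseteq> (Sus_inv_image C ^^ n) V" for n
  proof (induction n)
    case (Suc n)
    let ?W = "(Sus_inv_image C ^^ n) V"
    have W: "extension_closed C ?W" "Sus_image C ?W \<subseteq> ?W" using Suc.IH by blast+
    have W': "extension_closed C (Sus_inv_image C ?W)" by (rule extension_closed_Sus_inv_image[OF W(1)])
    have "Sus_image C (Sus_inv_image C ?W) \<subseteq> ?W"
    proof
      fix X assume "X \<in> Sus_image C (Sus_inv_image C ?W)"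
      then obtain Y where Y: "Y \<in> Sus_inv_image C ?W" "isomorphic C (susO Y) X"
        unfolding Sus_image_def by blast
      then show "X \<in> ?W" using Sus_inv_image_iff[OF W(1)] extension_closed_iso[OF W(1)] by blast
    qed
    with W' inc[OF W] show ?case by simp
  qed (use V in simp)
  then show "extension_closed C ((Sus_inv_image C ^^ n) V)" "Sus_image C ((Sus_inv_image C ^^ n) V) \<subseteq> (Sus_inv_image C ^^ n) V"
    by blast+
  then show "(Sus_inv_image C ^^ n) V \<subseteq> (Sus_inv_image C ^^ Suc n) V" using inc by simp
qed

lemma pre_weight_closed:
  assumes "pre_weight_structure C U V"
  shows "extension_closed C U" "Sus_inv_image C U \<subseteq> U" "extension_closed C V" "Sus_image C V \<subseteq> V"
  using assms unfolding pre_weight_structure_def full_additive_subcategory_def extension_closed_def by blast+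

text \<open>Iterated desuspension never leaves \<open>U\<close>, so the pieces with
  \<open>m > 0\<close> contribute nothing beyond \<open>U\<close>, and the union over the integers
  becomes a chain indexed by natural numbers.\<close>

lemma U_plus_eq:
  assumes U: "Sus_inv_image C U \<subseteq> U"
  shows "U_plus C U = (\<Union>n. (Sus_image C ^^ n) U)"
proof -
  have sub: "(Sus_inv_image C ^^ n) U \<subseteq> U" for n
  proof (induction n)
    case (Suc n)
    then show ?case using Sus_inv_image_mono[OF Suc.IH] U by auto
  qed simp
  have "X \<in> (\<Union>n. (Sus_image C ^^ n) U)" if X: "X \<in> U_ge C U m" for X m
  proof (cases "0 \<le> - m")
    case True
    then show ?thesis using X by (auto simp: U_ge_def Sus_power_def)
  next
    case False
    then have "X \<in> (Sus_image C ^^ 0) U" using X sub by (auto simp: U_ge_def Sus_power_def)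
    then show ?thesis by blast
  qed
  moreover have "(Sus_image C ^^ n) U = U_ge C U (- int n)" for n
    by (simp add: U_ge_def Sus_power_def)
  ultimately show ?thesis unfolding U_plus_def by blast
qed

lemma U_minus_eq:
  assumes V: "Sus_image C V \<subseteq> V"
  shows "U_minus C V = (\<Union>n. (Sus_inv_image C ^^ n) V)"
proof -
  have sub: "(Sus_image C ^^ n) V \<subseteq> V" for n
  proof (induction n)
    case (Suc n)
    then show ?case using Sus_image_mono[OF Suc.IH] V by auto
  qed simp
  \<comment> \<open>At exponent zero \<open>Sus_power\<close> takes the branch of
    \<open>Sus_image\<close>, so \<open>n = 0\<close> needs its own case.\<close>
  have le: "(Sus_inv_image C ^^ n) V = U_le C V (int n)" for n
    by (cases "n = 0") (simp_all add: U_le_def Sus_power_def)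
  have "X \<in> (\<Union>n. (Sus_inv_image C ^^ n) V)" if X: "X \<in> U_le C V m" for X m
  proof (cases "0 \<le> - m")
    case True
    then have "X \<in> (Sus_inv_image C ^^ 0) V" using X sub by (auto simp: U_le_def Sus_power_def)
    then show ?thesis by blast
  next
    case False
    then have "X \<in> (Sus_inv_image C ^^ nat m) V" using X by (simp add: U_le_def Sus_power_def)
    then show ?thesis by blast
  qed
  moreover have "X \<in> (\<Union>m. U_le C V m)" if "X \<in> (Sus_inv_image C ^^ n) V" for X n
    using that unfolding le by blast
  ultimately show ?thesis unfolding U_minus_def by blast
qed

text \<open>Membership in the two chains gives bounds of the form \<open>- int k\<close> and
  \<open>int l\<close>, for which the condition \<open>m \<le> n\<close> is automatic.\<close>

lemma U_bounded_eq:
  assumes U: "Sus_inv_image C U \<subseteq> U" and V: "Sus_image C V \<subseteq> V"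
  shows "U_bounded C U V = U_plus C U \<inter> U_minus C V"
proof
  show "U_bounded C U V \<subseteq> U_plus C U \<inter> U_minus C V"
    unfolding U_bounded_def U_plus_def U_minus_def by blast
  show "U_plus C U \<inter> U_minus C V \<subseteq> U_bounded C U V"
  proof
    fix X assume "X \<in> U_plus C U \<inter> U_minus C V"
    then obtain k l where kl: "X \<in> (Sus_image C ^^ k) U" "X \<in> (Sus_inv_image C ^^ l) V"
      unfolding U_plus_eq[OF U] U_minus_eq[OF V] by blast
    have "(Sus_image C ^^ k) U = U_ge C U (- int k)" by (simp add: U_ge_def Sus_power_def)
    moreover have "(Sus_inv_image C ^^ l) V = U_le C V (int l)"
      by (cases "l = 0") (simp_all add: U_le_def Sus_power_def)
    ultimately have "X \<in> U_ge C U (- int k) \<inter> U_le C V (int l)" using kl by simp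
    moreover have "- int k \<le> int l" by simp
    ultimately show "X \<in> U_bounded C U V" unfolding U_bounded_def by blast
  qed
qed

lemma triangulated_subcategory_U_plus:
  assumes U: "extension_closed C U" "Sus_inv_image C U \<subseteq> U"
  shows "triangulated_subcategory C (U_plus C U)"
  unfolding U_plus_eq[OF U(2)]
proof (rule triangulated_subcategory_Union)
  note W = Sus_image_funpow[OF U]
  show "extension_closed C ((Sus_image C ^^ n) U)" "(Sus_image C ^^ n) U \<subseteq> (Sus_image C ^^ Suc n) U" for n
    by (rule W)+
  show "\<exists>m. susO X \<in> (Sus_image C ^^ m) U" if X: "X \<in> (Sus_image C ^^ n) U" for n X
  proof -
    have "X \<in> Ob C" using W(1)[of n] X unfolding extension_closed_def by blast
    then have "susO X \<in> (Sus_image C ^^ Suc n) U" using Sus_image_iff[OF W(1)[of n]] X by simp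
    then show ?thesis ..
  qed
  show "\<exists>m. X \<in> (Sus_image C ^^ m) U" if "X \<in> Ob C" "susO X \<in> (Sus_image C ^^ n) U" for n X
    using W(2)[of n] that Sus_inv_image_iff[OF W(1)[of n]] by blast
qed

lemma triangulated_subcategory_U_minus:
  assumes V: "extension_closed C V" "Sus_image C V \<subseteq> V"
  shows "triangulated_subcategory C (U_minus C V)"
  unfolding U_minus_eq[OF V(2)]
proof (rule triangulated_subcategory_Union)
  note W = Sus_inv_image_funpow[OF V]
  show "extension_closed C ((Sus_inv_image C ^^ n) V)" "(Sus_inv_image C ^^ n) V \<subseteq> (Sus_inv_image C ^^ Suc n) V" for n
    by (rule W)+
  show "\<exists>m. susO X \<in> (Sus_inv_image C ^^ m) V" if X: "X \<in> (Sus_inv_image C ^^ n) V" for n X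
  proof -
    have "X \<in> Ob C" using W(1)[of n] X unfolding extension_closed_def by blast
    then show ?thesis using Sus_image_iff[OF W(1)[of n]] X W(2)[of n] by blast
  qed
  show "\<exists>m. X \<in> (Sus_inv_image C ^^ m) V" if X: "X \<in> Ob C" "susO X \<in> (Sus_inv_image C ^^ n) V" for n X
  proof -
    have "X \<in> (Sus_inv_image C ^^ Suc n) V" using X Sus_inv_image_iff[OF W(1)[of n]] by simp
    then show ?thesis ..
  qed
qed

text \<open>The defining decomposition has its second part in \<open>Sus_image C V\<close>, which
  lies in \<open>V\<close> and hence in \<open>U_minus C V\<close>.\<close>

lemma star_U_plus_U_minus:
  assumes "pre_weight_structure C U V"
  shows "star C (U_plus C U) (U_minus C V) = Ob C"
proof
  note W = pre_weight_closed[OF assms]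
  show "star C (U_plus C U) (U_minus C V) \<subseteq> Ob C"
  proof
    fix Z assume "Z \<in> star C (U_plus C U) (U_minus C V)"
    then obtain X Y f g h where "triangle C X Z Y f g h" by (rule starE)
    from triangle_Mor(1)[OF this] show "Z \<in> Ob C" by simp
  qed
  have "(Sus_image C ^^ 0) U \<subseteq> U_plus C U" unfolding U_plus_eq[OF W(2)] by blast
  moreover have "(Sus_inv_image C ^^ 0) V \<subseteq> U_minus C V" unfolding U_minus_eq[OF W(4)] by blast
  ultimately have "star C U (Sus_image C V) \<subseteq> star C (U_plus C U) (U_minus C V)"
    using W(4) unfolding star_def by fastforce
  then show "Ob C \<subseteq> star C (U_plus C U) (U_minus C V)"
    using assms unfolding pre_weight_structure_def by simp
qed

lemma triangulated_subcategory_Int: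
  assumes "triangulated_subcategory C P" "triangulated_subcategory C M"
  shows "triangulated_subcategory C (P \<inter> M)"
proof -
  interpret P: triangulated_sub C P by unfold_locales (rule assms)
  interpret M: triangulated_sub C M by unfold_locales (rule assms)
  obtain z where "zero_object C z" using ex_zero_object by blast
  then have "z \<in> P \<inter> M" "zero_object C z" using P.N_zero M.N_zero by blast+
  moreover have "\<forall>(f, g, h) \<in> Tri C. Dom C f \<in> P \<inter> M \<and> Cod C f \<in> P \<inter> M \<longrightarrow> Cod C g \<in> P \<inter> M"
    using triangleI P.N_third M.N_third by blast
  moreover have "\<forall>X \<in> P \<inter> M. \<forall>Y \<in> Ob C. isomorphic C X Y \<longrightarrow> Y \<in> P \<inter> M"
    using P.N_iso M.N_iso by blast
  moreover have "\<forall>X \<in> Ob C. X \<in> P \<inter> M \<longleftrightarrow> susO X \<in> P \<inter> M" using P.N_sus M.N_sus by blast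
  moreover have "P \<inter> M \<subseteq> Ob C" using P.N_Ob by blast
  ultimately show ?thesis unfolding triangulated_subcategory_def by blast
qed

end

section \<open>The semi-orthogonal decomposition\<close>

text \<open>The inclusion of \<open>N\<close> in \<open>A\<close> keeps the apex of a roof in
  \<open>A\<close>: the cone of its denominator lies in \<open>N\<close>, so two vertices of a
  triangle are in \<open>A\<close>. A cone in the quotient is then the cone of a numerator between
  objects of \<open>A\<close>.\<close>

lemma (in verdier) triangulated_subcategory_essential:
  assumes A: "triangulated_subcategory C A" and NA: "N \<subseteq> A"
  shows "triangulated_subcategory L {Y \<in> Ob C. \<exists>X \<in> A. isomorphic L X Y}" (is "triangulated_subcategory L ?E")
  unfolding triangulated_subcategory_def
proof (intro conjI ballI impI)
  interpret A: triangulated_sub C A by unfold_locales (rule A)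
  show "?E \<subseteq> Ob L" by auto
  obtain z where z: "zero_object C z" using ex_zero_object by blast
  then have "z \<in> Ob C" by (simp add: zero_object_def)
  then have "z \<in> ?E" using A.N_zero[OF z] L.isomorphic_refl[of z] by auto
  then show "\<exists>Z \<in> ?E. zero_object L Z" using zero_object_L[OF z] by blast
  show "Y \<in> ?E" if "X \<in> ?E" "Y \<in> Ob L" "isomorphic L X Y" for X Y
    using that L.isomorphic_trans by auto
  show "X \<in> ?E \<longleftrightarrow> FO (Sus L) X \<in> ?E" if "X \<in> Ob L" for X
  proof
    have X: "X \<in> Ob C" using that by simp
    {
      assume "X \<in> ?E"
      then obtain Y where Y: "Y \<in> A" "isomorphic L Y X" by blast
      then have "susO Y \<in> A" using A.N_sus[of Y] by simp
      then show "FO (Sus L) X \<in> ?E" using SL.isomorphic_FO[OF Y(2)] X by auto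
    next
      assume "FO (Sus L) X \<in> ?E"
      then obtain Y where Y: "Y \<in> A" "isomorphic L Y (susO X)" by auto
      have YO: "Y \<in> Ob C" using Y by simp
      \<comment> \<open>To descend from \<open>susO X\<close> to \<open>X\<close>, desuspend
        \<open>Y\<close> in \<open>C\<close> and reflect the isomorphism along the suspension of the
        quotient.\<close>
      then obtain Y' e where e: "Y' \<in> Ob C" "e \<in> Mor C (susO Y') Y" "is_isomorphism C e" by (rule sus_essE)
      have i: "isomorphic C (susO Y') Y" using isomorphicI[OF e(2,3)] .
      then have "susO Y' \<in> A" using A.N_iso[OF Y(1)] isomorphic_sym by blast
      then have Y': "Y' \<in> A" using A.N_sus[OF e(1)] by simp
      have "isomorphic L (susO Y') Y" using Q.isomorphic_FO[OF i] by simp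
      then have "isomorphic L (FO (Sus L) Y') (FO (Sus L) X)"
        using L.isomorphic_trans[OF _ Y(2)] by simp
      then have "isomorphic L Y' X" using L.sus.reflects_isomorphic[of Y' X] e(1) X by simp
      then show "X \<in> ?E" using X Y' by blast
    }
  qed
  fix t assume t: "t \<in> Tri L"
  obtain \<phi> \<gamma> \<psi> where te: "t = (\<phi>, \<gamma>, \<psi>)" by (cases t)
  have "Cod L \<gamma> \<in> ?E" if E: "Dom L \<phi> \<in> ?E" "Cod L \<phi> \<in> ?E"
  proof -
    note T = L.triangleI[OF t[unfolded te]]
    note m = triangle_Mor(1-3)[OF T]
    obtain X i where X: "X \<in> A" and i: "i \<in> Mor L X (Dom L \<phi>)" "is_isomorphism L i"
      using E(1) by (blast elim: L.isomorphicE)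
    obtain Y j where Y: "Y \<in> A" and j: "j \<in> Mor L Y (Cod L \<phi>)" "is_isomorphism L j"
      using E(2) by (blast elim: L.isomorphicE)
    have "\<phi> \<odot> i \<in> Mor L X (Cod L \<phi>)" using m(1) i(1) by simp
    then obtain \<phi>0 where \<phi>0: "\<phi>0 \<in> Mor L X Y" "j \<odot> \<phi>0 = \<phi> \<odot> i" by (rule L.iso_lift[OF j(2,1)])
    obtain W s f where s: "s \<in> Mor C W X" "s \<in> den" and f: "f \<in> Mor C W Y" and eq: "\<phi>0 \<odot> Q s = Q f"
      using Q_E[OF \<phi>0(1)] by metis
    obtain D p q where D: "triangle C W X D s p q" using cone_ex[OF s(1)] .
    have "D \<in> A" using den_iff_cone[OF D] s(2) NA by blast
    then have W: "W \<in> A" by (rule A.N_first[OF D X])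
    obtain Z g h where S: "triangle C W Y Z f g h" using cone_ex[OF f] .
    have Z: "Z \<in> A" by (rule A.N_third[OF S W Y])
    have is_W: "i \<odot> Q s \<in> Mor L W (Dom L \<phi>)" "is_isomorphism L (i \<odot> Q s)"
      using i s Q_iso[OF s(2)] by simp_all
    have "j \<odot> Q f = \<phi> \<odot> (i \<odot> Q s)"
      using j(1) \<phi>0(1) i(1) m(1) s(1) by (simp add: L.Cmp_ext[OF \<phi>0(2)] flip: eq)
    then obtain c where "c \<in> Mor L Z (Cod L \<gamma>)" "is_isomorphism L c"
      by (rule L.triangle_iso_ex[OF Q_triangle[OF S] T is_W j])
    then have "isomorphic L Z (Cod L \<gamma>)" by (rule L.isomorphicI)
    then show ?thesis using Z m by auto
  qed
  then show "case t of (\<phi>, \<gamma>, \<psi>) \<Rightarrow> Dom L \<phi> \<in> ?E \<and> Cod L \<phi> \<in> ?E \<longrightarrow> Cod L \<gamma> \<in> ?E"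
    unfolding te prod.case by blast
qed

locale star_decomposition = P: verdier C P + M: verdier C M
  for C :: "('o, 'm) triangulated_data" (structure) and P M +
  assumes star_eq: "star C P M = Ob C"
begin

abbreviation B where "B \<equiv> P \<inter> M"

lemma verdier_B: "verdier C B"
  by unfold_locales
    (rule P.triangulated_subcategory_Int[OF P.triangulated_subcategory M.triangulated_subcategory])

end

sublocale star_decomposition \<subseteq> B: verdier C "P \<inter> M"
  by (rule verdier_B)

sublocale star_decomposition \<subseteq> PC: canonical C P "P \<inter> M" M
  by unfold_locales auto

sublocale star_decomposition \<subseteq> MC: canonical C M "P \<inter> M" P
  by unfold_locales auto

context star_decomposition
begin

text \<open>The cone of \<open>f\<close> is \<open>Y\<close> and the cone of \<open>g\<close> is the
  suspension of \<open>X\<close>, so these arrows become invertible modulo \<open>M\<close> and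
  modulo \<open>P\<close> respectively.\<close>

lemma decompose:
  assumes "Z \<in> Ob C"
  obtains X Y f g h where "triangle C X Z Y f g h" "X \<in> P" "Y \<in> M" "f \<in> M.den" "g \<in> P.den"
proof -
  obtain X Y f g h where T: "triangle C X Z Y f g h" and XY: "X \<in> P" "Y \<in> M"
    using assms P.starE unfolding star_eq[symmetric] by blast
  have "f \<in> M.den" using M.den_iff_cone[OF T] XY by blast
  moreover have "P.susO X \<in> P" using P.N_sus XY by simp
  then have "g \<in> P.den" using P.den_iff_cone[OF P.rotate[OF T]] by blast
  ultimately show thesis using that T XY by blast
qed

text \<open>Pushing the fibre of \<open>f\<close> into \<open>P\<close> turns it into a denominator for \<open>P \<inter> M\<close>, and \<open>f\<close> vanishes
  on it.\<close>

lemma Mor_P_M_killed: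
  assumes f: "f \<in> Mor C W Y" and W: "W \<in> P" and Y: "Y \<in> M"
  obtains V q where "q \<in> Mor C V W" "q \<in> B.den" "V \<in> P" "f \<cdot> q = Zero C V Y"
proof -
  obtain F u h where T: "triangle C F W Y u f h" using P.fibre_ex[OF f] .
  note t = triangle_Mor(1-3)[OF T]
  have "F \<in> Ob C" using t by simp
  then obtain V Y' x y k where V: "triangle C V F Y' x y k" "V \<in> P" "x \<in> M.den" using decompose by metis
  have x: "x \<in> Mor C V F" using triangle_Mor(1)[OF V(1)] .
  have ux: "u \<cdot> x \<in> Mor C V W" using x t by simp
  have "u \<in> M.den" using M.den_iff_cone[OF T] Y by simp
  then have "u \<cdot> x \<in> M.den" using V(3) x t by simp
  moreover obtain D p d where D: "triangle C V W D (u \<cdot> x) p d" using P.cone_ex[OF ux] .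
  ultimately have "D \<in> P \<inter> M" using M.den_iff_cone[OF D] P.N_third[OF D V(2) W] by blast
  then have "u \<cdot> x \<in> B.den" using B.den_iff_cone[OF D] by blast
  moreover have "f \<cdot> (u \<cdot> x) = Zero C V Y"
    using P.triangle_comp_zero(1)[OF T] x t by (simp add: P.Cmp_ext[OF P.triangle_comp_zero(1)[OF T]])
  ultimately show thesis using that ux V(2) by blast
qed

text \<open>Since \<open>P \<inter> M\<close> is contained in \<open>P\<close>, the apex of a roof
  that starts in \<open>P\<close> stays in \<open>P\<close>, and its numerator is then killed by
  \<open>Mor_P_M_killed\<close>.\<close>

lemma Mor_B_P_M_zero:
  assumes X: "X \<in> P" and Y: "Y \<in> M" and \<alpha>: "\<alpha> \<in> Mor B.L X Y"
  shows "\<alpha> = Zero B.L X Y"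
proof -
  obtain W s f where s: "s \<in> Mor C W X" "s \<in> B.den" and f: "f \<in> Mor C W Y" and eq: "\<alpha> \<cdot>\<^bsub>B.L\<^esub> B.Q s = B.Q f"
    using B.Q_E[OF \<alpha>] by metis
  obtain D p q where D: "triangle C W X D s p q" using P.cone_ex[OF s(1)] .
  have "D \<in> P" using B.den_iff_cone[OF D] s(2) by blast
  then have W: "W \<in> P" by (rule P.N_first[OF D X])
  obtain V r where r: "r \<in> Mor C V W" "r \<in> B.den" "V \<in> P" "f \<cdot> r = Zero C V Y"
    using Mor_P_M_killed[OF f W Y] .
  have "f \<cdot> r = Zero C W Y \<cdot> r" "Zero C W Y \<in> Mor C W Y" using r f by simp_all
  then have "B.Q f = B.Q (Zero C W Y)" using B.Q_eq_iff[OF f] r(1,2) by blast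
  then have *: "\<alpha> \<cdot>\<^bsub>B.L\<^esub> B.Q s = Zero B.L X Y \<cdot>\<^bsub>B.L\<^esub> B.Q s" using eq s f by simp
  show ?thesis
    by (rule B.L.iso_cancel_right[OF B.Q_iso[OF s(2)] _ _ _ _ *]) (use \<alpha> s in simp_all)
qed

text \<open>The two quotients appear in the ambient one as essential images, so the vanishing of
  arrows is transported along isomorphisms from objects of \<open>P\<close> and
  \<open>M\<close>.\<close>

lemma semiorthogonal:
  "semiorthogonal_decomposition B.L {Y \<in> Ob C. \<exists>X \<in> M. isomorphic B.L X Y}
    {Y \<in> Ob C. \<exists>X \<in> P. isomorphic B.L X Y}"
  (is "semiorthogonal_decomposition _ ?M ?P")
  unfolding semiorthogonal_decomposition_def
proof (intro conjI B.triangulated_category_L ballI)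
  show "triangulated_subcategory B.L ?P" "triangulated_subcategory B.L ?M"
    by (rule B.triangulated_subcategory_essential P.triangulated_subcategory M.triangulated_subcategory
        inf_le1 inf_le2)+
  have sub: "X \<in> P \<Longrightarrow> X \<in> ?P" "X \<in> M \<Longrightarrow> X \<in> ?M" for X
    using B.L.isomorphic_refl[of X] by auto
  show "star B.L ?P ?M = Ob B.L"
  proof
    show "star B.L ?P ?M \<subseteq> Ob B.L"
    proof
      fix Z assume "Z \<in> star B.L ?P ?M"
      then obtain X Y f g h where "triangle B.L X Z Y f g h" by (rule B.L.starE)
      from triangle_Mor(1)[OF this] show "Z \<in> Ob B.L" by simp
    qed
    show "Ob B.L \<subseteq> star B.L ?P ?M"
    proof
      fix Z assume "Z \<in> Ob B.L"
      then have "Z \<in> Ob C" by simp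
      then obtain X Y f g h where T: "triangle C X Z Y f g h" "X \<in> P" "Y \<in> M" by (rule decompose)
      from B.L.starI[OF B.Q_triangle[OF T(1)]] T(2,3) sub show "Z \<in> star B.L ?P ?M" by blast
    qed
  qed
  fix X Y assume "X \<in> ?P" "Y \<in> ?M"
  then obtain X' Y' where X': "X' \<in> P" "isomorphic B.L X' X" and Y': "Y' \<in> M" "isomorphic B.L Y' Y" by blast
  obtain a where a: "a \<in> Mor B.L X' X" "is_isomorphism B.L a" using X'(2) by (rule B.L.isomorphicE)
  obtain b where b: "b \<in> Mor B.L Y Y'" "is_isomorphism B.L b"
    using B.L.isomorphic_sym[OF Y'(2)] by (rule B.L.isomorphicE)
  have "\<alpha> = Zero B.L X Y" if \<alpha>: "\<alpha> \<in> Mor B.L X Y" for \<alpha>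
  proof -
    have "b \<cdot>\<^bsub>B.L\<^esub> (\<alpha> \<cdot>\<^bsub>B.L\<^esub> a) \<in> Mor B.L X' Y'" using a b \<alpha> by simp
    then have "b \<cdot>\<^bsub>B.L\<^esub> (\<alpha> \<cdot>\<^bsub>B.L\<^esub> a) = Zero B.L X' Y'" by (rule Mor_B_P_M_zero[OF X'(1) Y'(1)])
    then have 1: "b \<cdot>\<^bsub>B.L\<^esub> (\<alpha> \<cdot>\<^bsub>B.L\<^esub> a) = b \<cdot>\<^bsub>B.L\<^esub> (Zero B.L X Y \<cdot>\<^bsub>B.L\<^esub> a)"
      using a b by simp
    have 2: "\<alpha> \<cdot>\<^bsub>B.L\<^esub> a = Zero B.L X Y \<cdot>\<^bsub>B.L\<^esub> a"
      by (rule B.L.iso_cancel_left[OF b(2) _ _ _ _ 1]) (use a b \<alpha> in simp_all)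
    show ?thesis
      by (rule B.L.iso_cancel_right[OF a(2) _ _ _ _ 2]) (use a b \<alpha> in simp_all)
  qed
  moreover have "Zero B.L X Y \<in> Mor B.L X Y" using a b by simp
  ultimately show "Mor B.L X Y = {Zero B.L X Y}" by blast
qed

text \<open>Precomposing with the \<open>P\<close>-part of the apex keeps a denominator for
  \<open>M\<close> and puts both of its ends into \<open>P\<close>, hence its cone into
  \<open>P \<inter> M\<close>.\<close>

lemma den_M_into_P:
  assumes "s \<in> Mor C W X" "s \<in> M.den" "X \<in> P"
  obtains V q where "q \<in> Mor C V W" "q \<in> M.den" "V \<in> P" "s \<cdot> q \<in> B.den"
proof -
  have "W \<in> Ob C" using assms by simp
  then obtain V Y q g h where T: "triangle C V W Y q g h" "V \<in> P" "q \<in> M.den" by (rule decompose)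
  have q: "q \<in> Mor C V W" using triangle_Mor(1)[OF T(1)] .
  have sq: "s \<cdot> q \<in> Mor C V X" "s \<cdot> q \<in> M.den" using assms q T(3) by simp_all
  obtain D p d where D: "triangle C V X D (s \<cdot> q) p d" using P.cone_ex[OF sq(1)] .
  have "D \<in> P \<inter> M" using M.den_iff_cone[OF D] sq(2) P.N_third[OF D T(2) assms(3)] by blast
  then have "s \<cdot> q \<in> B.den" using B.den_iff_cone[OF D] by blast
  then show thesis using that q T by blast
qed

text \<open>Fullness and faithfulness both reduce to \<open>den_M_into_P\<close>, applied to the
  denominator of a roof and to an arrow that kills a numerator. Every object is isomorphic to its
  \<open>P\<close>-part modulo \<open>M\<close>.\<close>

lemma plus_equivalence:
  "triangle_equivalence PC.D.L M.L PC.can (\<lambda>X. Id M.L (FO (Sus C) X))"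
proof (rule PC.can_triangle_equivalenceI)
  fix X Y W s f assume X: "X \<in> P" and s: "s \<in> Mor C W X" "s \<in> M.den" and f: "f \<in> Mor C W Y"
  obtain V q where q: "q \<in> Mor C V W" "q \<in> M.den" "V \<in> P" "s \<cdot> q \<in> B.den" using den_M_into_P[OF s X] .
  have "s \<cdot> q \<in> Mor C V X" "f \<cdot> q \<in> Mor C V Y" using s f q by simp_all
  then show "\<exists>W' s' f'. W' \<in> P \<and> s' \<in> Mor C W' X \<and> s' \<in> B.den \<and> f' \<in> Mor C W' Y \<and> M.frac s' f' = M.frac s f"
    using q M.frac_refine[OF s f q(1,2)] by blast
next
  fix W Y f V q assume W: "W \<in> P" and f: "f \<in> Mor C W Y" and q: "q \<in> Mor C V W" "q \<in> M.den" "f \<cdot> q = Zero C V Y"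
  obtain V' r where r: "r \<in> Mor C V' V" "V' \<in> P" "q \<cdot> r \<in> B.den" using den_M_into_P[OF q(1,2) W] by metis
  have "f \<cdot> (q \<cdot> r) = Zero C V' Y" "q \<cdot> r \<in> Mor C V' W"
    using f q(1) r(1) by (simp_all add: P.Cmp_ext[OF q(3)])
  then show "\<exists>V' q'. V' \<in> P \<and> q' \<in> Mor C V' W \<and> q' \<in> B.den \<and> f \<cdot> q' = Zero C V' Y"
    using r by blast
next
  fix Z assume "Z \<in> Ob C"
  then obtain X Y f g h where T: "triangle C X Z Y f g h" "X \<in> P" "f \<in> M.den" by (rule decompose)
  have "M.Q f \<in> Mor M.L X Z" using triangle_Mor(1)[OF T(1)] by simp
  then have "isomorphic M.L X Z" using M.Q_iso[OF T(3)] by (rule M.L.isomorphicI)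
  then show "\<exists>X \<in> P. isomorphic M.L X Z" using T(2) by blast
qed

lemma minus_equivalence:
  "triangle_equivalence MC.D.L P.L MC.can (\<lambda>X. Id P.L (FO (Sus C) X))"
proof (rule MC.can_triangle_equivalenceI)
  fix X Y W s f assume X: "X \<in> M" and Y: "Y \<in> M" and s: "s \<in> Mor C W X" "s \<in> P.den" and f: "f \<in> Mor C W Y"
  have "W \<in> Ob C" using s by simp
  then obtain A D a w k where T: "triangle C A W D a w k" "A \<in> P" "D \<in> M" "a \<in> M.den" by (rule decompose) blast
  have a: "a \<in> Mor C A W" using triangle_Mor(1)[OF T(1)] .
  \<comment> \<open>Kill \<open>s\<close> first and then \<open>f\<close> on the smaller object, so
    that both legs vanish on the arrow \<open>r\<close> below.\<close>
  have "s \<cdot> a \<in> Mor C A X" using s a by simp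
  then obtain A1 q1 where q1: "q1 \<in> Mor C A1 A" "q1 \<in> B.den" "A1 \<in> P" "(s \<cdot> a) \<cdot> q1 = Zero C A1 X"
    using Mor_P_M_killed[OF _ T(2) X] by metis
  have "f \<cdot> (a \<cdot> q1) \<in> Mor C A1 Y" using f a q1 by simp
  then obtain A2 q2 where q2: "q2 \<in> Mor C A2 A1" "q2 \<in> B.den" "A2 \<in> P" "(f \<cdot> (a \<cdot> q1)) \<cdot> q2 = Zero C A2 Y"
    using Mor_P_M_killed[OF _ q1(3) Y] by metis
  define r where "r = a \<cdot> (q1 \<cdot> q2)"
  have r: "r \<in> Mor C A2 W" using a q1 q2 by (simp add: r_def)
  \<comment> \<open>Denominators for \<open>P \<inter> M\<close> are denominators for
    \<open>M\<close>, so after the shrinking the cone of \<open>r\<close> still lies in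
    \<open>M\<close>.\<close>
  have rM: "r \<in> M.den" using a T(4) q1(1) q2(1) PC.den_mono[OF q1(2)] PC.den_mono[OF q2(2)] by (simp add: r_def)
  have saq: "s \<cdot> (a \<cdot> q1) = Zero C A1 X" using q1(1,4) s a by simp
  have sr: "s \<cdot> r = Zero C A2 X"
    using s a q1(1) q2(1) P.Cmp_ext[OF saq, of q2] by (simp add: r_def)
  have fr: "f \<cdot> r = Zero C A2 Y" using f a q1(1) q2(1,4) by (simp add: r_def)
  obtain E e k' where E: "triangle C A2 W E r e k'" using P.cone_ex[OF r] .
  note m = triangle_Mor(2)[OF E]
  have EM: "E \<in> M" using M.den_iff_cone[OF E] rM by blast
  have "P.susO A2 \<in> P" using P.N_sus q2(3) by simp
  then have e: "e \<in> P.den" using P.den_iff_cone[OF P.rotate[OF E]] by blast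
  \<comment> \<open>Both legs vanish on \<open>r\<close>, hence factor through its cone
    \<open>E\<close>, along the denominator \<open>e\<close> for \<open>P\<close>.\<close>
  obtain s' where s': "s' \<in> Mor C E X" "s' \<cdot> e = s" using P.weak_cokernel[OF E s(1) sr] .
  obtain f' where f': "f' \<in> Mor C E Y" "f' \<cdot> e = f" using P.weak_cokernel[OF E f fr] .
  \<comment> \<open>Two-of-three makes \<open>s'\<close> a denominator for \<open>P\<close>. As both
    of its ends lie in \<open>M\<close>, its cone lies in \<open>P \<inter> M\<close>.\<close>
  have s'P: "s' \<in> P.den" using P.den_two_of_three(3)[OF m s'(1)] s' s(2) e by simp
  obtain D' p d where D': "triangle C E X D' s' p d" using P.cone_ex[OF s'(1)] .
  have "D' \<in> P \<inter> M" using P.den_iff_cone[OF D'] s'P M.N_third[OF D' EM X] by blast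
  then have "s' \<in> B.den" using B.den_iff_cone[OF D'] by blast
  moreover have "P.frac s' f' = P.frac s f"
    using P.frac_refine[OF s'(1) s'P f'(1) m e] s'(2) f'(2) by simp
  ultimately show "\<exists>W' s' f'. W' \<in> M \<and> s' \<in> Mor C W' X \<and> s' \<in> B.den \<and> f' \<in> Mor C W' Y \<and> P.frac s' f' = P.frac s f"
    using EM s'(1) f'(1) by blast
next
  fix W Y f V q assume W: "W \<in> M" and Y: "Y \<in> M" and f: "f \<in> Mor C W Y"
    and q: "q \<in> Mor C V W" "q \<in> P.den" "f \<cdot> q = Zero C V Y"
  \<comment> \<open>The cone \<open>A\<close> of \<open>q\<close> lies in \<open>P\<close>, and
    \<open>f\<close> factors through it as \<open>e \<cdot> c\<close>. A denominator for
    \<open>P \<inter> M\<close> kills \<open>e\<close>, and pulling it back along \<open>c\<close>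
    gives one that kills \<open>f\<close>.\<close>
  obtain A c d where T: "triangle C V W A q c d" using P.cone_ex[OF q(1)] .
  have c: "c \<in> Mor C W A" using triangle_Mor(2)[OF T] .
  have A: "A \<in> P" using P.den_iff_cone[OF T] q(2) by blast
  obtain e where e: "e \<in> Mor C A Y" "e \<cdot> c = f" using P.weak_cokernel[OF T f q(3)] .
  obtain A' q' where q': "q' \<in> Mor C A' A" "q' \<in> B.den" "e \<cdot> q' = Zero C A' Y"
    using Mor_P_M_killed[OF e(1) A Y] by metis
  obtain R r c' where r: "r \<in> Mor C R W" "r \<in> B.den" "c' \<in> Mor C R A'" "c \<cdot> r = q' \<cdot> c'"
    using B.den_Ore[OF q'(1,2) c] .
  have "f \<cdot> r = e \<cdot> (c \<cdot> r)" using e(1) c r(1) by (simp add: P.Cmp_ext[OF e(2)] del: r(4))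
  also have "\<dots> = Zero C R Y" unfolding r(4) using e(1) q'(1) r(3) by (simp add: P.Cmp_ext[OF q'(3)])
  finally have fr: "f \<cdot> r = Zero C R Y" .
  \<comment> \<open>\<open>R\<close> lies in \<open>M\<close> because \<open>W\<close> and the cone
    of \<open>r\<close> do.\<close>
  obtain D p d' where D: "triangle C R W D r p d'" using P.cone_ex[OF r(1)] .
  have "D \<in> M" using B.den_iff_cone[OF D] r(2) by blast
  then have "R \<in> M" by (rule M.N_first[OF D W])
  then show "\<exists>V' q'. V' \<in> M \<and> q' \<in> Mor C V' W \<and> q' \<in> B.den \<and> f \<cdot> q' = Zero C V' Y"
    using r fr by blast
next
  fix Z assume "Z \<in> Ob C"
  then obtain X Y f g h where T: "triangle C X Z Y f g h" "Y \<in> M" "g \<in> P.den" by (rule decompose)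
  have "P.Q g \<in> Mor P.L Z Y" using triangle_Mor(2)[OF T(1)] by simp
  then have "isomorphic P.L Z Y" using P.Q_iso[OF T(3)] by (rule P.L.isomorphicI)
  then show "\<exists>X \<in> M. isomorphic P.L X Z" using T(2) P.L.isomorphic_sym by blast
qed

end

text \<open>The canonical functor is the identity on objects, so its essential image is the closure
  of \<open>A\<close> under isomorphism in the quotient, the form in which
  \<open>semiorthogonal\<close> is stated.\<close>

lemma essential_image_canonical:
  "essential_image (verdier_quotient (full_subcategory T A) N) (verdier_quotient T N) (canonical_functor T N) =
    {Y \<in> Ob T. \<exists>X \<in> A. isomorphic (verdier_quotient T N) X Y}"
  by (simp add: essential_image_def canonical_functor_def induced_functor_def verdier_quotient_def
      suspended_data.defs triangulated_data.defs localization_def full_subcategory_def)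

theorem proposition3p10:
  fixes T :: "('o, 'm) triangulated_data"
    and U V :: "'o set"
  assumes "triangulated_category T"
    and "pre_weight_structure T U V"
  shows
    "let Up = U_plus T U; Um = U_minus T V; Ub = U_bounded T U V;
         QT = verdier_quotient T Ub;
         Qp = verdier_quotient (full_subcategory T Up) Ub;
         Qm = verdier_quotient (full_subcategory T Um) Ub
     in semiorthogonal_decomposition QT
          (essential_image Qm QT (canonical_functor T Ub))
          (essential_image Qp QT (canonical_functor T Ub)) \<and>
        triangle_equivalence Qp (verdier_quotient T Um) (canonical_functor T Um)
          (\<lambda>X. Id (verdier_quotient T Um) (FO (Sus T) X)) \<and>
        triangle_equivalence Qm (verdier_quotient T Up) (canonical_functor T Up)
          (\<lambda>X. Id (verdier_quotient T Up) (FO (Sus T) X))"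
proof -
  interpret T: triangulated_category T by fact
  note W = T.pre_weight_closed[OF assms(2)]
  interpret star_decomposition T "U_plus T U" "U_minus T V"
    by unfold_locales
      (rule T.triangulated_subcategory_U_plus[OF W(1,2)] T.triangulated_subcategory_U_minus[OF W(3,4)]
        T.star_U_plus_U_minus[OF assms(2)])+
  show ?thesis
    unfolding Let_def T.U_bounded_eq[OF W(2,4)] essential_image_canonical
    using semiorthogonal plus_equivalence minus_equivalence by blast
qed

end
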